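(* Let $h(x)=-x\log_2 x-(1-x)\log_2(1-x)$ denote the binary entropy function (with $h(0)=h(1)=0$). Let $b\in(0,1)$ be the larger of the two roots in $(0,1)$ of $h(x)(2-h(x))-h(2x-x^2)$ (numerically $b\approx 0.3294547385$), let $a=\frac{1-h(b)}{2-h(b)}$, and let $c=a+(1-a)b\approx 0.3823455$. Let $n\ge 1$ and let $\mathcal{F}\subseteq 2^{[n]}$ be a union-closed family (i.e. $A\cup B\in\mathcal{F}$ for all $A,B\in\mathcal{F}$) containing at least one nonempty set. Then there is an element $i\in[n]$ that belongs to at least $c\,|\mathcal{F}|$ sets of $\mathcal{F}$.
   Context: $[n]=\{1,\dots,n\}$ and $2^{[n]}$ is the power set of $[n]$. *)

theory Defs
  imports Complex_Main
begin

text \<open>The binary entropy function. The endpoint convention \<open>h(0) = h(1) = 0\<close> needs no case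
  distinction, as the logarithm is total and the undefined value at 0 is multiplied by 0.\<close>

definition bin_entropy :: "real \<Rightarrow> real" where
  "bin_entropy x = - x * log 2 x - (1 - x) * log 2 (1 - x)"

lemma bin_entropy_0 [simp]: "bin_entropy 0 = 0"
  and bin_entropy_1 [simp]: "bin_entropy 1 = 0"
  by (simp_all add: bin_entropy_def)

definition gap :: "real \<Rightarrow> real" where
  "gap x = bin_entropy x * (2 - bin_entropy x) - bin_entropy (2 * x - x\<^sup>2)"

text \<open>The function \<^const>\<open>gap\<close> has exactly two roots in the open unit interval, so the larger of
  the two is the greatest one (about 0.3294547385).\<close>

definition b_const :: real where
  "b_const = (GREATEST x. 0 < x \<and> x < 1 \<and> gap x = 0)"

definition a_const :: real where
  "a_const = (1 - bin_entropy b_const) / (2 - bin_entropy b_const)"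

definition c_const :: real where
  "c_const = a_const + (1 - a_const) * b_const"

definition union_closed :: "'a set set \<Rightarrow> bool" where
  "union_closed F \<longleftrightarrow> (\<forall>A\<in>F. \<forall>B\<in>F. A \<union> B \<in> F)"

end

theory Submission
  imports Defs "HOL-Analysis.Analysis"
begin

text \<open>Couple two uniformly distributed members \<open>A\<close>, \<open>B\<close> of \<open>F\<close>. As \<open>A \<union> B \<in> F\<close>, its entropy is at most
  \<open>ln |F|\<close>, the entropy of \<open>A\<close>. Two couplings are combined with weights \<open>1 - al\<close> and \<open>al\<close>: the
  independent one, and one that reveals the elements of \<open>A\<close> and \<open>B\<close> one after the other and makes the
  conditional probability of \<open>k \<notin> A \<union> B\<close> as close to \<open>1/2\<close> as possible. Let \<open>X\<close>, \<open>Y\<close> be independent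
  copies of the conditional probability of \<open>k \<notin> A\<close>, given what was revealed before. If every element
  were in fewer than \<open>c |F|\<close> sets, then \<open>E X > m = 1 - c\<close> for all \<open>k\<close>, and the chain rule gives a
  contradiction once \<open>(1 - al) E (ent (X Y)) + 2 al E (g X) \<ge> (E X / m) E (ent X)\<close>. Here \<open>g\<close> is
  a function for which \<open>g x + g y\<close> bounds the entropy of the second coupling from below.

  This follows by integrating a pointwise inequality
  \<open>rh ent (x y) \<ge> x ent y + y ent x - cut y excess x - cut x excess y\<close>. After division by \<open>x y\<close> and
  the substitution \<open>x = exp (- u)\<close>, \<open>y = exp (- v)\<close> the two sides are built from functions that are
  concave in \<open>u\<close> and \<open>v\<close>, which reduces the inequality for the most part to the diagonal \<open>u = v\<close>.
  There the difference of the two sides has a double zero at \<open>x = 1 - b\<close>. It vanishes at this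
  point because \<open>gap b = 0\<close>, and its derivative vanishes for exactly one value of \<open>al\<close>.\<close>

section \<open>Families of sets and their entropy\<close>

text \<open>The constants come from one law: \<open>X = 1 - b\<close> with probability
  \<open>1 - a\<close> and \<open>X = 0\<close> with probability \<open>a\<close>, of mean
  \<open>(1 - a) * (1 - b) = m\<close>. For it \<open>gap b = 0\<close> says that
  \<open>E ent (X Y) = E ent X\<close>, and the formula for \<open>a\<close> says that
  \<open>2 E (g X) = E ent X\<close>. Both couplings are tight for this law, whatever their weights.
  Hence the pointwise inequality has no slack at \<open>x = y = 1 - b\<close>, where exact
  identities are required; away from there rational bounds for \<open>al\<close> and
  \<open>m\<close> are enough. The bound for the second coupling is a sum \<open>g x + g y\<close>
  because this coupling makes the histories of \<open>A\<close> and \<open>B\<close> dependent.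
  Their joint law is out of reach, but the coupling leaves the two marginals unchanged, and the mean
  of a sum depends on nothing else.\<close>

definition ent :: "real \<Rightarrow> real" where
  "ent x = - x * ln x - (1 - x) * ln (1 - x)"

lemma bin_entropy_eq_ent: "bin_entropy x = ent x / ln 2"
  by (simp add: bin_entropy_def ent_def log_def field_split_simps)

lemma ent_0 [simp]: "ent 0 = 0" and ent_1 [simp]: "ent 1 = 0"
  by (simp_all add: ent_def)

lemma ent_sym: "ent (1 - x) = ent x"
  by (simp add: ent_def algebra_simps)

text \<open>\<open>ln t \<le> t - 1\<close> at \<open>t = K / (z * S)\<close>, multiplied by
  \<open>z\<close>. Summed over the outcomes of a law with probabilities \<open>z\<close>, it is
  Gibbs' inequality for unnormalised weights \<open>K\<close> of total \<open>S\<close>.\<close>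

lemma mult_ln_le:
  fixes z K S :: real
  assumes "0 \<le> z" "0 \<le> K" "0 < z \<Longrightarrow> 0 < K" "0 < S"
  shows "z * ln K - z * ln z \<le> K / S - z + z * ln S"
proof (cases "z = 0")
  case True
  then show ?thesis using assms by simp
next
  case False
  then have z: "z > 0" "K > 0" using assms by auto
  have "ln (K / (z * S)) \<le> K / (z * S) - 1"
    using z assms by (intro ln_le_minus_one) auto
  then have "z * ln (K / (z * S)) \<le> z * (K / (z * S) - 1)"
    using z by (intro mult_left_mono) auto
  then show ?thesis using z assms
    by (simp add: ln_div ln_mult right_diff_distrib distrib_left)
qed

text \<open>Choosing between classes of sizes \<open>K\<close> and \<open>L\<close>, and then
  uniformly inside the class, gives at most the entropy of a uniform choice from everything.\<close>

lemma ent_plus_le_ln_add: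
  assumes "0 \<le> z" "z \<le> 1" "0 \<le> K" "0 \<le> L" "0 < z \<Longrightarrow> 0 < K" "z < 1 \<Longrightarrow> 0 < L"
  shows "ent z + z * ln K + (1 - z) * ln L \<le> ln (K + L)"
proof -
  have S: "K + L > 0" using assms by (cases "z = 0") (auto simp: add_pos_nonneg add_nonneg_pos)
  have "z * ln K - z * ln z \<le> K / (K + L) - z + z * ln (K + L)"
    using assms S by (intro mult_ln_le) auto
  moreover have "(1 - z) * ln L - (1 - z) * ln (1 - z) \<le> L / (K + L) - (1 - z) + (1 - z) * ln (K + L)"
    using assms S by (intro mult_ln_le) auto
  moreover have "K / (K + L) + L / (K + L) = 1"
    using S by (simp flip: add_divide_distrib)
  ultimately show ?thesis by (simp add: ent_def algebra_simps)
qed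

lemma ent_nonneg:
  assumes "0 \<le> x" "x \<le> 1" shows "0 \<le> ent x"
proof -
  have "x * ln x \<le> 0" "(1 - x) * ln (1 - x) \<le> 0"
    using assms by (cases "x = 0"; cases "x = 1"; simp add: mult_nonneg_nonpos)+
  then show ?thesis by (simp add: ent_def)
qed

section \<open>Splitting a family at one element\<close>

definition avoiding :: "'a \<Rightarrow> 'a set set \<Rightarrow> 'a set set" where
  "avoiding i F = {A \<in> F. i \<notin> A}"

definition containing :: "'a \<Rightarrow> 'a set set \<Rightarrow> 'a set set" where
  "containing i F = {A \<in> F. i \<in> A}"

definition avoid_frac :: "'a \<Rightarrow> 'a set set \<Rightarrow> real" where
  "avoid_frac i F = card (avoiding i F) / card F"

text \<open>Two families, because \<open>A\<close> and \<open>B\<close> range over different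
  subfamilies once a revealed element has told them apart.\<close>

definition joins :: "'a set set \<Rightarrow> 'a set set \<Rightarrow> 'a set set" where
  "joins F G = {A \<union> B | A B. A \<in> F \<and> B \<in> G}"

lemma finite_joins: "finite F \<Longrightarrow> finite G \<Longrightarrow> finite (joins F G)"
  unfolding joins_def by (rule finite_image_set2) simp_all

lemma finite_avoiding [simp]: "finite F \<Longrightarrow> finite (avoiding i F)"
  and finite_containing [simp]: "finite F \<Longrightarrow> finite (containing i F)"
  by (simp_all add: avoiding_def containing_def)

lemma card_avoiding_containing:
  "finite F \<Longrightarrow> card (avoiding i F) + card (containing i F) = card F"
  unfolding avoiding_def containing_def
  by (subst card_Un_disjoint [symmetric]) (auto intro: arg_cong [of _ _ card])

lemma avoid_frac_nonneg: "0 \<le> avoid_frac i F"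
  by (simp add: avoid_frac_def)

lemma avoid_frac_le_1:
  assumes "finite F" shows "avoid_frac i F \<le> 1"
  using card_avoiding_containing [OF assms, of i] by (auto simp: avoid_frac_def divide_le_eq_1)

lemma avoid_frac_pos_iff: "finite F \<Longrightarrow> 0 < avoid_frac i F \<longleftrightarrow> avoiding i F \<noteq> {}"
  using card_avoiding_containing [of F i]
  by (auto simp: avoid_frac_def zero_less_divide_iff card_gt_0_iff avoiding_def)

lemma one_minus_avoid_frac:
  assumes "finite F" "F \<noteq> {}"
  shows "1 - avoid_frac i F = card (containing i F) / card F"
proof -
  have "real (card (avoiding i F)) + real (card (containing i F)) = real (card F)"
    using card_avoiding_containing [OF assms(1), of i] by linarith
  then show ?thesis using assms by (simp add: avoid_frac_def field_simps)
qed

lemma avoid_frac_less_1_iff: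
  assumes "finite F" "F \<noteq> {}"
  shows "avoid_frac i F < 1 \<longleftrightarrow> containing i F \<noteq> {}"
proof -
  have "avoid_frac i F < 1 \<longleftrightarrow> 0 < real (card (containing i F)) / card F"
    using one_minus_avoid_frac [OF assms, of i] by linarith
  also have "\<dots> \<longleftrightarrow> containing i F \<noteq> {}"
    using assms by (auto simp: zero_less_divide_iff card_gt_0_iff)
  finally show ?thesis .
qed

text \<open>For a uniformly random \<open>A \<in> F\<close> whose elements are revealed in the order
  \<open>n, n - 1, \<dots>, 1\<close>, let \<open>X\<^sub>k\<close> be the conditional probability of \<open>k \<notin> A\<close> given what was revealed
  before \<open>k\<close>. Then \<open>cond_exp n k F g\<close> is the expectation of \<open>g X\<^sub>k\<close>.\<close>

primrec cond_exp :: "nat \<Rightarrow> nat \<Rightarrow> nat set set \<Rightarrow> (real \<Rightarrow> real) \<Rightarrow> real" where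
  "cond_exp 0 k F g = 0"
| "cond_exp (Suc n) k F g =
     (if k = Suc n then g (avoid_frac k F)
      else avoid_frac (Suc n) F * cond_exp n k (avoiding (Suc n) F) g
         + (1 - avoid_frac (Suc n) F) * cond_exp n k (containing (Suc n) F) g)"

lemma cond_exp_add:
  "cond_exp n k F (\<lambda>x. g x + h x) = cond_exp n k F g + cond_exp n k F h"
  by (induction n arbitrary: F) (simp_all add: algebra_simps)

lemma cond_exp_cmult: "cond_exp n k F (\<lambda>x. c * g x) = c * cond_exp n k F g"
  by (induction n arbitrary: F) (simp_all add: algebra_simps)

lemma cond_exp_diff:
  "cond_exp n k F (\<lambda>x. g x - h x) = cond_exp n k F g - cond_exp n k F h"
  using cond_exp_add [of n k F g "\<lambda>x. -1 * h x"] cond_exp_cmult [of n k F "-1" h] by simp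

lemma cond_exp_const: "k \<in> {1..n} \<Longrightarrow> cond_exp n k F (\<lambda>x. c) = c"
  by (induction n arbitrary: F) (auto simp: algebra_simps)

lemma cond_exp_mono:
  assumes "finite F" "\<And>x. 0 \<le> x \<Longrightarrow> x \<le> 1 \<Longrightarrow> g x \<le> h x"
  shows "cond_exp n k F g \<le> cond_exp n k F h"
  using assms(1)
proof (induction n arbitrary: F)
  case (Suc n)
  then show ?case
    using assms(2) avoid_frac_nonneg [of "Suc n" F] avoid_frac_le_1 [of F "Suc n"]
    by (auto intro!: add_mono mult_left_mono)
qed simp

lemma cond_exp_id:
  assumes "finite F" "F \<noteq> {}" "k \<in> {1..n}"
  shows "cond_exp n k F (\<lambda>x. x) = avoid_frac k F"
  using assms
proof (induction n arbitrary: F)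
  case (Suc n)
  show ?case
  proof (cases "k = Suc n")
    case False
    then have k: "k \<in> {1..n}" using Suc.prems by auto
    let ?F0 = "avoiding (Suc n) F" and ?F1 = "containing (Suc n) F"
    have c: "real (card F) > 0" using Suc.prems by (simp add: card_gt_0_iff)
    \<comment> \<open>The factor \<open>card H\<close> covers an empty branch, to which the
      induction hypothesis does not apply.\<close>
    have *: "real (card H) * cond_exp n k H (\<lambda>x. x) = card (avoiding k H)" if "finite H" for H
    proof (cases "H = {}")
      case False
      then show ?thesis
        using Suc.IH [of H] k that by (simp add: avoid_frac_def card_gt_0_iff)
    qed (simp add: avoiding_def)
    have "avoiding (Suc n) (avoiding k F) = avoiding k ?F0"
      "containing (Suc n) (avoiding k F) = avoiding k ?F1"
      by (auto simp: avoiding_def containing_def)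
    then have "real (card (avoiding k ?F0)) + card (avoiding k ?F1) = card (avoiding k F)"
      using card_avoiding_containing [of "avoiding k F" "Suc n"] Suc.prems
      by (metis finite_avoiding of_nat_add)
    moreover have "avoid_frac (Suc n) F * cond_exp n k ?F0 (\<lambda>x. x) = card (avoiding k ?F0) / card F"
      using * [of ?F0] Suc.prems c by (simp add: avoid_frac_def field_simps)
    moreover have "(1 - avoid_frac (Suc n) F) * cond_exp n k ?F1 (\<lambda>x. x) = card (avoiding k ?F1) / card F"
      using * [of ?F1] Suc.prems c by (simp add: one_minus_avoid_frac field_simps)
    ultimately have "cond_exp (Suc n) k F (\<lambda>x. x) = card (avoiding k F) / card F"
      using False by (simp only: cond_exp.simps if_False add_divide_distrib [symmetric])
    then show ?thesis by (simp only: avoid_frac_def)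
  qed simp
qed simp

text \<open>The chain rule for the Shannon entropy of a uniformly distributed member of \<open>F\<close>.\<close>

lemma sum_cond_exp_ent:
  assumes "finite F" "F \<noteq> {}" "inj_on (\<lambda>A. A \<inter> {1..n}) F"
  shows "(\<Sum>k=1..n. cond_exp n k F ent) = ln (card F)"
  using assms
proof (induction n arbitrary: F)
  case 0
  then have "\<forall>A\<in>F. \<forall>B\<in>F. A = B"
    by (simp add: inj_on_def)
  then have "is_singleton F"
    using 0 by (metis is_singletonI')
  then show ?case by (simp add: is_singleton_altdef)
next
  case (Suc n)
  let ?p = "avoid_frac (Suc n) F"
  let ?F0 = "avoiding (Suc n) F" and ?F1 = "containing (Suc n) F"
  have c: "real (card F) > 0" using Suc.prems by (simp add: card_gt_0_iff)
  have inj: "inj_on (\<lambda>A. A \<inter> {1..n}) ?F0" "inj_on (\<lambda>A. A \<inter> {1..n}) ?F1"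
    using Suc.prems(3) unfolding inj_on_def avoiding_def containing_def
    by (simp_all add: atLeastAtMostSuc_conv Int_insert_right)
  have 0: "?p * (\<Sum>k=1..n. cond_exp n k ?F0 ent) = ?p * (ln ?p + ln (card F))"
  proof (cases "?F0 = {}")
    case True
    then show ?thesis by (simp add: avoid_frac_def)
  next
    case False
    then have "(\<Sum>k=1..n. cond_exp n k ?F0 ent) = ln (card ?F0)"
      using Suc.IH [OF _ False inj(1)] Suc.prems by simp
    moreover have "card ?F0 > 0" using False Suc.prems by (simp add: card_gt_0_iff)
    ultimately show ?thesis using c by (simp add: avoid_frac_def ln_div)
  qed
  have 1: "(1 - ?p) * (\<Sum>k=1..n. cond_exp n k ?F1 ent) = (1 - ?p) * (ln (1 - ?p) + ln (card F))"
  proof (cases "?F1 = {}")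
    case True
    then show ?thesis using Suc.prems by (simp add: one_minus_avoid_frac)
  next
    case False
    then have "(\<Sum>k=1..n. cond_exp n k ?F1 ent) = ln (card ?F1)"
      using Suc.IH [OF _ False inj(2)] Suc.prems by simp
    moreover have "card ?F1 > 0" using False Suc.prems by (simp add: card_gt_0_iff)
    ultimately show ?thesis using c Suc.prems by (simp add: one_minus_avoid_frac ln_div)
  qed
  have "(\<Sum>k=1..Suc n. cond_exp (Suc n) k F ent) = ent ?p +
      (\<Sum>k=1..n. ?p * cond_exp n k ?F0 ent + (1 - ?p) * cond_exp n k ?F1 ent)"
    by (subst sum.nat_ivl_Suc') (simp_all cong: sum.cong_simp)
  also have "\<dots> = ent ?p + ?p * (\<Sum>k=1..n. cond_exp n k ?F0 ent)
      + (1 - ?p) * (\<Sum>k=1..n. cond_exp n k ?F1 ent)"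
    by (simp add: sum.distrib sum_distrib_left)
  also have "\<dots> = ln (card F)"
    unfolding 0 1 by (simp add: ent_def algebra_simps)
  finally show ?case .
qed

text \<open>One revealed element. \<open>z\<close> is the chosen probability that \<open>i\<close>
  lies in neither set; the marginals force the other three weights, and the bounds on
  \<open>z\<close> make them nonnegative. Only the first of the four branches yields unions without
  \<open>i\<close>, so the joins split into two classes to which \<open>ent_plus_le_ln_add\<close>
  applies. Counting unions in this way takes the place of the entropy of a union.\<close>

lemma coupling_step:
  fixes S :: "'a set set \<Rightarrow> 'a set set \<Rightarrow> real"
  assumes fin: "finite F" "finite G" and ne: "F \<noteq> {}" "G \<noteq> {}"
    and z: "0 \<le> z" "z \<le> avoid_frac i F" "z \<le> avoid_frac i G"
      "avoid_frac i F + avoid_frac i G - 1 \<le> z"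
    and S: "\<And>F' G'. F' \<subseteq> F \<Longrightarrow> G' \<subseteq> G \<Longrightarrow> F' \<noteq> {} \<Longrightarrow> G' \<noteq> {} \<Longrightarrow> S F' G' \<le> ln (card (joins F' G'))"
  shows "ent z + z * S (avoiding i F) (avoiding i G)
      + (avoid_frac i F - z) * S (avoiding i F) (containing i G)
      + (avoid_frac i G - z) * S (containing i F) (avoiding i G)
      + (1 - avoid_frac i F - avoid_frac i G + z) * S (containing i F) (containing i G)
      \<le> ln (card (joins F G))"
proof -
  let ?p = "avoid_frac i F" and ?q = "avoid_frac i G"
  let ?J0 = "avoiding i (joins F G)" and ?J1 = "containing i (joins F G)"
  have finJ: "finite (joins F G)" by (simp add: fin finite_joins)
  have le1: "?p \<le> 1" "?q \<le> 1" using fin by (simp_all add: avoid_frac_le_1)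
  have joinsI: "joins F' G' \<noteq> {}" if "F' \<noteq> {}" "G' \<noteq> {}" for F' G' :: "'a set set"
    using that by (auto simp: joins_def)
  have bound: "w * S F' G' \<le> w * ln (card J)"
    if w: "0 \<le> w" "0 < w \<Longrightarrow> F' \<noteq> {} \<and> G' \<noteq> {}"
      and sub: "F' \<subseteq> F" "G' \<subseteq> G" "joins F' G' \<subseteq> J" "J \<subseteq> joins F G" for w F' G' J
  proof (cases "w = 0")
    case False
    then have ne': "F' \<noteq> {}" "G' \<noteq> {}" using w by auto
    have "finite J" using finJ sub finite_subset by blast
    then have "card (joins F' G') \<le> card J" "card (joins F' G') > 0"
      using sub joinsI [OF ne'] by (auto intro: card_mono simp: card_gt_0_iff finite_subset)
    then have "S F' G' \<le> ln (card J)"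
      using S [OF sub(1,2) ne'] by (smt (verit) ln_mono of_nat_0_less_iff of_nat_mono)
    then show ?thesis using w by (simp add: mult_left_mono)
  qed simp
  have ne0: "avoiding i F \<noteq> {}" if "0 < ?p" using that avoid_frac_pos_iff [OF fin(1), of i] by simp
  have ne0': "avoiding i G \<noteq> {}" if "0 < ?q" using that avoid_frac_pos_iff [OF fin(2), of i] by simp
  have ne1: "containing i F \<noteq> {}" if "?p < 1" using that avoid_frac_less_1_iff [OF fin(1) ne(1), of i] by simp
  have ne1': "containing i G \<noteq> {}" if "?q < 1" using that avoid_frac_less_1_iff [OF fin(2) ne(2), of i] by simp
  have sub: "avoiding i F \<subseteq> F" "containing i F \<subseteq> F" "avoiding i G \<subseteq> G" "containing i G \<subseteq> G"
    "?J0 \<subseteq> joins F G" "?J1 \<subseteq> joins F G"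
    "joins (avoiding i F) (avoiding i G) \<subseteq> ?J0" "joins (avoiding i F) (containing i G) \<subseteq> ?J1"
    "joins (containing i F) (avoiding i G) \<subseteq> ?J1" "joins (containing i F) (containing i G) \<subseteq> ?J1"
    unfolding avoiding_def containing_def joins_def by blast+
  have b00: "z * S (avoiding i F) (avoiding i G) \<le> z * ln (card ?J0)"
    by (rule bound) (use z ne0 ne0' sub in simp_all)
  have b01: "(?p - z) * S (avoiding i F) (containing i G) \<le> (?p - z) * ln (card ?J1)"
    by (rule bound) (use z le1 ne0 ne1' sub in simp_all)
  have b10: "(?q - z) * S (containing i F) (avoiding i G) \<le> (?q - z) * ln (card ?J1)"
    by (rule bound) (use z le1 ne1 ne0' sub in simp_all)
  have b11: "(1 - ?p - ?q + z) * S (containing i F) (containing i G) \<le> (1 - ?p - ?q + z) * ln (card ?J1)"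
    by (rule bound) (use z le1 ne1 ne1' sub in simp_all)
  have "ent z + z * ln (card ?J0) + (1 - z) * ln (card ?J1) \<le> ln (real (card ?J0) + real (card ?J1))"
  proof (rule ent_plus_le_ln_add)
    show "0 < real (card ?J0)" if "0 < z"
    proof -
      have "joins (avoiding i F) (avoiding i G) \<noteq> {}"
        using that z ne0 ne0' by (intro joinsI) simp_all
      then have "?J0 \<noteq> {}" using sub(7) by blast
      then show ?thesis using finJ by (simp add: card_gt_0_iff)
    qed
    show "0 < real (card ?J1)" if "z < 1"
    proof -
      \<comment> \<open>\<open>p + q - 1 \<le> z < 1\<close> excludes \<open>p = q = 1\<close>, so
        one of the families has a member containing \<open>i\<close>.\<close>
      have "?p < 1 \<or> ?q < 1" using that z by linarith
      then have "joins (containing i F) G \<union> joins F (containing i G) \<noteq> {}"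
        using ne1 ne1' ne joinsI by blast
      moreover have "joins (containing i F) G \<union> joins F (containing i G) \<subseteq> ?J1"
        by (auto simp: containing_def joins_def)
      ultimately have "?J1 \<noteq> {}" by blast
      then show ?thesis using finJ by (simp add: card_gt_0_iff)
    qed
  qed (use z le1 in auto)
  also have "real (card ?J0) + real (card ?J1) = real (card (joins F G))"
    using card_avoiding_containing [OF finJ, of i] by linarith
  finally show ?thesis using b00 b01 b10 b11 by (simp add: algebra_simps)
qed

text \<open>Taking \<open>z = p * q\<close> at every element keeps the two histories independent, so
  the expectations are iterated ones.\<close>

lemma sum_cond_exp_indep_le:
  assumes "finite F" "finite G" "F \<noteq> {}" "G \<noteq> {}"
  shows "(\<Sum>k=1..n. cond_exp n k F (\<lambda>x. cond_exp n k G (\<lambda>y. ent (x * y)))) \<le> ln (card (joins F G))"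
  using assms
proof (induction n arbitrary: F G)
  case 0
  then have "finite (joins F G)" "joins F G \<noteq> {}"
    by (simp_all add: finite_joins) (auto simp: joins_def)
  then have "card (joins F G) \<ge> 1"
    by (simp add: Suc_le_eq card_gt_0_iff)
  then show ?case by simp
next
  case (Suc n)
  define S where "S F G = (\<Sum>k=1..n. cond_exp n k F (\<lambda>x. cond_exp n k G (\<lambda>y. ent (x * y))))" for F G
  let ?p = "avoid_frac (Suc n) F" and ?q = "avoid_frac (Suc n) G"
  let ?F0 = "avoiding (Suc n) F" and ?F1 = "containing (Suc n) F"
  let ?G0 = "avoiding (Suc n) G" and ?G1 = "containing (Suc n) G"
  have p: "0 \<le> ?p" "?p \<le> 1" "0 \<le> ?q" "?q \<le> 1"
    using Suc.prems by (simp_all add: avoid_frac_nonneg avoid_frac_le_1)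
  have pq: "0 \<le> (1 - ?p) * (1 - ?q)" using p by simp
  have "(\<Sum>k=1..Suc n. cond_exp (Suc n) k F (\<lambda>x. cond_exp (Suc n) k G (\<lambda>y. ent (x * y))))
      = ent (?p * ?q) + (\<Sum>k=1..n. cond_exp (Suc n) k F (\<lambda>x. cond_exp (Suc n) k G (\<lambda>y. ent (x * y))))"
    by simp
  also have "(\<Sum>k=1..n. cond_exp (Suc n) k F (\<lambda>x. cond_exp (Suc n) k G (\<lambda>y. ent (x * y))))
     = ?p * ?q * S ?F0 ?G0 + (?p - ?p * ?q) * S ?F0 ?G1
       + (?q - ?p * ?q) * S ?F1 ?G0 + (1 - ?p - ?q + ?p * ?q) * S ?F1 ?G1"
    by (simp add: S_def sum_distrib_left flip: sum.distrib)
       (rule sum.cong, simp, simp add: cond_exp_add cond_exp_cmult, simp add: algebra_simps)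
  also have "ent (?p * ?q) + \<dots> \<le> ln (card (joins F G))"
    using coupling_step [OF Suc.prems, of "?p * ?q" "Suc n" S] p pq Suc.IH Suc.prems
    by (simp add: S_def mult_left_le mult_left_le_one_le finite_subset algebra_simps)
  finally show ?case .
qed

text \<open>Whatever \<open>z\<close> is, the branches in which \<open>F\<close> passes to a given
  half have total weight \<open>avoid_frac\<close> or its complement, and likewise for
  \<open>G\<close>. So a bound of the form \<open>g p + g q\<close> adds up to separate expectations
  over \<open>F\<close> and over \<open>G\<close>.\<close>

lemma sum_cond_exp_coupled_le:
  assumes "finite F" "finite G" "F \<noteq> {}" "G \<noteq> {}"
    and g: "\<And>k p q. 0 \<le> p \<Longrightarrow> p \<le> 1 \<Longrightarrow> 0 \<le> q \<Longrightarrow> q \<le> 1 \<Longrightarrow>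
      \<exists>z. 0 \<le> z \<and> p + q - 1 \<le> z \<and> z \<le> p \<and> z \<le> q \<and> g k p + g k q \<le> ent z"
  shows "(\<Sum>k=1..n. cond_exp n k F (g k) + cond_exp n k G (g k)) \<le> ln (card (joins F G))"
  using assms(1-4)
proof (induction n arbitrary: F G)
  case 0
  then have "finite (joins F G)" "joins F G \<noteq> {}"
    by (simp_all add: finite_joins) (auto simp: joins_def)
  then have "card (joins F G) \<ge> 1"
    by (simp add: Suc_le_eq card_gt_0_iff)
  then show ?case by simp
next
  case (Suc n)
  define S where "S F G = (\<Sum>k=1..n. cond_exp n k F (g k) + cond_exp n k G (g k))" for F G
  let ?p = "avoid_frac (Suc n) F" and ?q = "avoid_frac (Suc n) G"
  let ?F0 = "avoiding (Suc n) F" and ?F1 = "containing (Suc n) F"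
  let ?G0 = "avoiding (Suc n) G" and ?G1 = "containing (Suc n) G"
  obtain z where z: "0 \<le> z" "?p + ?q - 1 \<le> z" "z \<le> ?p" "z \<le> ?q"
    and gz: "g (Suc n) ?p + g (Suc n) ?q \<le> ent z"
    using g [of ?p ?q "Suc n"] Suc.prems by (auto simp: avoid_frac_nonneg avoid_frac_le_1)
  have "(\<Sum>k=1..Suc n. cond_exp (Suc n) k F (g k) + cond_exp (Suc n) k G (g k))
      = g (Suc n) ?p + g (Suc n) ?q
        + (\<Sum>k=1..n. cond_exp (Suc n) k F (g k) + cond_exp (Suc n) k G (g k))"
    by simp
  also have "(\<Sum>k=1..n. cond_exp (Suc n) k F (g k) + cond_exp (Suc n) k G (g k))
     = z * S ?F0 ?G0 + (?p - z) * S ?F0 ?G1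
       + (?q - z) * S ?F1 ?G0 + (1 - ?p - ?q + z) * S ?F1 ?G1"
    by (simp add: S_def sum_distrib_left flip: sum.distrib)
       (rule sum.cong, simp_all add: algebra_simps)
  also have "g (Suc n) ?p + g (Suc n) ?q + \<dots> \<le> ln (card (joins F G))"
    using coupling_step [OF Suc.prems z(1) z(3) z(4) z(2), of S] gz Suc.IH Suc.prems
    by (simp add: S_def finite_subset)
  finally show ?case .
qed

section \<open>Concavity in logarithmic coordinates\<close>

lemma convex_real_between:
  fixes S :: "real set"
  assumes "convex S" "a \<in> S" "b \<in> S" "a \<le> t" "t \<le> b"
  shows "t \<in> S"
proof -
  have "closed_segment a b \<subseteq> S"
    using assms by (simp add: convex_contains_segment)
  then show ?thesis
    using assms by (auto simp: closed_segment_eq_real_ivl)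
qed

text \<open>Concavity is expressed by a decreasing first derivative, because the second derivative
  of \<open>gam\<close> jumps at its breakpoints.\<close>

lemma tangent_ge:
  fixes f f' :: "real \<Rightarrow> real"
  assumes S: "convex S" "c \<in> S" "t \<in> S"
    and der: "\<And>x. x \<in> S \<Longrightarrow> (f has_real_derivative f' x) (at x)"
    and anti: "\<And>x y. x \<in> S \<Longrightarrow> y \<in> S \<Longrightarrow> x \<le> y \<Longrightarrow> f' y \<le> f' x"
  shows "f t \<le> f c + f' c * (t - c)"
proof -
  consider "t = c" | "c < t" | "t < c" by linarith
  then show ?thesis
  proof cases
    case 2
    obtain z where z: "c < z" "z < t" "f t - f c = (t - c) * f' z"
      using MVT2 [OF 2, of f f'] der convex_real_between [OF S(1,2,3)] by (meson less_eq_real_def)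
    have "z \<in> S" using z convex_real_between [OF S(1,2,3)] by simp
    then have "f' z \<le> f' c" using anti [of c z] S z by simp
    then show ?thesis using z 2 by (smt (verit, best) mult.commute mult_left_mono)
  next
    case 3
    obtain z where z: "t < z" "z < c" "f c - f t = (c - t) * f' z"
      using MVT2 [OF 3, of f f'] der convex_real_between [OF S(1,3,2)] by (meson less_eq_real_def)
    have "z \<in> S" using z convex_real_between [OF S(1,3,2)] by simp
    then have "f' c \<le> f' z" using anti [of z c] S z by simp
    then have "(c - t) * f' c \<le> (c - t) * f' z" using 3 by (intro mult_left_mono) auto
    then show ?thesis using z by (simp add: algebra_simps)
  qed simp
qed

lemma chord_le:
  fixes f f' :: "real \<Rightarrow> real"
  assumes S: "convex S" "a \<in> S" "b \<in> S" and t: "a \<le> t" "t \<le> b"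
    and der: "\<And>x. x \<in> S \<Longrightarrow> (f has_real_derivative f' x) (at x)"
    and anti: "\<And>x y. x \<in> S \<Longrightarrow> y \<in> S \<Longrightarrow> x \<le> y \<Longrightarrow> f' y \<le> f' x"
  shows "(b - t) * f a + (t - a) * f b \<le> (b - a) * f t"
proof -
  have tS: "t \<in> S" using convex_real_between [OF S t] .
  have "f a \<le> f t + f' t * (a - t)" "f b \<le> f t + f' t * (b - t)"
    using tangent_ge [OF S(1) tS S(2) der anti] tangent_ge [OF S(1) tS S(3) der anti] by blast+
  then have "(b - t) * f a \<le> (b - t) * (f t + f' t * (a - t))"
    "(t - a) * f b \<le> (t - a) * (f t + f' t * (b - t))"
    using t by (auto intro: mult_left_mono)
  then show ?thesis by (simp add: algebra_simps)
qed

lemma midpoint_ge: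
  fixes f f' :: "real \<Rightarrow> real"
  assumes S: "convex S" "a \<in> S" "b \<in> S"
    and der: "\<And>x. x \<in> S \<Longrightarrow> (f has_real_derivative f' x) (at x)"
    and anti: "\<And>x y. x \<in> S \<Longrightarrow> y \<in> S \<Longrightarrow> x \<le> y \<Longrightarrow> f' y \<le> f' x"
  shows "f a + f b \<le> 2 * f ((a + b) / 2)"
proof -
  have mS: "(a + b) / 2 \<in> S"
    using convexD [OF S, of "1/2" "1/2"] by (simp add: add_divide_distrib)
  have "f a \<le> f ((a + b) / 2) + f' ((a + b) / 2) * (a - (a + b) / 2)"
       "f b \<le> f ((a + b) / 2) + f' ((a + b) / 2) * (b - (a + b) / 2)"
    using tangent_ge [OF S(1) mS S(2) der anti] tangent_ge [OF S(1) mS S(3) der anti] by blast+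
  moreover have "f' ((a + b) / 2) * (a - (a + b) / 2) + f' ((a + b) / 2) * (b - (a + b) / 2) = 0"
    by (simp flip: distrib_left)
  ultimately show ?thesis by linarith
qed

lemma antimono_of_deriv_nonpos:
  fixes f f' :: "real \<Rightarrow> real"
  assumes S: "convex S" "a \<in> S" "b \<in> S" "a \<le> b"
    and der: "\<And>x. x \<in> S \<Longrightarrow> (f has_real_derivative f' x) (at x)"
    and neg: "\<And>x. x \<in> S \<Longrightarrow> f' x \<le> 0"
  shows "f b \<le> f a"
  using DERIV_nonpos_imp_nonincreasing [OF S(4), of f] convex_real_between [OF S(1-3)] der neg
  by blast

text \<open>For the two breakpoints of \<open>gam\<close>, where neighbouring formulas agree in
  value and slope.\<close>

lemma DERIV_glue:
  fixes f g h :: "real \<Rightarrow> real"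
  assumes "\<And>t. a < t \<Longrightarrow> t \<le> c \<Longrightarrow> f t = g t" "\<And>t. c \<le> t \<Longrightarrow> t < b \<Longrightarrow> f t = h t" "a < c" "c < b"
    and "(g has_real_derivative D) (at c)" "(h has_real_derivative D) (at c)"
  shows "(f has_real_derivative D) (at c)"
proof -
  have g: "((\<lambda>y. (g y - g c) / (y - c)) \<longlongrightarrow> D) (at_left c)"
    and h: "((\<lambda>y. (h y - h c) / (y - c)) \<longlongrightarrow> D) (at_right c)"
    using assms(5,6) by (auto simp: has_field_derivative_iff intro: filterlim_mono at_le)
  have "\<forall>\<^sub>F y in at_left c. (g y - g c) / (y - c) = (f y - f c) / (y - c)"
    using assms(1,3) by (intro eventually_at_leftI [of a]) auto
  then have "((\<lambda>y. (f y - f c) / (y - c)) \<longlongrightarrow> D) (at_left c)"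
    using g by (rule Lim_transform_eventually [rotated])
  moreover have "\<forall>\<^sub>F y in at_right c. (h y - h c) / (y - c) = (f y - f c) / (y - c)"
    using assms(2,4) by (intro eventually_at_rightI [of _ b]) auto
  then have "((\<lambda>y. (f y - f c) / (y - c)) \<longlongrightarrow> D) (at_right c)"
    using h by (rule Lim_transform_eventually [rotated])
  ultimately show ?thesis
    by (simp add: has_field_derivative_iff filterlim_split_at)
qed

text \<open>The function \<open>ent x / x\<close> in the variable \<open>u = - ln x\<close>, in which it is concave.\<close>

definition nu :: "real \<Rightarrow> real" where
  "nu u = u - (exp u - 1) * ln (1 - exp (- u))"

definition nu' :: "real \<Rightarrow> real" where
  "nu' u = - exp u * ln (1 - exp (- u))"

text \<open>Minus the second derivative of \<open>nu\<close> at \<open>u = - ln x\<close>.\<close>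

definition curv :: "real \<Rightarrow> real" where
  "curv x = 1 / (1 - x) + ln (1 - x) / x"

lemma ent_eq_nu: "ent (exp (- u)) = exp (- u) * nu u"
proof -
  have "exp (- u) * (exp u * L) = L" for L
    by (simp add: exp_minus)
  then show ?thesis by (simp add: ent_def nu_def algebra_simps)
qed

lemma nu_minus_ln: "0 < x \<Longrightarrow> nu (- ln x) = ent x / x"
  using ent_eq_nu [of "- ln x"] by (simp add: field_simps)

lemma nu'_minus_ln: "0 < x \<Longrightarrow> nu' (- ln x) = - ln (1 - x) / x"
  by (simp add: nu'_def exp_minus divide_inverse)

lemma nu_0 [simp]: "nu 0 = 0"
  by (simp add: nu_def)

lemma DERIV_nu:
  assumes "0 < u" shows "(nu has_real_derivative nu' u) (at u)"
proof -
  have lt: "exp (- u) < 1" using assms by simp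
  have "(exp u - 1) * (exp (- u) / (1 - exp (- u))) = 1"
    using lt by (simp add: exp_minus field_simps)
  moreover have "1 + exp (- u) / (1 - exp (- u)) = 1 / (1 - exp (- u))"
    using lt by (simp add: field_simps)
  ultimately show ?thesis
    unfolding nu_def nu'_def using lt
    by (auto intro!: derivative_eq_intros simp: algebra_simps)
qed

lemma DERIV_nu':
  assumes "0 < u" shows "(nu' has_real_derivative - curv (exp (- u))) (at u)"
proof -
  have "exp (- u) < 1" using assms by simp
  then show ?thesis
    unfolding nu'_def curv_def
    by (auto intro!: derivative_eq_intros simp: exp_minus field_simps)
qed

lemma curv_nonneg:
  assumes "0 < x" "x < 1" shows "0 \<le> curv x"
proof -
  have "1 - 1 / (1 - x) \<le> ln (1 - x)"
    using ln_le_minus_one [of "1 / (1 - x)"] assms by (simp add: ln_div)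
  then have "(1 - 1 / (1 - x)) / x \<le> ln (1 - x) / x"
    using assms by (simp add: divide_right_mono)
  moreover have "(1 - 1 / (1 - x)) / x = - 1 / (1 - x)"
    using assms by (simp add: field_simps)
  ultimately show ?thesis by (simp add: curv_def)
qed

lemma nu'_antimono:
  assumes "0 < u" "u \<le> v" shows "nu' v \<le> nu' u"
  by (rule antimono_of_deriv_nonpos [where S = "{0<..}" and f' = "\<lambda>u. - curv (exp (- u))"])
     (use assms in \<open>auto intro: DERIV_nu' curv_nonneg\<close>)

lemma nu_tangent:
  assumes "0 < c" "0 < u" shows "nu u \<le> nu c + nu' c * (u - c)"
  by (rule tangent_ge [where S = "{0<..}"])
     (use assms in \<open>auto intro: DERIV_nu nu'_antimono\<close>)

lemma nu_chord:
  assumes "0 < a" "a \<le> u" "u \<le> b"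
  shows "(b - u) * nu a + (u - a) * nu b \<le> (b - a) * nu u"
  by (rule chord_le [where S = "{0<..}" and f' = nu'])
     (use assms in \<open>auto intro: DERIV_nu nu'_antimono\<close>)

lemma nu'_nonneg: "0 < u \<Longrightarrow> 0 \<le> nu' u"
  by (simp add: nu'_def mult_le_0_iff)

lemma nu_mono:
  assumes "0 < u" "u \<le> v" shows "nu u \<le> nu v"
  using assms DERIV_nonneg_imp_nondecreasing [of u v nu] DERIV_nu nu'_nonneg
  by (meson dual_order.strict_trans1)

text \<open>\<open>pay x - ln 2 / 2\<close> is the \<open>g\<close> of the overview. The bound
  \<open>pay p + pay q - ln 2\<close> for the entropy of the best \<open>z\<close> is exact for
  \<open>p = q \<ge> 1/2\<close>: there the best \<open>z\<close> is \<open>1/2\<close> up to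
  \<open>p = 3/4\<close> and \<open>2 * p - 1\<close> beyond.\<close>

definition pay :: "real \<Rightarrow> real" where
  "pay x = (if x \<le> 1/2 then ent x else if x \<le> 3/4 then ln 2 else (ln 2 + ent (2 * x - 1)) / 2)"

definition gam :: "real \<Rightarrow> real" where
  "gam u = exp u * pay (exp (- u))"

definition gam' :: "real \<Rightarrow> real" where
  "gam' u = (let x = exp (- u) in
     if x \<le> 1/2 then nu' u
     else if x \<le> 3/4 then ln 2 * exp u
     else (ln 2 + ent (2 * x - 1)) / 2 * exp u + ln ((2 * x - 1) / (2 - 2 * x)))"

lemma gam_minus_ln: "0 < x \<Longrightarrow> gam (- ln x) = pay x / x"
  by (simp add: gam_def exp_minus divide_inverse mult.commute)

lemma DERIV_ent:
  assumes "0 < x" "x < 1" shows "(ent has_real_derivative ln ((1 - x) / x)) (at x)"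
  unfolding ent_def using assms
  by (auto intro!: derivative_eq_intros simp: ln_div)

lemma ent_half: "ent (1/2) = ln 2"
  by (simp add: ent_def ln_div)

lemma exp_minus_le_iff: "0 < c \<Longrightarrow> exp (- u) \<le> c \<longleftrightarrow> - ln c \<le> (u::real)"
  by (metis exp_ln ln_exp ln_le_cancel_iff exp_gt_zero minus_le_iff neg_le_iff_le)

lemma le_exp_minus_iff: "0 < c \<Longrightarrow> c \<le> exp (- u) \<longleftrightarrow> (u::real) \<le> - ln c"
  by (metis exp_ln ln_exp ln_le_cancel_iff exp_gt_zero le_minus_iff)

lemma DERIV_gam_low: "0 < u \<Longrightarrow> ((\<lambda>u. exp u * ent (exp (- u))) has_real_derivative nu' u) (at u)"
proof -
  have "(\<lambda>u. exp u * ent (exp (- u))) = nu" by (rule ext, simp only: ent_eq_nu) (simp add: exp_minus)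
  then show "0 < u \<Longrightarrow> ?thesis" by (simp add: DERIV_nu)
qed

lemma DERIV_gam_high:
  assumes "0 < u" "1/2 < exp (- u)"
  shows "((\<lambda>u. exp u * ((ln 2 + ent (2 * exp (- u) - 1)) / 2)) has_real_derivative
    (ln 2 + ent (2 * exp (- u) - 1)) / 2 * exp u + ln ((2 * exp (- u) - 1) / (2 - 2 * exp (- u)))) (at u)"
proof -
  have "((\<lambda>u. ent (2 * exp (- u) - 1)) has_real_derivative
      ln ((1 - (2 * exp (- u) - 1)) / (2 * exp (- u) - 1)) * (- 2 * exp (- u))) (at u)"
    by (rule DERIV_chain2 [OF DERIV_ent]) (use assms in \<open>auto intro!: derivative_eq_intros\<close>)
  then have D: "((\<lambda>u. exp u * ((ln 2 + ent (2 * exp (- u) - 1)) / 2)) has_real_derivative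
      exp u * ((ln 2 + ent (2 * exp (- u) - 1)) / 2) +
      exp u * (ln ((1 - (2 * exp (- u) - 1)) / (2 * exp (- u) - 1)) * (- 2 * exp (- u)) / 2)) (at u)"
    by (auto intro!: derivative_eq_intros)
  have E: "exp u * (ln ((1 - (2 * exp (- u) - 1)) / (2 * exp (- u) - 1)) * (- 2 * exp (- u)) / 2)
     = ln ((2 * exp (- u) - 1) / (2 - 2 * exp (- u)))"
  proof -
    have "ln ((1 - (2 * exp (- u) - 1)) / (2 * exp (- u) - 1)) = - ln ((2 * exp (- u) - 1) / (2 - 2 * exp (- u)))"
      using assms by (simp add: ln_div)
    moreover have "exp u * (- L * (- 2 * exp (- u)) / 2) = L" for L by (simp add: exp_minus)
    ultimately show ?thesis by (simp only:)
  qed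
  show ?thesis using D unfolding E by (simp only: mult.commute [of "exp u"])
qed

text \<open>The pieces join smoothly because \<open>ent\<close> is stationary at its maximum
  \<open>1/2\<close>, which is reached by the argument \<open>x\<close> at \<open>x = 1/2\<close>
  and by \<open>2 * x - 1\<close> at \<open>x = 3/4\<close>.\<close>

lemma DERIV_gam:
  assumes "0 < u" shows "(gam has_real_derivative gam' u) (at u)"
proof -
  have l: "ln (1/2) = - ln (2::real)" "ln (3/4) = - ln (4/3::real)" by (simp_all add: ln_div)
  have l43: "0 < ln (4/3::real)" "ln (4/3) < ln (2::real)" by simp_all
  have h: "exp (- u) \<le> 1/2 \<longleftrightarrow> ln 2 \<le> u" "exp (- u) \<le> 3/4 \<longleftrightarrow> ln (4/3) \<le> u" for u :: real
    using exp_minus_le_iff [of "1/2" u] exp_minus_le_iff [of "3/4" u] by (simp_all only: l) auto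
  have low: "gam t = exp t * ent (exp (- t))" if "ln 2 \<le> t" for t
    using that h [of t] by (simp add: gam_def pay_def)
  have mid: "gam t = exp t * ln 2" if "ln (4/3) \<le> t" "t \<le> ln 2" for t
    using that h [of t] ent_half by (cases "t = ln 2") (simp_all add: gam_def pay_def exp_minus)
  have high: "gam t = exp t * ((ln 2 + ent (2 * exp (- t) - 1)) / 2)" if "t \<le> ln (4/3)" for t
    using that l43 h [of t] ent_half by (cases "t = ln (4/3)") (simp_all add: gam_def pay_def exp_minus)
  have midD: "((\<lambda>t. exp t * ln 2) has_real_derivative ln 2 * exp t) (at t)" for t :: real
    by (auto intro!: derivative_eq_intros)
  consider "ln 2 < u" | "u = ln 2" | "ln (4/3) < u" "u < ln 2" | "u = ln (4/3)" | "u < ln (4/3)"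
    by linarith
  then show ?thesis
  proof cases
    case 1
    have "(gam has_real_derivative nu' u) (at u)"
      by (rule has_field_derivative_transform_within_open [OF DERIV_gam_low, where S = "{ln 2<..}"])
         (use 1 assms low in auto)
    then show ?thesis using 1 h [of u] by (simp add: gam'_def Let_def)
  next
    case 2
    have "nu' u = ln 2 * exp u"
      using 2 by (simp add: nu'_def exp_minus ln_div)
    then have midD': "((\<lambda>t. exp t * ln 2) has_real_derivative nu' u) (at u)"
      using midD [of u] by (simp only:)
    have "(gam has_real_derivative nu' u) (at u)"
    proof (rule DERIV_glue [OF _ _ _ _ midD' DERIV_gam_low [OF assms]])
      show "gam t = exp t * ln 2" if "ln (4/3) < t" "t \<le> u" for t using that 2 mid by simp
      show "gam t = exp t * ent (exp (- t))" if "u \<le> t" "t < u + 1" for t using that 2 low by simp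
    qed (use 2 l43 in simp_all)
    then show ?thesis using 2 h [of u] by (simp add: gam'_def Let_def)
  next
    case 3
    have "(gam has_real_derivative ln 2 * exp u) (at u)"
      by (rule has_field_derivative_transform_within_open [OF midD, where S = "{ln (4/3)<..<ln 2}"])
         (use 3 mid in auto)
    then show ?thesis using 3 h [of u] by (simp add: gam'_def Let_def)
  next
    case 4
    have e: "exp (- u) = 3/4" using 4 by (simp add: exp_minus)
    have val: "(ln 2 + ent (2 * exp (- u) - 1)) / 2 * exp u + ln ((2 * exp (- u) - 1) / (2 - 2 * exp (- u)))
        = ln 2 * exp u"
      using ent_half by (simp add: e)
    have "1/2 < exp (- u)" by (simp add: e)
    from DERIV_gam_high [OF assms this]
    have high': "((\<lambda>u. exp u * ((ln 2 + ent (2 * exp (- u) - 1)) / 2)) has_real_derivative ln 2 * exp u) (at u)"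
      by (simp only: val)
    have "(gam has_real_derivative ln 2 * exp u) (at u)"
    proof (rule DERIV_glue [OF _ _ _ _ high' midD])
      show "gam t = exp t * ((ln 2 + ent (2 * exp (- t) - 1)) / 2)" if "0 < t" "t \<le> u" for t
        using that 4 high by simp
      show "gam t = exp t * ln 2" if "u \<le> t" "t < ln 2" for t using that 4 mid by simp
    qed (use 4 l43 assms in simp_all)
    then show ?thesis using 4 l43 h [of u] by (simp add: gam'_def Let_def)
  next
    case 5
    then have u: "3/4 < exp (- u)" "\<not> ln 2 \<le> u" "\<not> ln (4/3) \<le> u" using h(2) [of u] l43 by linarith+
    have "(gam has_real_derivative (ln 2 + ent (2 * exp (- u) - 1)) / 2 * exp u
        + ln ((2 * exp (- u) - 1) / (2 - 2 * exp (- u)))) (at u)"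
      by (rule has_field_derivative_transform_within_open [OF DERIV_gam_high [OF assms], where S = "{..<ln (4/3)}"])
         (use 5 u high in auto)
    then show ?thesis using u h [of u] by (simp add: gam'_def Let_def)
  qed
qed

section \<open>Numerical bounds for logarithms\<close>

text \<open>Six terms of the series for \<open>2 artanh y\<close>, which is \<open>ln q\<close> for
  \<open>y = (q - 1) / (q + 1)\<close>. If \<open>q \<le> 3/2\<close> then
  \<open>y \<le> 1/5\<close>, and the tail is below \<open>2 / 10^10\<close>.\<close>

definition atanh_sum :: "real \<Rightarrow> real" where
  "atanh_sum y = 2 * y * (1 + y^2 / 3 + y^4 / 5 + y^6 / 7 + y^8 / 9 + y^10 / 11)"

lemma ln_atanh_bounds:
  assumes "1 < q" "q \<le> 3/2"
  shows "atanh_sum ((q - 1) / (q + 1)) \<le> ln q" "ln q \<le> atanh_sum ((q - 1) / (q + 1)) + 2 / 10000000000"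
proof -
  define y where "y = (q - 1) / (q + 1)"
  have y: "0 \<le> y" "y \<le> 1/5" using assms by (auto simp: y_def field_simps)
  have sum: "(\<Sum>k<6. 2 * y^(2*k+1) / real (2*k+1)) = atanh_sum y"
    by (simp add: atanh_sum_def eval_nat_numeral algebra_simps)
  have "y^13 / (1 - y^2) / 13 \<le> (1/5)^13 / (1 - (1/5)^2) / 13"
    using y by (intro divide_right_mono frac_le power_mono diff_left_mono) (auto simp: power2_eq_square intro: mult_mono)
  also have "\<dots> \<le> 1 / 10000000000" by (simp add: power_divide)
  finally have d: "y^13 / (1 - y^2) / 13 \<le> 1 / 10000000000" .
  have "atanh_sum y \<le> ln q" "ln q \<le> atanh_sum y + 2 * (y^13 / (1 - y^2) / 13)"
    using ln_approx_bounds [OF assms(1), of 6] unfolding y_def [symmetric] sum by simp_all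
  then show "atanh_sum ((q - 1) / (q + 1)) \<le> ln q" "ln q \<le> atanh_sum ((q - 1) / (q + 1)) + 2 / 10000000000"
    using d unfolding y_def [symmetric] by linarith+
qed

lemma ln_2_bounds: "693147180 / 1000000000 \<le> ln (2::real)" "ln (2::real) \<le> 693147181 / 1000000000"
proof -
  have "ln (2::real) = ln (4/3 * (3/2))" by simp
  also have "\<dots> = ln (4/3) + ln (3/2)" by (subst ln_mult) auto
  finally show "693147180 / 1000000000 \<le> ln (2::real)" "ln (2::real) \<le> 693147181 / 1000000000"
    using ln_atanh_bounds [of "4/3"] ln_atanh_bounds [of "3/2"] by (simp_all add: atanh_sum_def power_divide)
qed

text \<open>Range reduction: with this lemma and the next two, the tabulated arguments become
  \<open>q / 2^k\<close>, \<open>1 / (q * 2^k)\<close> or \<open>2 / q\<close> with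
  \<open>1 < q \<le> 3/2\<close>.\<close>

lemma ln_bounds_mult:
  assumes "1 < q" "q \<le> 3/2" "r = q / 2^k"
  shows "atanh_sum ((q - 1) / (q + 1)) - k * (693147181 / 1000000000) \<le> ln r"
    "ln r \<le> atanh_sum ((q - 1) / (q + 1)) + 2 / 10000000000 - k * (693147180 / 1000000000)"
proof -
  have "ln r = ln q - k * ln 2" using assms by (simp add: ln_div ln_realpow)
  moreover have "k * (693147180 / 1000000000) \<le> k * ln (2::real)" "k * ln (2::real) \<le> k * (693147181 / 1000000000)"
    by (intro mult_left_mono ln_2_bounds of_nat_0_le_iff)+
  ultimately show "atanh_sum ((q - 1) / (q + 1)) - k * (693147181 / 1000000000) \<le> ln r"
    "ln r \<le> atanh_sum ((q - 1) / (q + 1)) + 2 / 10000000000 - k * (693147180 / 1000000000)"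
    using ln_atanh_bounds [OF assms(1,2)] by linarith+
qed

lemma ln_bounds_inv:
  assumes "1 < q" "q \<le> 3/2" "r = 1 / (q * 2^k)"
  shows "- (atanh_sum ((q - 1) / (q + 1)) + 2 / 10000000000) - k * (693147181 / 1000000000) \<le> ln r"
    "ln r \<le> - atanh_sum ((q - 1) / (q + 1)) - k * (693147180 / 1000000000)"
proof -
  have "ln r = - ln q - k * ln 2" using assms by (simp add: ln_div ln_mult ln_realpow)
  moreover have "k * (693147180 / 1000000000) \<le> k * ln (2::real)" "k * ln (2::real) \<le> k * (693147181 / 1000000000)"
    by (intro mult_left_mono ln_2_bounds of_nat_0_le_iff)+
  ultimately show "- (atanh_sum ((q - 1) / (q + 1)) + 2 / 10000000000) - k * (693147181 / 1000000000) \<le> ln r"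
    "ln r \<le> - atanh_sum ((q - 1) / (q + 1)) - k * (693147180 / 1000000000)"
    using ln_atanh_bounds [OF assms(1,2)] by linarith+
qed

lemma ln_bounds_two:
  assumes "1 < q" "q \<le> 3/2" "r = 2 / q"
  shows "693147180 / 1000000000 - (atanh_sum ((q - 1) / (q + 1)) + 2 / 10000000000) \<le> ln r"
    "ln r \<le> 693147181 / 1000000000 - atanh_sum ((q - 1) / (q + 1))"
proof -
  have "ln r = ln 2 - ln q" using assms by (simp add: ln_div)
  then show "693147180 / 1000000000 - (atanh_sum ((q - 1) / (q + 1)) + 2 / 10000000000) \<le> ln r"
    "ln r \<le> 693147181 / 1000000000 - atanh_sum ((q - 1) / (q + 1))"
    using ln_atanh_bounds [OF assms(1,2)] ln_2_bounds by linarith+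
qed

section \<open>Table of logarithms\<close>

lemma ln_0_2: "- 160943793 / 100000000 \<le> ln (1 / 5 :: real)" "ln (1 / 5 :: real) \<le> - 160943790 / 100000000"
  using ln_bounds_inv [of "5 / 4" "1 / 5" 2] by (simp_all add: atanh_sum_def power_divide)

lemma ln_0_09: "- 240794562 / 100000000 \<le> ln (9 / 100 :: real)" "ln (9 / 100 :: real) \<le> - 240794559 / 100000000"
  using ln_bounds_mult [of "36 / 25" "9 / 100" 4] by (simp_all add: atanh_sum_def power_divide)

lemma ln_0_03: "- 350655791 / 100000000 \<le> ln (3 / 100 :: real)" "ln (3 / 100 :: real) \<le> - 350655788 / 100000000"
  using ln_bounds_inv [of "25 / 24" "3 / 100" 5] by (simp_all add: atanh_sum_def power_divide)

lemma ln_1_85: "61518562 / 100000000 \<le> ln (37 / 20 :: real)" "ln (37 / 20 :: real) \<le> 61518565 / 100000000"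
  using ln_bounds_two [of "40 / 37" "37 / 20"] by (simp_all add: atanh_sum_def power_divide)

lemma ln_1_94: "66268796 / 100000000 \<le> ln (97 / 50 :: real)" "ln (97 / 50 :: real) \<le> 66268799 / 100000000"
  using ln_bounds_two [of "100 / 97" "97 / 50"] by (simp_all add: atanh_sum_def power_divide)

lemma ln_0_6: "- 51082564 / 100000000 \<le> ln (3 / 5 :: real)" "ln (3 / 5 :: real) \<le> - 51082561 / 100000000"
  using ln_bounds_mult [of "6 / 5" "3 / 5" 1] by (simp_all add: atanh_sum_def power_divide)

lemma ln_0_84: "- 17435340 / 100000000 \<le> ln (21 / 25 :: real)" "ln (21 / 25 :: real) \<le> - 17435337 / 100000000"
  using ln_bounds_inv [of "25 / 21" "21 / 25" 0] by (simp_all add: atanh_sum_def power_divide)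

lemma ln_0_94: "- 6187542 / 100000000 \<le> ln (47 / 50 :: real)" "ln (47 / 50 :: real) \<le> - 6187539 / 100000000"
  using ln_bounds_inv [of "50 / 47" "47 / 50" 0] by (simp_all add: atanh_sum_def power_divide)

lemma ln_0_06: "- 281341073 / 100000000 \<le> ln (3 / 50 :: real)" "ln (3 / 50 :: real) \<le> - 281341070 / 100000000"
  using ln_bounds_inv [of "25 / 24" "3 / 50" 4] by (simp_all add: atanh_sum_def power_divide)

lemma ln_0_1164: "- 215072276 / 100000000 \<le> ln (291 / 2500 :: real)" "ln (291 / 2500 :: real) \<le> - 215072273 / 100000000"
  using ln_bounds_inv [of "625 / 582" "291 / 2500" 3] by (simp_all add: atanh_sum_def power_divide)

lemma ln_0_88: "- 12783339 / 100000000 \<le> ln (22 / 25 :: real)" "ln (22 / 25 :: real) \<le> - 12783336 / 100000000"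
  using ln_bounds_inv [of "25 / 22" "22 / 25" 0] by (simp_all add: atanh_sum_def power_divide)

lemma ln_0_12: "- 212026355 / 100000000 \<le> ln (3 / 25 :: real)" "ln (3 / 25 :: real) \<le> - 212026352 / 100000000"
  using ln_bounds_inv [of "25 / 24" "3 / 25" 3] by (simp_all add: atanh_sum_def power_divide)

lemma ln_0_08: "- 252572866 / 100000000 \<le> ln (2 / 25 :: real)" "ln (2 / 25 :: real) \<le> - 252572863 / 100000000"
  using ln_bounds_mult [of "32 / 25" "2 / 25" 4] by (simp_all add: atanh_sum_def power_divide)

lemma ln_0_1352: "- 200100013 / 100000000 \<le> ln (169 / 1250 :: real)" "ln (169 / 1250 :: real) \<le> - 200100010 / 100000000"
  using ln_bounds_mult [of "676 / 625" "169 / 1250" 3] by (simp_all add: atanh_sum_def power_divide)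

lemma ln_0_93: "- 7257071 / 100000000 \<le> ln (93 / 100 :: real)" "ln (93 / 100 :: real) \<le> - 7257068 / 100000000"
  using ln_bounds_inv [of "100 / 93" "93 / 100" 0] by (simp_all add: atanh_sum_def power_divide)

lemma ln_0_07: "- 265926005 / 100000000 \<le> ln (7 / 100 :: real)" "ln (7 / 100 :: real) \<le> - 265926002 / 100000000"
  using ln_bounds_mult [of "28 / 25" "7 / 100" 4] by (simp_all add: atanh_sum_def power_divide)

lemma ln_0_945: "- 5657037 / 100000000 \<le> ln (189 / 200 :: real)" "ln (189 / 200 :: real) \<le> - 5657034 / 100000000"
  using ln_bounds_inv [of "200 / 189" "189 / 200" 0] by (simp_all add: atanh_sum_def power_divide)

lemma ln_0_055: "- 290042211 / 100000000 \<le> ln (11 / 200 :: real)" "ln (11 / 200 :: real) \<le> - 290042208 / 100000000"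
  using ln_bounds_inv [of "25 / 22" "11 / 200" 4] by (simp_all add: atanh_sum_def power_divide)

lemma ln_0_89: "- 11653383 / 100000000 \<le> ln (89 / 100 :: real)" "ln (89 / 100 :: real) \<le> - 11653380 / 100000000"
  using ln_bounds_inv [of "100 / 89" "89 / 100" 0] by (simp_all add: atanh_sum_def power_divide)

lemma ln_0_11: "- 220727493 / 100000000 \<le> ln (11 / 100 :: real)" "ln (11 / 100 :: real) \<le> - 220727490 / 100000000"
  using ln_bounds_inv [of "25 / 22" "11 / 100" 3] by (simp_all add: atanh_sum_def power_divide)

lemma ln_0_96: "- 4082201 / 100000000 \<le> ln (24 / 25 :: real)" "ln (24 / 25 :: real) \<le> - 4082198 / 100000000"
  using ln_bounds_inv [of "25 / 24" "24 / 25" 0] by (simp_all add: atanh_sum_def power_divide)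

lemma ln_0_04: "- 321887584 / 100000000 \<le> ln (1 / 25 :: real)" "ln (1 / 25 :: real) \<le> - 321887581 / 100000000"
  using ln_bounds_mult [of "32 / 25" "1 / 25" 5] by (simp_all add: atanh_sum_def power_divide)

lemma ln_0_92: "- 8338162 / 100000000 \<le> ln (23 / 25 :: real)" "ln (23 / 25 :: real) \<le> - 8338159 / 100000000"
  using ln_bounds_inv [of "25 / 23" "23 / 25" 0] by (simp_all add: atanh_sum_def power_divide)

lemma ln_0_98: "- 2020272 / 100000000 \<le> ln (49 / 50 :: real)" "ln (49 / 50 :: real) \<le> - 2020269 / 100000000"
  using ln_bounds_inv [of "50 / 49" "49 / 50" 0] by (simp_all add: atanh_sum_def power_divide)

lemma ln_0_02: "- 391202302 / 100000000 \<le> ln (1 / 50 :: real)" "ln (1 / 50 :: real) \<le> - 391202299 / 100000000"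
  using ln_bounds_mult [of "32 / 25" "1 / 50" 6] by (simp_all add: atanh_sum_def power_divide)

lemma ln_0_895: "- 11093158 / 100000000 \<le> ln (179 / 200 :: real)" "ln (179 / 200 :: real) \<le> - 11093155 / 100000000"
  using ln_bounds_inv [of "200 / 179" "179 / 200" 0] by (simp_all add: atanh_sum_def power_divide)

lemma ln_0_105: "- 225379494 / 100000000 \<le> ln (21 / 200 :: real)" "ln (21 / 200 :: real) \<le> - 225379491 / 100000000"
  using ln_bounds_inv [of "25 / 21" "21 / 200" 3] by (simp_all add: atanh_sum_def power_divide)

lemma ln_0_8648: "- 14525703 / 100000000 \<le> ln (1081 / 1250 :: real)" "ln (1081 / 1250 :: real) \<le> - 14525700 / 100000000"
  using ln_bounds_inv [of "1250 / 1081" "1081 / 1250" 0] by (simp_all add: atanh_sum_def power_divide)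

lemma ln_0_4: "- 91629075 / 100000000 \<le> ln (2 / 5 :: real)" "ln (2 / 5 :: real) \<le> - 91629072 / 100000000"
  using ln_bounds_inv [of "5 / 4" "2 / 5" 1] by (simp_all add: atanh_sum_def power_divide)

lemma ln_0_67: "- 400477568 / 1000000000 \<le> ln (67 / 100 :: real)" "ln (67 / 100 :: real) \<le> - 400477565 / 1000000000"
  using ln_bounds_mult [of "67 / 50" "67 / 100" 1] by (simp_all add: atanh_sum_def power_divide)

lemma ln_0_33: "- 1108662626 / 1000000000 \<le> ln (33 / 100 :: real)" "ln (33 / 100 :: real) \<le> - 1108662623 / 1000000000"
  using ln_bounds_mult [of "33 / 25" "33 / 100" 2] by (simp_all add: atanh_sum_def power_divide)

lemma ln_1_67: "512823625 / 1000000000 \<le> ln (167 / 100 :: real)" "ln (167 / 100 :: real) \<le> 512823628 / 1000000000"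
  using ln_bounds_two [of "200 / 167" "167 / 100"] by (simp_all add: atanh_sum_def power_divide)

text \<open>Close to a tabulated \<open>a\<close> one term of the series is enough, as the remainder
  is cubic in a quantity of size at most \<open>1/1000\<close>.\<close>

lemma ln_near:
  fixes a x :: real
  assumes "0 < a" "a < x" "(x - a) / (x + a) \<le> 1/1000"
  shows "2 * ((x - a) / (x + a)) \<le> ln x - ln a"
    "ln x - ln a \<le> 2 * ((x - a) / (x + a)) + 1 / 1000000000"
proof -
  define y where "y = (x - a) / (x + a)"
  have y: "0 \<le> y" "y \<le> 1/1000" using assms by (auto simp: y_def)
  have "x / a - 1 = (x - a) / a" "x / a + 1 = (x + a) / a"
    using assms by (simp_all add: diff_divide_distrib add_divide_distrib)
  then have q: "1 < x / a" "(x / a - 1) / (x / a + 1) = y" using assms by (simp_all add: y_def)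
  have "2 * y \<le> ln (x / a)" "ln (x / a) \<le> 2 * y + 2 * (y ^ 3 / (1 - y\<^sup>2) / 3)"
    using ln_approx_bounds [OF q(1), of 1] unfolding q(2) by (simp_all add: numeral_3_eq_3)
  moreover have "y ^ 3 / (1 - y\<^sup>2) / 3 \<le> (1/1000) ^ 3 / (1 - (1/1000)\<^sup>2) / 3"
    using y by (intro divide_right_mono frac_le power_mono diff_left_mono) (auto simp: power2_eq_square intro: mult_mono)
  moreover have "(1/1000) ^ 3 / (1 - (1/1000)\<^sup>2) / 3 \<le> (1 / 2000000000 :: real)"
    by (simp add: power_divide)
  moreover have "ln (x / a) = ln x - ln a" using assms by (simp add: ln_div)
  ultimately show "2 * ((x - a) / (x + a)) \<le> ln x - ln a"
    "ln x - ln a \<le> 2 * ((x - a) / (x + a)) + 1 / 1000000000"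
    unfolding y_def [symmetric] by linarith+
qed

text \<open>0.329454 and 0.329455 will enclose \<open>b_const\<close>. The four lemmas after the
  next one concern the matching values of \<open>1 - b\<close> and \<open>2 - b\<close>.\<close>

lemma ln_b_lo: "- 1110318546 / 1000000000 \<le> ln (164727/500000 :: real)" "ln (164727/500000 :: real) \<le> - 1110318535 / 1000000000"
  using ln_near [of "164727/500000" "33/100"] ln_0_33 by simp_all

lemma ln_b_hi: "- 1110315510 / 1000000000 \<le> ln (65891/200000 :: real)" "ln (65891/200000 :: real) \<le> - 1110315499 / 1000000000"
  using ln_near [of "65891/200000" "33/100"] ln_0_33 by simp_all

lemma ln_x_hi: "- 399662979 / 1000000000 \<le> ln (335273/500000 :: real)" "ln (335273/500000 :: real) \<le> - 399662968 / 1000000000"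
  using ln_near [of "67/100" "335273/500000"] ln_0_67 by simp_all

lemma ln_x_lo: "- 399664470 / 1000000000 \<le> ln (134109/200000 :: real)" "ln (134109/200000 :: real) \<le> - 399664459 / 1000000000"
  using ln_near [of "67/100" "134109/200000"] ln_0_67 by simp_all

lemma ln_1x_hi: "513150514 / 1000000000 \<le> ln (835273/500000 :: real)" "ln (835273/500000 :: real) \<le> 513150525 / 1000000000"
  using ln_near [of "167/100" "835273/500000"] ln_1_67 by simp_all

lemma ln_1x_lo: "513149915 / 1000000000 \<le> ln (334109/200000 :: real)" "ln (334109/200000 :: real) \<le> 513149926 / 1000000000"
  using ln_near [of "167/100" "334109/200000"] ln_1_67 by simp_all

section \<open>Bounds for the second derivative\<close>

text \<open>\<open>ln (1 - x) = 2 * ln s\<close> with \<open>s = sqrt (1 - x)\<close>, and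
  \<open>ln s \<ge> 1 - 1 / s\<close> reduces the claim to
  \<open>(1 - s) * (1 - 2 * s) \<ge> 0\<close>. The form of the bound matches the pole at
  \<open>x = 1\<close> of the second derivative of \<open>gam\<close>.\<close>

lemma curv_ge:
  assumes "3/4 \<le> x" "x < 1" shows "1 / (3 * (1 - x)) \<le> curv x"
proof -
  define s where "s = sqrt (1 - x)"
  have s: "0 < s" "s\<^sup>2 = 1 - x" using assms by (auto simp: s_def)
  have "s\<^sup>2 \<le> (1/2)\<^sup>2" using s assms by (simp add: power2_eq_square)
  then have s2: "s \<le> 1/2" by (rule power2_le_imp_le) simp
  have "1 - 1 / s \<le> ln s"
    using ln_le_minus_one [of "1 / s"] s by (simp add: ln_div)
  moreover have "ln (1 - x) = 2 * ln s"
    using s by (simp add: ln_realpow flip: s(2))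
  ultimately have "2 * (1 - 1 / s) \<le> ln (1 - x)" by simp
  then have "s\<^sup>2 * (2 * (1 - 1 / s)) \<le> (1 - x) * ln (1 - x)"
    unfolding s(2) using assms by (intro mult_left_mono) auto
  moreover have "s\<^sup>2 * (2 * (1 - 1 / s)) = 2 * s\<^sup>2 - 2 * s"
    using s by (simp add: power2_eq_square field_simps)
  moreover have "- (2/3) * x \<le> 2 * s\<^sup>2 - 2 * s"
  proof -
    have "0 \<le> (1 - s) * (1 - 2 * s)" using s2 by simp
    moreover have "x = 1 - s\<^sup>2" using s by simp
    ultimately show ?thesis by (simp add: power2_eq_square algebra_simps)
  qed
  ultimately have "- (2/3) * x \<le> (1 - x) * ln (1 - x)" by linarith
  then have "- (2/3) / (1 - x) \<le> ln (1 - x) / x" using assms by (simp add: field_simps)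
  moreover have "1 / (3 * (1 - x)) = 1 / (1 - x) + - (2/3) / (1 - x)" using assms by (simp add: field_simps)
  ultimately show ?thesis by (simp add: curv_def)
qed

lemma curv_le:
  assumes "0 < x" "x < 1" shows "curv x \<le> x / (1 - x)"
proof -
  have "ln (1 - x) / x \<le> -1"
    using ln_le_minus_one [of "1 - x"] assms by (simp add: field_simps)
  moreover have "1 / (1 - x) = x / (1 - x) + 1" using assms by (simp add: field_simps)
  ultimately show ?thesis by (simp add: curv_def)
qed

lemma curv_sums:
  assumes "0 < z" "z < 1"
  shows "(\<lambda>n. real n / (real n + 1) * z ^ n) sums curv z"
proof -
  have "(\<lambda>n. - (z ^ n) / real n) sums ln (1 - z)"
    using ln_series' [of "- z"] assms by simp
  then have "(\<lambda>n. - (z ^ Suc n) / real (Suc n)) sums ln (1 - z)"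
    by (subst sums_Suc_iff) simp
  from sums_divide [OF this, of z]
  have "(\<lambda>n. - (z ^ n) / real (Suc n)) sums (ln (1 - z) / z)"
    using assms by simp
  from sums_add [OF geometric_sums [of z] this]
  have "(\<lambda>n. z ^ n - z ^ n / (real n + 1)) sums curv z"
    using assms by (simp add: curv_def add.commute)
  moreover have "z ^ n - z ^ n / (real n + 1) = real n / (real n + 1) * z ^ n" for n
    by (simp add: field_simps)
  ultimately show ?thesis by simp
qed

text \<open>Compare the power series termwise, the term of degree \<open>2 k + 2\<close> on the left with those of
  degrees \<open>2 k + 1\<close> and \<open>2 k + 2\<close> on the right.\<close>

lemma curv_square_le:
  assumes "0 < x" "x \<le> 3/4" shows "14 / 3 * curv (x\<^sup>2) \<le> 2 * curv x"
proof -
  let ?a = "\<lambda>n. real n / (real n + 1) * x ^ n"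
  let ?b = "\<lambda>n. real n / (real n + 1) * (x\<^sup>2) ^ n"
  have "?a sums curv x" using assms by (intro curv_sums) auto
  then have "(\<lambda>n. ?a (Suc n)) sums curv x" by (subst sums_Suc_iff) simp
  from sums_group [OF this, of 2]
  have "(\<lambda>n. sum (\<lambda>n. ?a (Suc n)) {n * 2..<n * 2 + 2}) sums curv x" by simp
  then have 1: "(\<lambda>k. ?a (2 * k + 1) + ?a (2 * k + 2)) sums curv x"
    by (simp add: eval_nat_numeral mult.commute)
  have "x\<^sup>2 < 1" using assms by (simp add: power_less_one_iff abs_square_less_1)
  then have "?b sums curv (x\<^sup>2)" using assms by (intro curv_sums) auto
  then have 2: "(\<lambda>k. ?b (Suc k)) sums curv (x\<^sup>2)" by (subst sums_Suc_iff) simp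
  show ?thesis
  proof (rule sums_le [OF _ sums_mult [OF 2, of "14/3"] sums_mult [OF 1, of 2]])
    fix k
    define K where "K = real k + 1"
    have K: "K \<ge> 1" by (simp add: K_def)
    \<comment> \<open>The termwise comparison divided by the power \<open>2 * k + 1\<close> of
      \<open>x\<close>. At \<open>x = 3/4\<close> both sides tend to 2 for large \<open>K\<close>,
      so \<open>14/3\<close> is the largest factor this method allows.\<close>
    have key: "x * (14 / 3 * (K / (K + 1)) - 4 * K / (2 * K + 1)) \<le> (2 * K - 1) / K"
    proof -
      have "0 \<le> 14 / 3 * (K / (K + 1)) - 4 * K / (2 * K + 1)"
        using K by (simp add: field_simps)
      then have "x * (14 / 3 * (K / (K + 1)) - 4 * K / (2 * K + 1))
          \<le> 3/4 * (14 / 3 * (K / (K + 1)) - 4 * K / (2 * K + 1))"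
        using assms by (intro mult_right_mono) auto
      also have "\<dots> \<le> (2 * K - 1) / K"
      proof -
        have "(2 * K - 1) / K - 3/4 * (14 / 3 * (K / (K + 1)) - 4 * K / (2 * K + 1))
            = (7/2 * (K * K) - K - 1) / (K * (K + 1) * (2 * K + 1))"
          using K by (simp add: divide_simps) (simp add: algebra_simps)
        moreover have "1 * K \<le> K * K" using K by (intro mult_right_mono) auto
        then have "0 \<le> 7/2 * (K * K) - K - 1" using K by linarith
        then have "0 \<le> (7/2 * (K * K) - K - 1) / (K * (K + 1) * (2 * K + 1))"
          using K by (intro divide_nonneg_nonneg) auto
        ultimately show ?thesis by linarith
      qed
      finally show ?thesis .
    qed
    show "14 / 3 * ?b (Suc k) \<le> 2 * (?a (2 * k + 1) + ?a (2 * k + 2))"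
    proof -
      define p where "p = x ^ (2 * k + 1)"
      have p: "0 \<le> p" "x ^ (2 * k + 2) = x * p" "(x\<^sup>2) ^ Suc k = x * p"
        using assms by (simp_all add: p_def power_even_eq mult.commute flip: power_mult power_Suc)
      have r: "real (Suc k) = K" "real (Suc k) + 1 = K + 1" "real (2 * k + 1) = 2 * K - 1"
        "real (2 * k + 1) + 1 = 2 * K" "real (2 * k + 2) = 2 * K" "real (2 * k + 2) + 1 = 2 * K + 1"
        by (simp_all add: K_def)
      have "p * (x * (14 / 3 * (K / (K + 1)) - 4 * K / (2 * K + 1))) \<le> p * ((2 * K - 1) / K)"
        using key p by (intro mult_left_mono) auto
      moreover have "2 * ((2 * K - 1) / (2 * K) * p) = p * ((2 * K - 1) / K)"
        using K by (simp add: field_simps)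
      ultimately show ?thesis
        unfolding r p(2,3) p_def [symmetric] by (simp add: algebra_simps)
    qed
  qed
qed

lemma curv_square_eq:
  assumes "0 < x" "x < 1"
  shows "curv (x\<^sup>2) = 1 / ((1 - x) * (1 + x)) + (ln (1 - x) + ln (1 + x)) / x\<^sup>2"
proof -
  have "1 - x\<^sup>2 = (1 - x) * (1 + x)" by (simp add: power2_eq_square algebra_simps)
  then show ?thesis using assms by (simp add: curv_def ln_mult)
qed

lemma ln_ge_tangent:
  assumes "0 < c" "0 < (t::real)" shows "ln c + 1 - c / t \<le> ln t"
  using ln_le_minus_one [of "c / t"] assms by (simp add: ln_div)

text \<open>The left side is the second derivative of \<open>r * nu (2 * u) - 2 * nu u\<close>.
  Bounding \<open>ln (1 - x)\<close> and \<open>ln (1 + x)\<close> from below by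
  \<open>ln_ge_tangent\<close> at \<open>c'\<close> and \<open>c\<close>, and clearing denominators,
  leaves the polynomial inequality. \<open>4764/1000\<close> is four times the lower bound for
  \<open>r\<close>; \<open>k\<close> and \<open>l\<close> are rational substitutes for
  \<open>- ln c' - 1\<close> and \<open>ln c + 1\<close>.\<close>

lemma curv_diff_le:
  assumes x: "0 < x" "x < 1" and cs: "0 < c" "0 < c'" and r: "1191/1000 \<le> r"
    and k: "- ln c' - 1 \<le> k" and l: "l \<le> ln c + 1"
    and poly: "2 * x\<^sup>2 * (1 + x) - 4764/1000 * x\<^sup>2 + (c' + k * (1 - x)) * (4764/1000 - 2 * x) * (1 + x)
      - 4764/1000 * ((1 - x) * (l * (1 + x) - c)) - K * ((1 - x) * x\<^sup>2 * (1 + x)) \<le> 0"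
  shows "2 * curv x - 4 * r * curv (x\<^sup>2) \<le> K"
proof -
  define t where "t = 1 - x"
  define L where "L = - ln t"
  define M where "M = ln (1 + x)"
  have t: "0 < t" "t < 1" using x by (auto simp: t_def)
  have "x\<^sup>2 < 1" using x by (simp add: power_less_one_iff abs_square_less_1)
  then have "0 \<le> curv (x\<^sup>2)" using x by (intro curv_nonneg) auto
  then have "1191/1000 * curv (x\<^sup>2) \<le> r * curv (x\<^sup>2)" using r by (intro mult_right_mono) auto
  then have "2 * curv x - 4 * r * curv (x\<^sup>2) \<le> 2 * curv x - 4764/1000 * curv (x\<^sup>2)" by linarith
  moreover have "2 * curv x - 4764/1000 * curv (x\<^sup>2) \<le> K"
  proof -
    have "ln c' + 1 - c' / t \<le> ln t" using cs t by (intro ln_ge_tangent)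
    then have "L \<le> k + c' / t" using k by (simp add: L_def)
    then have "t * L \<le> t * (k + c' / t)" using t by (intro mult_left_mono) auto
    moreover have "t * (k + c' / t) = c' + k * t" using t by (simp add: field_simps)
    ultimately have tL: "t * L \<le> c' + k * t" by simp
    have "l - c / (1 + x) \<le> M" using ln_ge_tangent [of c "1 + x"] cs x l by (simp add: M_def)
    then have "(1 + x) * (l - c / (1 + x)) \<le> (1 + x) * M" using x by (intro mult_left_mono) auto
    moreover have "(1 + x) * (l - c / (1 + x)) = l * (1 + x) - c" using x by (simp add: field_simps)
    ultimately have "l * (1 + x) - c \<le> (1 + x) * M" by simp
    then have M: "t * (l * (1 + x) - c) \<le> t * ((1 + x) * M)" using t by (intro mult_left_mono) auto
    have "t * L * ((4764/1000 - 2 * x) * (1 + x)) \<le> (c' + k * t) * ((4764/1000 - 2 * x) * (1 + x))"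
      using tL x by (intro mult_right_mono) auto
    then have *: "2 * x\<^sup>2 * (1 + x) - 4764/1000 * x\<^sup>2 + t * L * ((4764/1000 - 2 * x) * (1 + x))
        - 4764/1000 * (t * ((1 + x) * M)) \<le> K * (t * x\<^sup>2 * (1 + x))"
      using poly M unfolding t_def [symmetric] by (simp add: mult.assoc)
    have cx: "curv x = 1 / t - L / x" "curv (x\<^sup>2) = 1 / (t * (1 + x)) + (M - L) / x\<^sup>2"
      using curv_square_eq [OF x] by (simp_all add: curv_def t_def L_def M_def)
    have A: "curv x * (t * x\<^sup>2 * (1 + x)) = x\<^sup>2 * (1 + x) - t * L * (x * (1 + x))"
      unfolding cx(1) using t x by (simp add: field_simps power2_eq_square)
    have "1 / (t * (1 + x)) * (t * x\<^sup>2 * (1 + x)) = x\<^sup>2" "(M - L) / x\<^sup>2 * (t * x\<^sup>2 * (1 + x)) = t * (M - L) * (1 + x)"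
      using t x by simp_all
    then have B: "curv (x\<^sup>2) * (t * x\<^sup>2 * (1 + x)) = x\<^sup>2 + t * (M - L) * (1 + x)"
      unfolding cx(2) distrib_right by simp
    have "(2 * curv x - 4764/1000 * curv (x\<^sup>2)) * (t * x\<^sup>2 * (1 + x))
      = 2 * (curv x * (t * x\<^sup>2 * (1 + x))) - 4764/1000 * (curv (x\<^sup>2) * (t * x\<^sup>2 * (1 + x)))"
      by (simp only: left_diff_distrib mult.assoc)
    also have "\<dots> = 2 * x\<^sup>2 * (1 + x) - 4764/1000 * x\<^sup>2 + t * L * ((4764/1000 - 2 * x) * (1 + x))
        - 4764/1000 * (t * ((1 + x) * M))"
      unfolding A B by (simp add: field_simps)
    finally have "(2 * curv x - 4764/1000 * curv (x\<^sup>2)) * (t * x\<^sup>2 * (1 + x)) \<le> K * (t * x\<^sup>2 * (1 + x))"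
      using * by simp
    then show ?thesis using t x by (simp add: mult_le_cancel_right)
  qed
  ultimately show ?thesis by linarith
qed

text \<open>The coefficients come from dividing the polynomial of \<open>curv_diff_le\<close> by \<open>(x - a) (x - b)\<close> on an
  interval from \<open>a\<close> to \<open>b\<close>: the quotient is nonnegative there, and the remainder is linear.\<close>

lemma curv_diff_le_mid:
  assumes x: "3/4 \<le> x" "x \<le> 47/50" and r: "1191/1000 \<le> r"
  shows "2 * curv x - 4 * r * curv (x\<^sup>2) \<le> 69/100"
proof (cases "x \<le> 22/25")
  case True
  show ?thesis
  \<comment> \<open>\<open>c\<close> and \<open>c'\<close> are interior points of the ranges of
    \<open>1 + x\<close> and \<open>1 - x\<close>.\<close>
  proof (rule curv_diff_le [where c = "37/20" and c' = "1/5" and k = "60944/100000" and l = "161518/100000"])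
    have "(x - 3/4) * (x - 22/25) * (189049519/25000000 + 217179/50000 * x + 69/100 * x\<^sup>2) \<le> 0"
      using x True by (intro mult_nonpos_nonneg mult_nonneg_nonpos add_nonneg_nonneg) auto
    moreover have "2 * x\<^sup>2 * (1 + x) - 4764/1000 * x\<^sup>2 + (1/5 + 60944/100000 * (1 - x)) * (4764/1000 - 2 * x) * (1 + x)
      - 4764/1000 * ((1 - x) * (161518/100000 * (1 + x) - 37/20)) - 69/100 * ((1 - x) * x\<^sup>2 * (1 + x))
      = (- 20065827/1250000000 - 50535403/2500000000 * x) + (x - 3/4) * (x - 22/25) * (189049519/25000000 + 217179/50000 * x + 69/100 * x\<^sup>2)"
      by (simp add: field_simps power2_eq_square)
    ultimately show "2 * x\<^sup>2 * (1 + x) - 4764/1000 * x\<^sup>2 + (1/5 + 60944/100000 * (1 - x)) * (4764/1000 - 2 * x) * (1 + x)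
      - 4764/1000 * ((1 - x) * (161518/100000 * (1 + x) - 37/20)) - 69/100 * ((1 - x) * x\<^sup>2 * (1 + x)) \<le> 0"
      using x by linarith
  qed (use x r ln_0_2 ln_1_85 in auto)
next
  case False
  show ?thesis
  proof (rule curv_diff_le [where c = "37/20" and c' = "9/100" and k = "140795/100000" and l = "161518/100000"])
    have "(x - 87/100) * (x - 47/50) * (194156243/25000000 + 7581/1250 * x + 69/100 * x\<^sup>2) \<le> 0"
      using x False by (intro mult_nonpos_nonneg mult_nonneg_nonpos add_nonneg_nonneg) auto
    moreover have "2 * x\<^sup>2 * (1 + x) - 4764/1000 * x\<^sup>2 + (9/100 + 140795/100000 * (1 - x)) * (4764/1000 - 2 * x) * (1 + x)
      - 4764/1000 * ((1 - x) * (161518/100000 * (1 + x) - 37/20)) - 69/100 * ((1 - x) * x\<^sup>2 * (1 + x))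
      = (237959657373/125000000000 - 5708553617/2500000000 * x) + (x - 87/100) * (x - 47/50) * (194156243/25000000 + 7581/1250 * x + 69/100 * x\<^sup>2)"
      by (simp add: field_simps power2_eq_square)
    ultimately show "2 * x\<^sup>2 * (1 + x) - 4764/1000 * x\<^sup>2 + (9/100 + 140795/100000 * (1 - x)) * (4764/1000 - 2 * x) * (1 + x)
      - 4764/1000 * ((1 - x) * (161518/100000 * (1 + x) - 37/20)) - 69/100 * ((1 - x) * x\<^sup>2 * (1 + x)) \<le> 0"
      using x False by linarith
  qed (use x r ln_0_09 ln_1_85 in auto)
qed

lemma curv_diff_le_high:
  assumes x: "47/50 \<le> x" "x < 1" and r: "1191/1000 \<le> r"
  shows "2 * curv x - 4 * r * curv (x\<^sup>2) \<le> 0"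
proof (rule curv_diff_le [where c = "97/50" and c' = "3/100" and k = "250656/100000" and l = "166268/100000"])
  have "(x - 47/50) * (x - 1) * (42257553/6250000 + 21916/3125 * x) \<le> 0"
    using x by (intro mult_nonpos_nonneg mult_nonneg_nonpos add_nonneg_nonneg) auto
  moreover have "2 * x\<^sup>2 * (1 + x) - 4764/1000 * x\<^sup>2 + (3/100 + 250656/100000 * (1 - x)) * (4764/1000 - 2 * x) * (1 + x)
      - 4764/1000 * ((1 - x) * (166268/100000 * (1 + x) - 97/50)) - 0 * ((1 - x) * x\<^sup>2 * (1 + x))
      = (2203058859/312500000 - 2389983859/312500000 * x) + (x - 47/50) * (x - 1) * (42257553/6250000 + 21916/3125 * x)"
      by (simp add: field_simps power2_eq_square)
    ultimately show "2 * x\<^sup>2 * (1 + x) - 4764/1000 * x\<^sup>2 + (3/100 + 250656/100000 * (1 - x)) * (4764/1000 - 2 * x) * (1 + x)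
      - 4764/1000 * ((1 - x) * (166268/100000 * (1 + x) - 97/50)) - 0 * ((1 - x) * x\<^sup>2 * (1 + x)) \<le> 0"
      using x by linarith
qed (use x r ln_0_03 ln_1_94 in auto)

section \<open>The kernel inequality\<close>

lemma nu_minus_ln': "0 < x \<Longrightarrow> nu (- ln x) = - ln x - (1 / x - 1) * ln (1 - x)"
  by (simp add: nu_def exp_minus inverse_eq_divide)

lemma ent_le_ln_2:
  assumes "0 \<le> x" "x \<le> 1" shows "ent x \<le> ln 2"
  using ent_plus_le_ln_add [of x 1 1] assms by simp

text \<open>The branch of \<open>gam'\<close> for \<open>x \<ge> 3/4\<close> as a function of its
  own: it is differentiable at \<open>u = ln (4/3)\<close>, where \<open>gam'\<close> has a
  kink.\<close>

definition gam_high' :: "real \<Rightarrow> real" where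
  "gam_high' u = (ln 2 + ent (2 * exp (- u) - 1)) / 2 * exp u + ln ((2 * exp (- u) - 1) / (2 - 2 * exp (- u)))"

lemma exp_minus_bounds_high:
  assumes "0 < u" "u \<le> ln (4/3)" shows "3/4 \<le> exp (- u)" "exp (- u) < (1::real)"
proof -
  have "exp (- ln (4/3)) \<le> exp (- u)" using assms by simp
  then show "3/4 \<le> exp (- u)" by (simp add: exp_minus)
qed (use assms in simp)

lemma gam'_high:
  assumes "0 < u" "u \<le> ln (4/3)" shows "gam' u = gam_high' u"
proof (cases "exp (- u) = 3/4")
  case True
  then show ?thesis using ent_half unfolding gam'_def gam_high'_def True by simp
next
  case False
  then show ?thesis using exp_minus_bounds_high [OF assms] by (simp add: gam'_def gam_high'_def Let_def)
qed

lemma DERIV_gam_high':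
  assumes "0 < u" "u \<le> ln (4/3)"
  defines "x \<equiv> exp (- u)"
  shows "(gam_high' has_real_derivative gam_high' u - x / ((2 * x - 1) * (1 - x))) (at u)"
proof -
  have x: "3/4 \<le> exp (- u)" "exp (- u) < 1" using exp_minus_bounds_high [OF assms(1,2)] by auto
  have "((\<lambda>u. ln ((2 * exp (- u) - 1) / (2 - 2 * exp (- u)))) has_real_derivative
      - exp (- u) / ((2 * exp (- u) - 1) * (1 - exp (- u)))) (at u)"
    using x by (auto intro!: derivative_eq_intros simp: divide_simps) (simp add: algebra_simps)
  moreover have "((\<lambda>u. (ln 2 + ent (2 * exp (- u) - 1)) / 2 * exp u) has_real_derivative gam_high' u) (at u)"
    using DERIV_gam_high [OF assms(1)] x unfolding gam_high'_def by (simp add: mult.commute)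
  ultimately have "((\<lambda>u. (ln 2 + ent (2 * exp (- u) - 1)) / 2 * exp u + ln ((2 * exp (- u) - 1) / (2 - 2 * exp (- u))))
      has_real_derivative gam_high' u + - exp (- u) / ((2 * exp (- u) - 1) * (1 - exp (- u)))) (at u)"
    by (rule DERIV_add [rotated])
  then show ?thesis unfolding x_def gam_high'_def [abs_def] by simp
qed

text \<open>The second bound is one for the second derivative of \<open>gam\<close>. After
  \<open>ln q \<le> q - 1\<close> the rational part is at most \<open>- 49/10\<close>, and the
  entropy part stays below the 1 that was subtracted.\<close>

lemma gam_high'_bounds:
  assumes "0 < u" "u \<le> ln (4/3)"
  defines "x \<equiv> exp (- u)"
  shows "0 \<le> gam_high' u" "gam_high' u - x / ((2 * x - 1) * (1 - x)) \<le> - 49/10"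
proof -
  have x: "3/4 \<le> x" "x < 1" using exp_minus_bounds_high [OF assms(1,2)] by (auto simp: x_def)
  have e: "0 \<le> ent (2 * x - 1)" "ent (2 * x - 1) \<le> ln 2"
    using x by (auto intro!: ent_nonneg ent_le_ln_2)
  define q where "q = (2 * x - 1) / (2 - 2 * x)"
  have q: "1 \<le> q" using x by (simp add: q_def field_simps)
  have eu: "exp u = 1 / x" by (simp add: x_def exp_minus field_simps)
  have g: "gam_high' u = (ln 2 + ent (2 * x - 1)) / 2 / x + ln q"
    using eu by (simp add: gam_high'_def x_def q_def)
  show "0 \<le> gam_high' u" unfolding g using x e q by simp
  have "(ln 2 + ent (2 * x - 1)) / 2 / x \<le> ln 2 / (3/4)"
    using e x by (intro frac_le) auto
  moreover have "ln q \<le> q - 1" using q by (intro ln_le_minus_one) auto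
  moreover have "q - x / ((2 * x - 1) * (1 - x)) + 49/10 \<le> 0"
  proof -
    have "q - x / ((2 * x - 1) * (1 - x)) + 49/10
        = - (39/10 * (2 * x - 3/2)\<^sup>2 + (1/40)) / (2 * (2 * x - 1) * (1 - x)) "
      using x by (simp add: q_def divide_simps) (simp add: algebra_simps power2_eq_square)
    also have "\<dots> \<le> 0"
      using x zero_le_power2 [of "2 * x - 3/2"] by (intro divide_nonpos_pos mult_pos_pos) linarith+
    finally show ?thesis .
  qed
  moreover define E F where "E = (ln 2 + ent (2 * x - 1)) / 2 / x" and "F = x / ((2 * x - 1) * (1 - x))"
  ultimately show "gam_high' u - x / ((2 * x - 1) * (1 - x)) \<le> - 49/10"
    using ln_2_bounds unfolding g E_def [symmetric] F_def [symmetric] by simp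
qed

text \<open>The weight of the second coupling is \<open>al\<close>, and \<open>m\<close> is the assumed lower bound for the mean of \<open>X\<close>.
  The last two assumptions say that the diagonal function of lemma \<open>diag_mid\<close> has a double zero at
  \<open>u0\<close>.\<close>

locale kernel_params =
  fixes al m rh u0 :: real
  assumes al: "3556/100000 \<le> al" "al \<le> 3565/100000"
    and m: "61765/100000 \<le> m" "m \<le> 61766/100000"
    and rh_eq: "rh = 2 * m * (1 - al)"
    and u0: "ln (4/3) \<le> u0"
    and touch: "rh * nu (2 * u0) - 2 * nu u0 + 2 * (2 * al * (ln 2 * exp u0) - al * ln 2 / m) = 0"
    and tangent: "2 * rh * nu' (2 * u0) - 2 * nu' u0 + 4 * al * (ln 2 * exp u0) = 0"
begin

lemma rh: "119125/100000 \<le> rh" "rh \<le> 119140/100000"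
proof -
  have "119125/100000 \<le> 2 * (61765/100000) * (1 - 3565/100000 :: real)" by simp
  also have "\<dots> \<le> 2 * m * (1 - al)" using al m by (intro mult_mono) auto
  finally show "119125/100000 \<le> rh" by (simp add: rh_eq)
  have "2 * m * (1 - al) \<le> 2 * (61766/100000) * (1 - 3556/100000)" using al m by (intro mult_mono) auto
  also have "\<dots> \<le> 119140/100000" by simp
  finally show "rh \<le> 119140/100000" by (simp add: rh_eq)
qed

text \<open>\<open>excess x / x\<close> in the variable \<open>u\<close>, for the
  \<open>excess\<close> defined further down.\<close>

definition tee :: "real \<Rightarrow> real" where
  "tee u = 2 * al * gam u - al * ln 2 / m"

definition phi :: "real \<Rightarrow> real" where
  "phi u = nu u - tee u"

definition phi' :: "real \<Rightarrow> real" where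
  "phi' u = nu' u - 2 * al * gam' u"

lemma DERIV_tee: "0 < u \<Longrightarrow> (tee has_real_derivative 2 * al * gam' u) (at u)"
  unfolding tee_def by (auto intro!: derivative_eq_intros DERIV_gam)

lemma DERIV_phi: "0 < u \<Longrightarrow> (phi has_real_derivative phi' u) (at u)"
  unfolding phi_def phi'_def by (auto intro!: derivative_eq_intros DERIV_nu DERIV_tee)

text \<open>\<open>gam\<close> is concave in this range, so subtracting it works against concavity.
  Its second derivative and that of \<open>nu\<close> both have a pole \<open>1 / (1 - x)\<close>,
  and \<open>al\<close> is small enough for \<open>nu\<close> to win:
  \<open>6 * al * x \<le> 2 * x - 1\<close>.\<close>

lemma phi'_antimono_high:
  assumes "0 < u" "u \<le> v" "v \<le> ln (4/3)" shows "phi' v \<le> phi' u"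
proof -
  have "nu' v - 2 * al * gam_high' v \<le> nu' u - 2 * al * gam_high' u"
  proof (rule antimono_of_deriv_nonpos [where S = "{0<..ln (4/3)}" and f = "\<lambda>u. nu' u - 2 * al * gam_high' u"])
    fix w :: real assume w: "w \<in> {0<..ln (4/3)}"
    let ?x = "exp (- w)"
    show "((\<lambda>u. nu' u - 2 * al * gam_high' u) has_real_derivative
        - curv ?x - 2 * al * (gam_high' w - ?x / ((2 * ?x - 1) * (1 - ?x)))) (at w)"
      using w by (auto intro!: derivative_eq_intros DERIV_nu' DERIV_gam_high')
    have x: "3/4 \<le> ?x" "?x < 1" using exp_minus_bounds_high [of w] w by auto
    have "2 * al * (?x / ((2 * ?x - 1) * (1 - ?x))) \<le> 1 / (3 * (1 - ?x))"
    proof -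
      have "al * ?x \<le> 3565/100000 * ?x" using al by (intro mult_right_mono) auto
      then have "6 * (al * ?x) \<le> 2 * ?x - 1" using x by linarith
      then have "6 * (al * ?x) / (2 * ?x - 1) \<le> 1" using x by simp
      then have "6 * (al * ?x) / (2 * ?x - 1) * (1 / (3 * (1 - ?x))) \<le> 1 * (1 / (3 * (1 - ?x)))"
        using x by (intro mult_right_mono) auto
      moreover have "2 * al * (?x / ((2 * ?x - 1) * (1 - ?x))) = 6 * (al * ?x) / (2 * ?x - 1) * (1 / (3 * (1 - ?x)))"
      proof -
        have aux: "2 * al * (y / (r * t)) = 6 * (al * y) / r * (1 / (3 * t))" if "r \<noteq> 0" "t \<noteq> 0" for r t y
          using that by (simp add: divide_simps)
        show ?thesis using x by (intro aux) auto
      qed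
      ultimately show ?thesis by simp
    qed
    also have "\<dots> \<le> curv ?x" using x by (rule curv_ge)
    finally have "2 * al * (?x / ((2 * ?x - 1) * (1 - ?x))) \<le> curv ?x" .
    moreover have "0 \<le> 2 * al * gam_high' w" using gam_high'_bounds(1) [of w] w al by simp
    ultimately show "- curv ?x - 2 * al * (gam_high' w - ?x / ((2 * ?x - 1) * (1 - ?x))) \<le> 0"
      by (simp add: right_diff_distrib)
  qed (use assms in auto)
  then show ?thesis using assms by (simp add: phi'_def gam'_high)
qed

lemma gam'_mid:
  assumes "ln (4/3) \<le> u" "u \<le> ln 2" shows "gam' u = ln 2 * exp u"
proof -
  have "exp (- ln 2) \<le> exp (- u)" "exp (- u) \<le> exp (- ln (4/3))" using assms by simp_all
  then have x: "1/2 \<le> exp (- u)" "exp (- u) \<le> 3/4" by (simp_all add: exp_minus)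
  show ?thesis
  proof (cases "exp (- u) = 1/2")
    case True
    have "exp u = inverse (exp (- u))" by (simp add: exp_minus)
    then have eu: "exp u = 2" unfolding True by simp
    show ?thesis unfolding gam'_def nu'_def True eu by (simp add: ln_div)
  next
    case False
    then have "\<not> exp (- u) \<le> 1/2" using x by linarith
    then show ?thesis unfolding gam'_def Let_def using x(2) by (simp only: if_False if_True)
  qed
qed

lemma gam'_low:
  assumes "ln 2 \<le> u" shows "gam' u = nu' u"
proof -
  have "exp (- u) \<le> exp (- ln 2)" using assms by simp
  then have "exp (- u) \<le> 1/2" by (simp add: exp_minus)
  then show ?thesis by (simp add: gam'_def Let_def)
qed

lemma ln_43: "0 < ln (4/3::real)" "ln (4/3) < ln (2::real)"
  by simp_all

text \<open>Of the other two pieces, the middle one subtracts a multiple of \<open>exp\<close> from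
  \<open>nu\<close>, and the low one is \<open>(1 - 2 * al) * nu\<close> plus a constant.\<close>

lemma phi'_antimono:
  assumes "0 < u" "u \<le> v" shows "phi' v \<le> phi' u"
proof -
  have mid: "phi' v \<le> phi' u" if "ln (4/3) \<le> u" "u \<le> v" "v \<le> ln 2" for u v
  proof -
    have "0 < u" using that ln_43 by linarith
    moreover have "2 * al * (ln 2 * exp u) \<le> 2 * al * (ln 2 * exp v)"
      using that al by (intro mult_left_mono) auto
    ultimately show ?thesis
      using nu'_antimono [of u v] that by (simp add: phi'_def gam'_mid)
  qed
  have low: "phi' v \<le> phi' u" if "ln 2 \<le> u" "u \<le> v" for u v
  proof -
    have "0 < u" using that ln_43 by linarith
    then have "(1 - 2 * al) * nu' v \<le> (1 - 2 * al) * nu' u"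
      using nu'_antimono [of u v] that al by (intro mult_left_mono) auto
    then show ?thesis using that by (simp add: phi'_def gam'_low algebra_simps)
  qed
  have high: "phi' (ln (4/3)) \<le> phi' u" if "u \<le> ln (4/3)" using phi'_antimono_high assms that by blast
  show ?thesis
  proof (cases "v \<le> ln (4/3)")
    case True
    then show ?thesis using phi'_antimono_high assms by blast
  next
    case False
    show ?thesis
    proof (cases "v \<le> ln 2")
      case True
      then show ?thesis using mid [of u v] mid [of "ln (4/3)" v] high False assms
        by (cases "u \<le> ln (4/3)") auto
    next
      case v: False
      then show ?thesis
        using low [of u v] low [of "ln 2" v] mid [of u "ln 2"] mid [of "ln (4/3)" "ln 2"] high assms ln_43
        by (cases "u \<le> ln (4/3)"; cases "u \<le> ln 2") auto
    qed
  qed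
qed

lemma phi_tangent: "0 < c \<Longrightarrow> 0 < u \<Longrightarrow> phi u \<le> phi c + phi' c * (u - c)"
  by (rule tangent_ge [where S = "{0<..}"]) (auto intro: DERIV_phi phi'_antimono)

lemma phi_midpoint: "0 < u \<Longrightarrow> 0 < v \<Longrightarrow> phi u + phi v \<le> 2 * phi ((u + v) / 2)"
  by (rule midpoint_ge [where S = "{0<..}"]) (auto intro: DERIV_phi phi'_antimono)

text \<open>With \<open>ln 2 * exp u\<close> in place of \<open>gam u\<close> the function is convex
  for all \<open>u \<ge> ln (4/3)\<close>, so its tangent at the double zero \<open>u0\<close>,
  which is the zero function, lies below it. It is the diagonal difference only up to
  \<open>ln 2\<close>.\<close>

lemma diag_mid:
  assumes "ln (4/3) \<le> u"
  shows "0 \<le> rh * nu (2 * u) - 2 * nu u + 2 * (2 * al * (ln 2 * exp u) - al * ln 2 / m)"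
proof -
  let ?f = "\<lambda>u. - (rh * nu (2 * u) - 2 * nu u + 2 * (2 * al * (ln 2 * exp u) - al * ln 2 / m))"
  let ?f' = "\<lambda>u. - (2 * rh * nu' (2 * u) - 2 * nu' u + 4 * al * (ln 2 * exp u))"
  have pos: "0 < w" if "ln (4/3) \<le> w" for w :: real using that ln_43 by linarith
  have d2: "((\<lambda>w. nu (2 * w)) has_real_derivative nu' (2 * w) * 2) (at w)"
    "((\<lambda>w. nu' (2 * w)) has_real_derivative - curv (exp (- (2 * w))) * 2) (at w)" if "0 < w" for w
    by (rule DERIV_chain2 [where g = "\<lambda>w. 2 * w", OF DERIV_nu]
          DERIV_chain2 [where g = "\<lambda>w. 2 * w", OF DERIV_nu'];
        use that in \<open>auto intro!: derivative_eq_intros\<close>)+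
  have "?f u \<le> ?f u0 + ?f' u0 * (u - u0)"
  proof (rule tangent_ge [where S = "{ln (4/3)..}" and f = ?f and f' = ?f'])
    show "(?f has_real_derivative ?f' w) (at w)" if "w \<in> {ln (4/3)..}" for w
      using that pos [of w] by (auto intro!: derivative_eq_intros d2 DERIV_nu)
    show "?f' w \<le> ?f' v" if "v \<in> {ln (4/3)..}" "w \<in> {ln (4/3)..}" "v \<le> w" for v w
    proof (rule antimono_of_deriv_nonpos [where S = "{ln (4/3)..}" and f = ?f'])
      fix z :: real assume "z \<in> {ln (4/3)..}"
      then have z: "ln (4/3) \<le> z" "0 < z" using pos by auto
      let ?x = "exp (- z)"
      show "(?f' has_real_derivative - (- 4 * rh * curv (exp (- (2 * z))) + 2 * curv ?x + 4 * al * (ln 2 * exp z))) (at z)"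
        using z by (auto intro!: derivative_eq_intros d2 DERIV_nu')
      have "exp (- z) \<le> exp (- ln (4/3))" using z by simp
      then have x: "0 < ?x" "?x \<le> 3/4" by (simp_all add: exp_minus)
      have x2: "exp (- (2 * z)) = ?x\<^sup>2" by (simp add: exp_double [symmetric])
      have "?x\<^sup>2 \<le> (3/4)\<^sup>2" using x by (intro power_mono) auto
      then have y: "0 < ?x\<^sup>2" "?x\<^sup>2 \<le> 9/16" by (simp_all add: power_divide)
      have "14/3 * curv (?x\<^sup>2) \<le> 2 * curv ?x" using x by (rule curv_square_le)
      \<comment> \<open>\<open>curv_square_le\<close> covers the part \<open>14/12\<close> of
        \<open>rh\<close>; the small rest is paid by the exponential term.\<close>
      moreover have "4 * (rh - 14/12) * curv (?x\<^sup>2) \<le> 4 * al * (ln 2 * exp z)"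
      proof -
        have "curv (?x\<^sup>2) \<le> ?x\<^sup>2 / (1 - ?x\<^sup>2)" using y by (intro curv_le) auto
        also have "\<dots> \<le> (9/16) / (1 - 9/16)" using y by (intro frac_le) auto
        finally have "4 * (rh - 14/12) * curv (?x\<^sup>2) \<le> 4 * (119140/100000 - 14/12) * ((9/16) / (1 - 9/16))"
          using rh y by (intro mult_mono) (auto intro: curv_nonneg)
        also have "\<dots> \<le> 4 * (3556/100000) * (693147180 / 1000000000 * (4/3))" by simp
        also have "\<dots> \<le> 4 * al * (ln 2 * exp z)"
        proof (intro mult_mono)
          have "exp (ln (4/3)) \<le> exp z" using z by (simp only: exp_le_cancel_iff)
          then show "4/3 \<le> exp z" by (subst (asm) exp_ln) simp_all
        qed (use al ln_2_bounds in auto)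
        finally show ?thesis .
      qed
      ultimately show "- (- 4 * rh * curv (exp (- (2 * z))) + 2 * curv ?x + 4 * al * (ln 2 * exp z)) \<le> 0"
        unfolding x2 by (simp add: algebra_simps)
    qed (use that in auto)
  qed (use assms u0 in auto)
  then show ?thesis using touch tangent by simp
qed

end

lemma nu_nonneg: "0 \<le> u \<Longrightarrow> 0 \<le> nu u"
  using ent_nonneg [of "exp (- u)"] by (simp add: ent_eq_nu zero_le_mult_iff)

lemma ent_le_sqrt:
  assumes "0 < x" "x < 1" shows "ent x \<le> 2 * sqrt (1 - x)"
proof -
  define s where "s = sqrt (1 - x)"
  have s: "0 < s" "s * s = 1 - x" using assms by (simp_all add: s_def)
  have "1 - 1 / x \<le> ln x" using ln_ge_tangent [of 1 x] assms by simp
  then have "x * (1 - 1 / x) \<le> x * ln x" using assms by (intro mult_left_mono) auto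
  moreover have "x * (1 - 1 / x) = x - 1" using assms by (simp add: field_simps)
  ultimately have xx: "x - 1 \<le> x * ln x" by simp
  have "ln (1 - x) = 2 * ln s" using s by (simp add: ln_mult flip: s(2))
  moreover have "1 - 1 / s \<le> ln s" using ln_ge_tangent [of 1 s] s by simp
  then have "s * s * (1 - 1 / s) \<le> s * s * ln s" by (rule mult_left_mono) simp
  moreover have "s * s * (1 - 1 / s) = s * s - s" using s by (simp add: field_simps)
  ultimately have "x - 1 - (2 * s - 2 * (s * s)) \<le> x * ln x + (1 - x) * ln (1 - x)"
    using s(2) xx by simp
  then show ?thesis using s(2) assms unfolding ent_def s_def [symmetric] by simp
qed

text \<open>The slope of \<open>nu\<close> is unbounded at 0, so chords that start at 0 are obtained
  as limits.\<close>

lemma nu_tendsto_0: "(nu \<longlongrightarrow> 0) (at_right 0)"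
proof (rule tendsto_sandwich [where f = "\<lambda>_. 0" and h = "\<lambda>u. exp u * (2 * sqrt u)"])
  show "\<forall>\<^sub>F u in at_right 0. 0 \<le> nu u"
    using eventually_at_right_less [of "0::real"] by eventually_elim (simp add: nu_nonneg)
  show "\<forall>\<^sub>F u in at_right 0. nu u \<le> exp u * (2 * sqrt u)"
    using eventually_at_right_less [of "0::real"]
  proof eventually_elim
    case (elim u)
    have "nu u = exp u * ent (exp (- u))" by (simp only: ent_eq_nu) (simp add: exp_minus)
    also have "ent (exp (- u)) \<le> 2 * sqrt (1 - exp (- u))" using elim by (intro ent_le_sqrt) auto
    also have "1 - exp (- u) \<le> u" using exp_ge_add_one_self [of "- u"] by simp
    finally show ?case by simp
  qed
  have "((\<lambda>u. exp u * (2 * sqrt u)) \<longlongrightarrow> exp 0 * (2 * sqrt 0)) (at_right 0)"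
    by (intro tendsto_intros)
  then show "((\<lambda>u. exp u * (2 * sqrt u)) \<longlongrightarrow> 0) (at_right 0)" by simp
qed simp

context kernel_params
begin

text \<open>For \<open>u \<ge> ln 2\<close> one has \<open>gam = nu\<close>, and the difference is
  increasing; at \<open>ln 2\<close> it is nonnegative by \<open>diag_mid\<close>.\<close>

lemma diag_low:
  assumes "ln 2 \<le> u"
  shows "0 \<le> rh * nu (2 * u) - 2 * phi u"
proof -
  have ln2: "0 < ln (2::real)" by simp
  have nu2: "nu (ln 2) = 2 * ln 2" by (simp add: nu_def exp_minus ln_div)
  have gam2: "gam (ln 2) = 2 * ln 2" using ent_half by (simp add: gam_def pay_def exp_minus)
  have gam: "gam w = nu w" if "ln 2 \<le> w" for w
  proof -
    have "exp (- w) \<le> exp (- ln 2)" using that by simp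
    then have "exp (- w) \<le> 1/2" by (simp add: exp_minus)
    then show ?thesis by (simp add: gam_def pay_def ent_eq_nu) (simp add: exp_minus)
  qed
  have "0 \<le> rh * nu (2 * ln 2) - 2 * phi (ln 2)"
    using diag_mid [of "ln 2"] ln_43 gam2 by (simp add: phi_def tee_def algebra_simps)
  also have "rh * nu (2 * ln 2) - 2 * phi (ln 2) \<le> rh * nu (2 * u) - 2 * phi u"
  proof -
    let ?f = "\<lambda>w. rh * nu (2 * w) - 2 * (1 - 2 * al) * nu w"
    have "?f (ln 2) \<le> ?f u"
    proof (rule DERIV_nonneg_imp_nondecreasing [OF assms])
      fix w :: real assume w': "ln 2 \<le> w" "w \<le> u"
      then have w: "ln 2 \<le> w" "w \<le> u" "0 < w" using ln2 by linarith+
      have d2: "((\<lambda>w. nu (2 * w)) has_real_derivative nu' (2 * w) * 2) (at w)"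
        by (rule DERIV_chain2 [where g = "\<lambda>w. 2 * w", OF DERIV_nu])
           (use w(3) in \<open>auto intro!: derivative_eq_intros\<close>)
      have "(?f has_real_derivative 2 * rh * nu' (2 * w) - 2 * (1 - 2 * al) * nu' w) (at w)"
        using w(3) by (auto intro!: derivative_eq_intros d2 DERIV_nu)
      \<comment> \<open>\<open>nu'\<close> decreases, so on each side of \<open>x = 2/5\<close> the
        right side is estimated at the far end and the left side at the near end; on the unbounded
        side \<open>nu' \<ge> 1\<close> serves as the far end.\<close>
      moreover have "(1 - 2 * al) * nu' w \<le> rh * nu' (2 * w)"
      proof (cases "w \<le> - ln (2/5)")
        case True
        have "- ln (21/25) / (4/25) = nu' (- ln (4/25))"
          by (simp add: nu'_minus_ln)
        also have "- ln (4/25) = 2 * - ln (2/5 :: real)"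
        proof -
          have "ln (4/25 :: real) = ln ((2/5)^2)" by (simp add: power2_eq_square)
          also have "\<dots> = 2 * ln (2/5)" by (subst ln_realpow) simp_all
          finally show ?thesis by simp
        qed
        also have "nu' (2 * - ln (2/5)) \<le> nu' (2 * w)"
          using True w(3) by (intro nu'_antimono) auto
        finally have "119125/100000 * (- ln (21/25) / (4/25)) \<le> rh * nu' (2 * w)"
          using rh ln_0_84 by (intro mult_mono) auto
        moreover have "nu' w \<le> nu' (ln 2)" using w ln2 by (intro nu'_antimono) auto
        moreover have "nu' (ln 2) = 2 * ln 2" by (simp add: nu'_def exp_minus ln_div)
        ultimately have "(1 - 2 * al) * nu' w \<le> (1 - 2 * (3556/100000)) * (2 * ln 2)"
          using al by (intro mult_mono) (use w(3) in \<open>auto intro: nu'_nonneg\<close>)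
        then show ?thesis
          using \<open>119125/100000 * (- ln (21/25) / (4/25)) \<le> rh * nu' (2 * w)\<close> ln_0_84 ln_2_bounds by simp
      next
        case False
        have "nu' w \<le> nu' (- ln (2/5))"
          using False ln_0_4 by (intro nu'_antimono) auto
        also have "\<dots> = - ln (3/5) / (2/5)" by (simp add: nu'_minus_ln)
        finally have "(1 - 2 * al) * nu' w \<le> (1 - 2 * (3556/100000)) * (- ln (3/5) / (2/5))"
          using al w(3) by (intro mult_mono) (auto intro: nu'_nonneg)
        moreover have "1 \<le> nu' (2 * w)"
        proof -
          have "ln (1 - exp (- (2 * w))) \<le> - exp (- (2 * w))"
            using ln_le_minus_one [of "1 - exp (- (2 * w))"] w(3) by simp
          then have "exp (2 * w) * ln (1 - exp (- (2 * w))) \<le> exp (2 * w) * - exp (- (2 * w))"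
            by (intro mult_left_mono) auto
          then show ?thesis by (simp add: nu'_def exp_minus)
        qed
        then have "119125/100000 * 1 \<le> rh * nu' (2 * w)" using rh by (intro mult_mono) auto
        ultimately show ?thesis using ln_0_6 by simp
      qed
      ultimately show "\<exists>y. (?f has_real_derivative y) (at w) \<and> 0 \<le> y"
        by (auto simp: algebra_simps)
    qed
    then show ?thesis using gam [OF assms] gam2 nu2 by (simp add: phi_def tee_def algebra_simps)
  qed
  finally show ?thesis .
qed

lemma gam_minus_ln_high:
  assumes "3/4 < x" shows "gam (- ln x) = (ln 2 + ent (2 * x - 1)) / 2 / x"
  using assms by (simp add: gam_minus_ln pay_def)

lemma gam'_minus_ln_high:
  assumes "3/4 < x" "x < 1"
  shows "gam' (- ln x) = (ln 2 + ent (2 * x - 1)) / 2 / x + (ln (2 * x - 1) - ln (2 - 2 * x))"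
proof -
  have e: "exp (- (- ln x)) = x" "exp (- ln x) = 1 / x"
    using assms by (simp_all add: exp_minus inverse_eq_divide)
  have "\<not> x \<le> 1/2" "\<not> x \<le> 3/4" using assms by auto
  then have "gam' (- ln x) = (ln 2 + ent (2 * x - 1)) / 2 * (1 / x) + ln ((2 * x - 1) / (2 - 2 * x))"
    unfolding gam'_def Let_def e by (simp only: if_False)
  also have "ln ((2 * x - 1) / (2 - 2 * x)) = ln (2 * x - 1) - ln (2 - 2 * x)"
    using assms by (simp add: ln_div)
  finally show ?thesis by simp
qed

lemma tee_eq: "tee u = al * (2 * gam u - ln 2 / m)"
  by (simp add: tee_def algebra_simps)

lemma ln_2_m: "11222/10000 \<le> ln 2 / m" "ln 2 / m \<le> 11223/10000"
proof -
  have "ln 2 / m \<le> (693147181 / 1000000000) / (61765/100000)" using m ln_2_bounds by (intro frac_le) auto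
  also have "\<dots> \<le> 11223/10000" by simp
  finally show "ln 2 / m \<le> 11223/10000" .
  have "11222/10000 \<le> (693147180 / 1000000000) / (61766/100000 :: real)" by simp
  also have "\<dots> \<le> ln 2 / m" using m ln_2_bounds by (intro frac_le) auto
  finally show "11222/10000 \<le> ln 2 / m" .
qed

section \<open>Values at the threshold \<open>47/50\<close> and the diagonal above it\<close>

lemma ln_mult_94_92: "- ln (1081/1250) = - ln (47/50) - ln (23/25 :: real)"
proof -
  have "ln (1081/1250) = ln (47/50 * (23/25 :: real))" by simp
  also have "\<dots> = ln (47/50) + ln (23/25)" by (subst ln_mult) auto
  finally show ?thesis by simp
qed

lemma nu_94: "2414/10000 \<le> nu (- ln (47/50))" "nu (- ln (47/50)) \<le> 24146/100000"
  using ln_0_94 ln_0_06 by (simp_all add: nu_minus_ln')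

lemma nu_8836: "40707/100000 \<le> nu (2 * - ln (47/50))"
proof -
  have "ln (2209/2500 :: real) = ln ((47/50)^2)" by (simp add: power2_eq_square)
  also have "\<dots> = 2 * ln (47/50)" by (subst ln_realpow) simp_all
  finally have e: "2 * - ln (47/50 :: real) = - ln (2209/2500)" by simp
  have "nu (2 * - ln (47/50)) = 2 * - ln (47/50) - (1 / (2209/2500) - 1) * ln (1 - 2209/2500)"
    unfolding e by (subst nu_minus_ln') auto
  then show ?thesis using ln_0_94 ln_0_1164 by simp
qed

lemma tee_94: "0 \<le> tee (- ln (47/50))"
proof -
  have "gam (- ln (47/50)) = (ln 2 + ent (22/25)) / 2 / (47/50)"
    by (subst gam_minus_ln_high) auto
  moreover have "ent (22/25) = - (22/25) * ln (22/25) - (3/25) * ln (3/25)" by (simp add: ent_def)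
  moreover define k where "k = ln 2 / m"
  moreover have "k \<le> 11223/10000" using ln_2_m by (simp add: k_def)
  ultimately have "0 \<le> 2 * gam (- ln (47/50)) - k"
    using ln_2_bounds ln_0_88 ln_0_12 by simp
  then have "0 \<le> 2 * gam (- ln (47/50)) - ln 2 / m" by (simp only: k_def)
  then show ?thesis using al unfolding tee_eq by (intro mult_nonneg_nonneg) auto
qed

text \<open>At the threshold the diagonal inequality holds without \<open>tee\<close>, and
  \<open>tee\<close> is nonnegative there. So this point can end the range with \<open>tee\<close>
  as well as the range without it.\<close>

lemma diag_94: "0 \<le> rh * nu (2 * - ln (47/50)) - 2 * nu (- ln (47/50))"
proof -
  have "119125/100000 * (40707/100000) \<le> rh * nu (2 * - ln (47/50))"
    using rh nu_8836 by (intro mult_mono) auto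
  then show ?thesis using nu_94 by simp
qed

text \<open>Here the difference is concave, so the two ends of the interval suffice:
  \<open>diag_94\<close> with \<open>tee_94\<close> at one, \<open>diag_mid\<close> at the
  other.\<close>

lemma diag_high:
  assumes "- ln (47/50) \<le> u" "u \<le> ln (4/3)"
  shows "0 \<le> rh * nu (2 * u) - 2 * phi u"
proof -
  let ?a = "- ln (47/50 :: real)" and ?b = "ln (4/3 :: real)"
  let ?f = "\<lambda>u. rh * nu (2 * u) - 2 * phi u"
  let ?f' = "\<lambda>u. 2 * rh * nu' (2 * u) - 2 * nu' u + 4 * al * gam_high' u"
  have a: "0 < ?a" using ln_0_94 by simp
  have d2: "((\<lambda>w. nu (2 * w)) has_real_derivative nu' (2 * w) * 2) (at w)"
    "((\<lambda>w. nu' (2 * w)) has_real_derivative - curv (exp (- (2 * w))) * 2) (at w)" if "0 < w" for w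
    by (rule DERIV_chain2 [where g = "\<lambda>w. 2 * w", OF DERIV_nu]
          DERIV_chain2 [where g = "\<lambda>w. 2 * w", OF DERIV_nu'];
        use that in \<open>auto intro!: derivative_eq_intros\<close>)+
  have "(?b - u) * ?f ?a + (u - ?a) * ?f ?b \<le> (?b - ?a) * ?f u"
  proof (rule chord_le [where S = "{?a..?b}" and f = ?f and f' = ?f'])
    show "(?f has_real_derivative ?f' w) (at w)" if "w \<in> {?a..?b}" for w
    proof -
      from that have "?a \<le> w" and w': "w \<le> ?b" by auto
      then have w: "0 < w" using a by linarith
      have "(?f has_real_derivative 2 * rh * nu' (2 * w) - 2 * (nu' w - 2 * al * gam' w)) (at w)"
        using w by (auto intro!: derivative_eq_intros d2 DERIV_phi simp: phi'_def)
      then show ?thesis using w w' by (simp add: gam'_high algebra_simps)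
    qed
    show "?f' w \<le> ?f' v" if "v \<in> {?a..?b}" "w \<in> {?a..?b}" "v \<le> w" for v w
    proof (rule antimono_of_deriv_nonpos [where S = "{?a..?b}" and f = ?f'])
      fix z :: real assume "z \<in> {?a..?b}"
      then have z': "z \<le> ?b" "?a \<le> z" by auto
      then have "0 < z" using a by linarith
      note z = this z'
      let ?x = "exp (- z)"
      let ?g = "gam_high' z - ?x / ((2 * ?x - 1) * (1 - ?x))"
      show "(?f' has_real_derivative - 4 * rh * curv (exp (- (2 * z))) + 2 * curv ?x + 4 * al * ?g) (at z)"
        using z by (auto intro!: derivative_eq_intros d2 DERIV_nu' DERIV_gam_high')
      have x: "3/4 \<le> ?x" using exp_minus_bounds_high z by simp
      have x': "?x \<le> 47/50" using z' exp_minus_le_iff [of "47/50" z] by simp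
      have x2: "exp (- (2 * z)) = ?x\<^sup>2" by (simp add: exp_double [symmetric])
      have "2 * curv ?x - 4 * rh * curv (?x\<^sup>2) \<le> 69/100"
        using x x' rh by (intro curv_diff_le_mid) auto
      \<comment> \<open>With \<open>al \<ge> 0.03556\<close> this is below \<open>- 0.69\<close>,
        which offsets the \<open>69/100\<close> of \<open>curv_diff_le_mid\<close>.\<close>
      moreover have "4 * al * ?g \<le> 4 * al * (- 49/10)"
        using gam_high'_bounds(2) [of z] z al by (intro mult_left_mono) auto
      ultimately show "- 4 * rh * curv (exp (- (2 * z))) + 2 * curv ?x + 4 * al * ?g \<le> 0"
        unfolding x2 using al by simp
    qed (use that in auto)
  qed (use assms in auto)
  moreover have "0 \<le> ?f ?a" using diag_94 tee_94 by (simp add: phi_def)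
  moreover have "0 \<le> ?f ?b"
  proof -
    have g: "gam ?b = ln 2 * exp ?b" by (simp add: gam_def pay_def exp_minus)
    have "A - 2 * (B - C) = A - 2 * B + 2 * C" for A B C :: real by simp
    then show ?thesis using diag_mid [OF order_refl] unfolding phi_def tee_def g by (simp only:)
  qed
  ultimately have "0 \<le> (?b - ?a) * ?f u"
    using assms by (smt (verit) mult_nonneg_nonneg)
  moreover have "?a < ?b"
  proof -
    have "ln (50/47) < ln (4/3 :: real)" by simp
    then show ?thesis by (simp add: ln_div)
  qed
  ultimately show ?thesis by (simp add: zero_le_mult_iff)
qed

lemma diag_nonneg:
  assumes "- ln (47/50) \<le> u" shows "0 \<le> rh * nu (2 * u) - 2 * phi u"
proof -
  consider "u \<le> ln (4/3)" | "ln (4/3) \<le> u" "u \<le> ln 2" | "ln 2 \<le> u" by linarith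
  then show ?thesis
  proof cases
    case 2
    then have "exp (- ln 2) \<le> exp (- u)" "exp (- u) \<le> exp (- ln (4/3))" by simp_all
    then have x: "1/2 \<le> exp (- u)" "exp (- u) \<le> 3/4" by (simp_all add: exp_minus)
    then have "pay (exp (- u)) = ln 2"
    proof (cases "exp (- u) = 1/2")
      case True
      then show ?thesis unfolding True pay_def using ent_half by simp
    qed (simp add: pay_def)
    then have "gam u = ln 2 * exp u" by (simp add: gam_def)
    then show ?thesis using diag_mid [of u] 2 by (simp add: phi_def tee_def algebra_simps)
  qed (use assms diag_high diag_low in auto)
qed

lemma kernel_low_low:
  assumes "- ln (47/50) \<le> u" "- ln (47/50) \<le> v"
  shows "nu u - tee u + (nu v - tee v) \<le> rh * nu (u + v)"
proof -
  have "0 < u" "0 < v" using assms ln_0_94 by auto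
  then have "phi u + phi v \<le> 2 * phi ((u + v) / 2)" by (rule phi_midpoint)
  moreover have "2 * ((u + v) / 2) = u + v" by simp
  with diag_nonneg [of "(u + v) / 2"] assms have "0 \<le> rh * nu (u + v) - 2 * phi ((u + v) / 2)"
    by (simp only:)
  ultimately show ?thesis by (simp add: phi_def)
qed

text \<open>The cut-off has removed \<open>tee\<close>. Both \<open>nu\<close> and the diagonal
  difference are concave; the latter tends to 0 at 0 and is nonnegative at the threshold.\<close>

lemma kernel_high_high:
  assumes "0 < u" "u \<le> - ln (47/50)" "0 < v" "v \<le> - ln (47/50)"
  shows "nu u + nu v \<le> rh * nu (u + v)"
proof -
  let ?b = "- ln (47/50 :: real)"
  let ?f = "\<lambda>u. rh * nu (2 * u) - 2 * nu u"
  let ?f' = "\<lambda>u. 2 * rh * nu' (2 * u) - 2 * nu' u"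
  have d2: "((\<lambda>w. nu (2 * w)) has_real_derivative nu' (2 * w) * 2) (at w)"
    "((\<lambda>w. nu' (2 * w)) has_real_derivative - curv (exp (- (2 * w))) * 2) (at w)" if "0 < w" for w
    by (rule DERIV_chain2 [where g = "\<lambda>w. 2 * w", OF DERIV_nu]
          DERIV_chain2 [where g = "\<lambda>w. 2 * w", OF DERIV_nu'];
        use that in \<open>auto intro!: derivative_eq_intros\<close>)+
  have D: "(?f has_real_derivative ?f' w) (at w)" if "w \<in> {0<..?b}" for w
    using that by (auto intro!: derivative_eq_intros d2 DERIV_nu)
  have anti: "?f' w \<le> ?f' v" if "v \<in> {0<..?b}" "w \<in> {0<..?b}" "v \<le> w" for v w
  proof (rule antimono_of_deriv_nonpos [where S = "{0<..?b}" and f = ?f'])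
    fix z :: real assume z: "z \<in> {0<..?b}"
    let ?x = "exp (- z)"
    show "(?f' has_real_derivative - 4 * rh * curv (exp (- (2 * z))) + 2 * curv ?x) (at z)"
      using z by (auto intro!: derivative_eq_intros d2 DERIV_nu')
    have x: "47/50 \<le> ?x" "?x < 1" using z le_exp_minus_iff [of "47/50" z] by simp_all
    have x2: "exp (- (2 * z)) = ?x\<^sup>2" by (simp add: exp_double [symmetric])
    show "- 4 * rh * curv (exp (- (2 * z))) + 2 * curv ?x \<le> 0"
      using curv_diff_le_high [OF x, of rh] rh unfolding x2 by simp
  qed (use that in auto)
  \<comment> \<open>Chord from \<open>e\<close> to \<open>?b\<close> with
    \<open>rh * nu (2 * e) \<ge> 0\<close> dropped, then \<open>e\<close> tends to 0.\<close>
  have diag: "0 \<le> ?f w" if w: "0 < w" "w \<le> ?b" for w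
  proof -
    have b: "0 < ?b" using w by linarith
    have "\<forall>\<^sub>F e in at_right 0. (?b - w) * (- 2 * nu e) + (w - e) * ?f ?b \<le> (?b - e) * ?f w"
      using eventually_at_right_less [of 0] eventually_at_right_real [OF w(1)]
    proof eventually_elim
      case (elim e)
      then have e: "0 < e" "e < w" by auto
      have "0 \<le> rh * nu (2 * e)" using e rh nu_nonneg [of "2 * e"] by simp
      then have "(?b - w) * (- 2 * nu e) \<le> (?b - w) * ?f e"
        using w by (intro mult_left_mono) auto
      moreover have "(?b - w) * ?f e + (w - e) * ?f ?b \<le> (?b - e) * ?f w"
        by (rule chord_le [where S = "{0<..?b}" and f = ?f and f' = ?f', OF _ _ _ _ _ D anti])
           (use e w b in auto)
      ultimately show ?case by linarith
    qed
    moreover have "((\<lambda>e. (?b - w) * (- 2 * nu e) + (w - e) * ?f ?b) \<longlongrightarrow>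
        (?b - w) * (- 2 * 0) + (w - 0) * ?f ?b) (at_right 0)"
      by (intro tendsto_intros nu_tendsto_0)
    moreover have "((\<lambda>e. (?b - e) * ?f w) \<longlongrightarrow> (?b - 0) * ?f w) (at_right 0)"
      by (intro tendsto_intros)
    ultimately have "(?b - w) * (- 2 * 0) + (w - 0) * ?f ?b \<le> (?b - 0) * ?f w"
      by (intro tendsto_le [OF trivial_limit_at_right_real])
    moreover have "0 \<le> w * ?f ?b" using w diag_94 by (intro mult_nonneg_nonneg) auto
    ultimately have "0 \<le> ?b * ?f w" by simp
    then show ?thesis using b by (simp only: zero_le_mult_iff) linarith
  qed
  have "nu u + nu v \<le> 2 * nu ((u + v) / 2)"
    by (rule midpoint_ge [where S = "{0<..}"]) (use assms in \<open>auto intro: DERIV_nu nu'_antimono\<close>)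
  moreover have "0 < (u + v) / 2" "(u + v) / 2 \<le> ?b" using assms by auto
  from diag [OF this] have "0 \<le> rh * nu (2 * ((u + v) / 2)) - 2 * nu ((u + v) / 2)" .
  moreover have "2 * ((u + v) / 2) = u + v" by simp
  ultimately show ?thesis by (simp only:)
qed

end

lemma nu_ge_linear:
  assumes "0 < a" "a \<le> s" "s \<le> b" "a < b" "p + q * a \<le> nu a" "p + q * b \<le> nu b"
  shows "p + q * s \<le> nu s"
proof -
  have "(b - s) * (p + q * a) + (s - a) * (p + q * b) \<le> (b - s) * nu a + (s - a) * nu b"
    using assms by (intro add_mono mult_left_mono) auto
  also have "\<dots> \<le> (b - a) * nu s" using assms by (intro nu_chord) auto
  also have "(b - s) * (p + q * a) + (s - a) * (p + q * b) = (b - a) * (p + q * s)"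
    by (simp add: algebra_simps)
  finally show ?thesis using assms by simp
qed

text \<open>A rational slope \<open>Q\<close> replaces the exact slope \<open>B\<close>: an error of
  \<open>10 * e\<close> over a distance of at most \<open>1/10\<close> costs
  \<open>e\<close>.\<close>

lemma tangent_slope_error:
  fixes Q :: real
  assumes "y \<le> A + B * d" "A \<le> A'" "\<bar>B - Q\<bar> \<le> 10 * e" "\<bar>d\<bar> \<le> 1/10"
  shows "y \<le> A' + Q * d + e"
proof -
  have "(B - Q) * d \<le> \<bar>B - Q\<bar> * \<bar>d\<bar>" by (metis abs_ge_self abs_mult)
  also have "\<dots> \<le> 10 * e * (1/10)" using assms by (intro mult_mono) auto
  finally show ?thesis using assms by (simp add: algebra_simps)
qed

lemma nu_minus_ln_tangent:
  assumes "0 < x" "x < 1" "0 < u" "\<bar>u + ln x\<bar> \<le> 1/10"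
    and "- ln x - (1 / x - 1) * ln (1 - x) \<le> A" "\<bar>- ln (1 - x) / x - Q\<bar> \<le> 10 * e"
  shows "nu u \<le> A + Q * (u + ln x) + e"
proof -
  have "nu u \<le> nu (- ln x) + nu' (- ln x) * (u - (- ln x))"
    using assms by (intro nu_tangent) auto
  then show ?thesis
    using assms by (intro tangent_slope_error [of _ "nu (- ln x)" "nu' (- ln x)"])
      (auto simp: nu_minus_ln' nu'_minus_ln)
qed

context kernel_params
begin

text \<open>The next two lemmas give monotonicity in \<open>u\<close> far from the corner \<open>u = v = - ln (47/50)\<close>. Near it the
  slack is only about \<open>1/1000\<close>, and concave functions are compared with chords and tangents.\<close>

lemma slope_94:
  assumes "0 < x" "x \<le> 23/25"
  shows "47/50 * (- ln (1 - x)) \<le> rh * (- ln (1 - 47/50 * x))"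
proof -
  let ?k = "\<lambda>x. rh * (- ln (1 - 47/50 * x)) + 47/50 * ln (1 - x)"
  let ?k' = "\<lambda>x. 47/50 * (rh / (1 - 47/50 * x) - 1 / (1 - x))"
  have D: "(?k has_real_derivative ?k' y) (at y)" if "y \<le> 23/25" for y
  proof -
    have d1: "((\<lambda>x. ln (1 - 47/50 * x)) has_real_derivative 1 / (1 - 47/50 * y) * (- (47/50))) (at y)"
      by (rule DERIV_chain2 [where f = ln and g = "\<lambda>x. 1 - 47/50 * x", OF DERIV_ln_divide])
         (use that in \<open>auto intro!: derivative_eq_intros\<close>)
    have d2: "((\<lambda>x. ln (1 - x)) has_real_derivative 1 / (1 - y) * (- 1)) (at y)"
      by (rule DERIV_chain2 [where f = ln and g = "\<lambda>x. 1 - x", OF DERIV_ln_divide])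
         (use that in \<open>auto intro!: derivative_eq_intros\<close>)
    show ?thesis
      by (rule DERIV_cong [OF DERIV_add [OF DERIV_cmult [OF DERIV_minus [OF d1], of rh] DERIV_cmult [OF d2, of "47/50"]]])
         (simp add: right_diff_distrib)
  qed
  have sgn: "rh / (1 - 47/50 * y) - 1 / (1 - y) = (rh - 1 - (rh - 47/50) * y) / ((1 - 47/50 * y) * (1 - y))"
    if "y \<le> 23/25" for y
    using that by (simp add: divide_simps) (simp add: algebra_simps)
  have den: "0 < (1 - 47/50 * y) * (1 - y)" if "y \<le> 23/25" for y :: real
    using that by (intro mult_pos_pos) auto
  have "0 \<le> ?k x"
  \<comment> \<open>\<open>?k'\<close> has the sign of a decreasing linear function, so
    \<open>?k\<close> rises and then falls, and its values at 0 and \<open>23/25\<close>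
    decide.\<close>
  proof (cases "(rh - 47/50) * x \<le> rh - 1")
    case True
    have "?k 0 \<le> ?k x"
    proof (rule DERIV_nonneg_imp_nondecreasing [where f = ?k])
      fix y assume y: "0 \<le> y" "y \<le> x"
      have "(rh - 47/50) * y \<le> (rh - 47/50) * x" using y rh by (intro mult_left_mono) auto
      then have "0 \<le> ?k' y" using True y assms den [of y]
        by (subst sgn) (auto intro!: mult_nonneg_nonneg divide_nonneg_pos simp del: mult_pos_pos)
      then show "\<exists>z. (?k has_real_derivative z) (at y) \<and> 0 \<le> z"
        using D [of y] y assms by auto
    qed (use assms in auto)
    then show ?thesis by simp
  next
    case False
    have "?k (23/25) \<le> ?k x"
    proof (rule DERIV_nonpos_imp_nonincreasing [where f = ?k])
      fix y assume y: "x \<le> y" "y \<le> 23/25"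
      have "(rh - 47/50) * x \<le> (rh - 47/50) * y" using y rh by (intro mult_left_mono) auto
      then have "?k' y \<le> 0" using False y assms den [of y]
        by (subst sgn) (auto intro!: mult_nonneg_nonpos divide_nonpos_pos)
      then show "\<exists>z. (?k has_real_derivative z) (at y) \<and> z \<le> 0"
        using D [of y] y assms by auto
    qed (use assms in auto)
    moreover have "119125/100000 * (- ln (169/1250)) \<le> rh * (- ln (169/1250))"
      using rh ln_0_1352 by (intro mult_right_mono) auto
    moreover have "?k (23/25) = rh * (- ln (169/1250)) + 47/50 * ln (2/25)" by simp
    ultimately show ?thesis using ln_0_1352 ln_0_08 by linarith
  qed
  then show ?thesis by simp
qed

lemma slope_far:
  assumes "- ln (23/25) \<le> u" "0 < v" "v \<le> - ln (47/50)"
  shows "nu' u \<le> rh * nu' (u + v)"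
proof -
  define x where "x = exp (- u)"
  have u: "0 < u" using assms ln_0_92 by simp
  have x: "0 < x" "x \<le> 23/25" using assms exp_minus_le_iff [of "23/25" u] by (simp_all add: x_def)
  have ux: "u = - ln x" by (simp add: x_def)
  \<comment> \<open>As \<open>nu'\<close> decreases, the largest \<open>v\<close>, that is
    \<open>y = 47/50\<close>, is the worst.\<close>
  have "u - ln (47/50) = - ln (47/50 * x)"
    using x by (subst ln_mult) (simp_all add: ux)
  then have "nu' (u - ln (47/50)) = - ln (1 - 47/50 * x) / (47/50 * x)"
    using x by (simp only:) (subst nu'_minus_ln, simp_all)
  moreover have "47/50 * (- ln (1 - x)) / (47/50 * x) \<le> rh * (- ln (1 - 47/50 * x)) / (47/50 * x)"
    using slope_94 [OF x] x by (intro divide_right_mono) auto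
  moreover have "nu' u = 47/50 * (- ln (1 - x)) / (47/50 * x)"
    using x unfolding ux by (subst nu'_minus_ln) simp_all
  ultimately have "nu' u \<le> rh * nu' (u - ln (47/50))" by simp
  also have "\<dots> \<le> rh * nu' (u + v)"
    using assms u rh by (intro mult_left_mono nu'_antimono) auto
  finally show ?thesis .
qed

text \<open>Interval arithmetic for the tangent: \<open>elo\<close>, \<open>ehi\<close> enclose the
  entropy, \<open>llo\<close>, \<open>lhi\<close> the log-odds and \<open>glo\<close>,
  \<open>ghi\<close> the value of \<open>gam\<close>. The signs of
  \<open>11222/10000 - 2 * glo\<close> and \<open>glo + llo\<close> decide which bound for
  \<open>al\<close> is the worst one.\<close>

lemma phi_minus_ln_tangent:
  assumes x: "3/4 < x" "x < 1" and u: "0 < u" "\<bar>u + ln x\<bar> \<le> 1/10"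
    and E: "elo \<le> ent (2 * x - 1)" "ent (2 * x - 1) \<le> ehi"
    and l: "llo \<le> ln (2 * x - 1) - ln (2 - 2 * x)" "ln (2 * x - 1) - ln (2 - 2 * x) \<le> lhi"
    and g: "glo \<le> (693147180/1000000000 + elo) / 2 / x" "(693147181/1000000000 + ehi) / 2 / x \<le> ghi"
      "2 * glo \<le> 11222/10000" "0 \<le> glo + llo"
    and A: "- ln x - (1 / x - 1) * ln (1 - x) + 3565/100000 * (11223/10000 - 2 * glo) \<le> A"
    and Q: "- ln (1 - x) / x - 2 * (3556/100000) * (glo + llo) \<le> Q + 10 * e"
      "Q - 10 * e \<le> - ln (1 - x) / x - 2 * (3565/100000) * (ghi + lhi)"
  shows "phi u \<le> A + Q * (u + ln x) + e"
proof -
  define G where "G = gam (- ln x)"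
  define d where "d = gam' (- ln x)"
  have "(693147180/1000000000 + elo) / 2 / x \<le> (ln 2 + ent (2 * x - 1)) / 2 / x"
    "(ln 2 + ent (2 * x - 1)) / 2 / x \<le> (693147181/1000000000 + ehi) / 2 / x"
    using E ln_2_bounds x by (intro divide_right_mono add_mono; simp)+
  then have G: "glo \<le> G" "G \<le> ghi" using g x unfolding G_def by (simp_all only: gam_minus_ln_high)
  have d: "glo + llo \<le> d" "d \<le> ghi + lhi"
    using G l x unfolding G_def d_def by (simp_all only: gam_minus_ln_high gam'_minus_ln_high)
  have "phi u \<le> phi (- ln x) + phi' (- ln x) * (u - (- ln x))"
    using x u by (intro phi_tangent) auto
  moreover have "phi (- ln x) \<le> A"
  proof -
    have "2 * glo \<le> 2 * G" using G(1) by (rule mult_left_mono) simp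
    then have "2 * glo - 11223/10000 \<le> 2 * G - ln 2 / m" using ln_2_m(2) by (rule diff_mono)
    then have "al * (2 * glo - 11223/10000) \<le> tee (- ln x)"
      unfolding tee_eq G_def using al by (intro mult_left_mono) auto
    moreover have "al * (11223/10000 - 2 * glo) \<le> 3565/100000 * (11223/10000 - 2 * glo)"
      using al g by (intro mult_right_mono) auto
    ultimately show ?thesis using A x by (simp add: phi_def nu_minus_ln' algebra_simps)
  qed
  moreover have "\<bar>phi' (- ln x) - Q\<bar> \<le> 10 * e"
  proof -
    have p: "phi' (- ln x) = - ln (1 - x) / x - 2 * al * d" using x by (simp add: phi'_def nu'_minus_ln d_def)
    have "2 * (3556/100000) * (glo + llo) \<le> 2 * al * d" "2 * al * d \<le> 2 * (3565/100000) * (ghi + lhi)"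
      using al d g(4) by (intro mult_mono; simp)+
    then show ?thesis using Q unfolding p by linarith
  qed
  ultimately show ?thesis
    using u by (intro tangent_slope_error [of _ "phi (- ln x)" "phi' (- ln x)"]) auto
qed

text \<open>Concave functions stand on both sides. On each of three ranges of \<open>u + v\<close> a
  chord bounds \<open>nu (u + v)\<close> from below and tangents bound \<open>nu u\<close> and
  \<open>phi v\<close> from above, which leaves an inequality linear in \<open>u\<close> and
  \<open>v\<close>.\<close>

lemma kernel_near:
  assumes u: "- ln (47/50) \<le> u" "u \<le> - ln (23/25)" and v: "0 < v" "v \<le> - ln (47/50)"
  shows "nu u + phi v \<le> rh * nu (u + v)"
proof -
  have u0: "0 < u" using u ln_0_94 by simp
  have lb: "119125/100000 * (p + q * (u + v)) \<le> rh * nu (u + v)"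
    if "p + q * (u + v) \<le> nu (u + v)" for p q
  proof -
    have "119125/100000 * (p + q * (u + v)) \<le> 119125/100000 * nu (u + v)" using that by simp
    also have "\<dots> \<le> rh * nu (u + v)" using rh u0 v by (intro mult_right_mono nu_nonneg) auto
    finally show ?thesis .
  qed
  consider "u + v \<le> - ln (23/25)" | "- ln (23/25) \<le> u + v" "u + v \<le> - ln (179/200)" | "- ln (179/200) \<le> u + v"
    by linarith
  then show ?thesis
  proof cases
    case 1
    have "6435/100000 + 28622/10000 * (u + v) \<le> nu (u + v)"
      by (rule nu_ge_linear [where a = "- ln (47/50)" and b = "- ln (23/25)"])
         (use u v 1 ln_0_94 ln_0_06 ln_0_92 ln_0_08 in \<open>auto simp: nu_minus_ln'\<close>)
    from lb [OF this] have f1: "119125/100000 * (6435/100000 + 28622/10000 * (u + v)) \<le> rh * nu (u + v)" .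
    have f2: "nu u \<le> 24146/100000 + 2993/1000 * (u + ln (47/50)) + 2/1000000"
      by (rule nu_minus_ln_tangent) (use u u0 ln_0_94 ln_0_06 ln_0_92 in \<open>auto simp: abs_le_iff\<close>)
    have ab: "\<bar>v + ln (49/50)\<bar> \<le> 1/10"
      unfolding abs_le_iff using v ln_0_98 ln_0_94 by simp
    have f3: "phi v \<le> 10874/100000 + 37343/10000 * (v + ln (49/50)) + 5/100000"
      by (rule phi_minus_ln_tangent [where elo = "16794/100000" and ehi = "16795/100000" and llo = "317805/100000" and lhi = "317806/100000" and glo = "43933/100000" and ghi = "43936/100000"])
         (use ab v ln_0_98 ln_0_02 ln_0_96 ln_0_04 ln_0_94 ln_2_bounds in \<open>auto simp: abs_le_iff ent_def\<close>)
    show ?thesis using f1 f2 f3 u v 1 ln_0_94 ln_0_92 ln_0_98 by (simp add: field_simps)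
  next
    case 2
    have "8408/100000 + 26255/10000 * (u + v) \<le> nu (u + v)"
      by (rule nu_ge_linear [where a = "- ln (23/25)" and b = "- ln (179/200)"])
         (use 2 ln_0_92 ln_0_08 ln_0_895 ln_0_105 in \<open>auto simp: nu_minus_ln'\<close>)
    from lb [OF this] have f1: "119125/100000 * (8408/100000 + 26255/10000 * (u + v)) \<le> rh * nu (u + v)" .
    have f2: "nu u \<le> 24146/100000 + 2993/1000 * (u + ln (47/50)) + 2/1000000"
      by (rule nu_minus_ln_tangent) (use u u0 ln_0_94 ln_0_06 ln_0_92 in \<open>auto simp: abs_le_iff\<close>)
    have ab: "\<bar>v + ln (24/25)\<bar> \<le> 1/10"
      unfolding abs_le_iff using v ln_0_96 ln_0_94 by simp
    have f3: "phi v \<le> 17887/100000 + 3143/1000 * (v + ln (24/25)) + 5/100000"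
      by (rule phi_minus_ln_tangent [where elo = "27876/100000" and ehi = "27877/100000" and llo = "244234/100000" and lhi = "244235/100000" and glo = "50620/100000" and ghi = "50623/100000"])
         (use ab v ln_0_96 ln_0_04 ln_0_92 ln_0_08 ln_0_94 ln_2_bounds in \<open>auto simp: abs_le_iff ent_def\<close>)
    show ?thesis using f1 f2 f3 u v 2 ln_0_94 ln_0_92 ln_0_895 ln_0_96 by (simp add: field_simps)
  next
    case 3
    \<comment> \<open>\<open>1081/1250 = 47/50 * 23/25\<close> belongs to the corner with the
      largest \<open>u + v\<close>.\<close>
    have s: "u + v \<le> - ln (1081/1250)" using u v ln_mult_94_92 by linarith
    have "10793/100000 + 241055/100000 * (u + v) \<le> nu (u + v)"
      by (rule nu_ge_linear [where a = "- ln (179/200)" and b = "- ln (1081/1250)"])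
         (use s 3 ln_0_895 ln_0_105 ln_0_8648 ln_0_1352 in \<open>auto simp: nu_minus_ln'\<close>)
    from lb [OF this] have f1: "119125/100000 * (10793/100000 + 241055/100000 * (u + v)) \<le> rh * nu (u + v)" .
    have au: "\<bar>u + ln (93/100)\<bar> \<le> 1/10"
      unfolding abs_le_iff using u ln_0_93 ln_0_92 ln_0_94 by simp
    have f2: "nu u \<le> 27274/100000 + 28594/10000 * (u + ln (93/100)) + 3/1000000"
      by (rule nu_minus_ln_tangent) (use au u0 ln_0_93 ln_0_07 ln_0_94 ln_0_92 in \<open>auto simp: abs_le_iff\<close>)
    have ab: "\<bar>v + ln (189/200)\<bar> \<le> 1/10"
      unfolding abs_le_iff using v ln_0_945 ln_0_94 by simp
    have f3: "phi v \<le> 22618/100000 + 28812/10000 * (v + ln (189/200)) + 5/100000"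
      by (rule phi_minus_ln_tangent [where elo = "34651/100000" and ehi = "34652/100000" and llo = "209074/100000" and lhi = "209075/100000" and glo = "55008/100000" and ghi = "55011/100000"])
         (use ab v ln_0_945 ln_0_055 ln_0_89 ln_0_11 ln_0_94 ln_2_bounds in \<open>auto simp: abs_le_iff ent_def\<close>)
    show ?thesis using f1 f2 f3 u v 3 ln_0_94 ln_0_92 ln_0_895 ln_0_93 ln_0_945 by (simp add: field_simps)
  qed
qed

text \<open>The mixed case of \<open>kernel_u\<close>: \<open>y\<close> is above the threshold, so
  \<open>cut y = 0\<close> removes \<open>tee u\<close>, while \<open>tee v\<close> stays.\<close>

lemma kernel_low_high:
  assumes u: "- ln (47/50) \<le> u" and v: "0 < v" "v \<le> - ln (47/50)"
  shows "nu u + nu v - tee v \<le> rh * nu (u + v)"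
proof (cases "u \<le> - ln (23/25)")
  case True
  then show ?thesis using kernel_near [OF u _ v] by (simp add: phi_def)
next
  case False
  let ?a = "- ln (23/25 :: real)"
  have a: "0 < ?a" using ln_0_92 by simp
  have "rh * nu (?a + v) - nu ?a \<le> rh * nu (u + v) - nu u"
  proof (rule DERIV_nonneg_imp_nondecreasing [where f = "\<lambda>w. rh * nu (w + v) - nu w"])
    fix w assume w: "?a \<le> w" "w \<le> u"
    have "0 < w" using w a by linarith
    then have "((\<lambda>w. nu (w + v)) has_real_derivative nu' (w + v) * 1) (at w)"
      using v by (intro DERIV_chain2 [where g = "\<lambda>w. w + v", OF DERIV_nu]) (auto intro!: derivative_eq_intros)
    then have "((\<lambda>w. rh * nu (w + v) - nu w) has_real_derivative rh * nu' (w + v) - nu' w) (at w)"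
      using \<open>0 < w\<close> by (auto intro!: derivative_eq_intros DERIV_nu)
    then show "\<exists>y. ((\<lambda>w. rh * nu (w + v) - nu w) has_real_derivative y) (at w) \<and> 0 \<le> y"
      using slope_far [OF w(1) v] by auto
  qed (use False in auto)
  moreover have "nu ?a + phi v \<le> rh * nu (?a + v)"
    using ln_0_92 ln_0_94 v by (intro kernel_near) auto
  ultimately show ?thesis by (simp add: phi_def)
qed

text \<open>Without a cut-off the kernel inequality would fail at \<open>x = y = 1\<close>, where all entropies vanish and
  \<open>excess\<close> is negative. The threshold lies close to the zero of \<open>excess\<close>.\<close>

definition cut :: "real \<Rightarrow> real" where
  "cut x = (if x \<le> 47/50 then x else 0)"

text \<open>\<open>2 * al * (pay x - ln 2 / 2)\<close> with \<open>ln 2\<close> replaced by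
  \<open>ln 2 * x / m\<close>, which fits the division by \<open>x\<close> in the kernel inequality.
  \<open>entropy_gain\<close> accounts for the difference.\<close>

definition excess :: "real \<Rightarrow> real" where
  "excess x = 2 * al * pay x - al * ln 2 * x / m"

lemma kernel_u:
  assumes "0 \<le> u" "0 \<le> v"
  shows "nu u + nu v - of_bool (- ln (47/50) \<le> v) * tee u - of_bool (- ln (47/50) \<le> u) * tee v
    \<le> rh * nu (u + v)"
proof -
  have b: "0 < - ln (47/50 :: real)" using ln_0_94 by simp
  have main: "nu u + nu v - of_bool (- ln (47/50) \<le> v) * tee u - of_bool (- ln (47/50) \<le> u) * tee v
    \<le> rh * nu (u + v)" if "0 \<le> v" "v \<le> u" for u v
  proof (cases "v = 0")
    case True
    show ?thesis
    proof (cases "- ln (47/50) \<le> u")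
      case u: True
      have "nu (- ln (47/50)) \<le> nu u" using u b by (intro nu_mono) auto
      then have "24/100 \<le> nu u" using nu_94 by simp
      \<comment> \<open>At \<open>y = 1\<close> the surplus \<open>(rh - 1) * nu u\<close> outweighs
        the negative value of \<open>tee 0\<close>.\<close>
      then have "19125/100000 * (24/100) \<le> (rh - 1) * nu u" using rh by (intro mult_mono) auto
      moreover have "- (3565/100000 * (11223/10000)) \<le> tee 0"
      proof -
        have "0 \<le> 2 * gam 0" by (simp add: gam_def pay_def)
        then have "0 - 11223/10000 \<le> 2 * gam 0 - ln 2 / m" using ln_2_m(2) by (rule diff_mono)
        then have "- (11223/10000) \<le> 2 * gam 0 - ln 2 / m" by (simp only: diff_0)
        then have "al * - (11223/10000) \<le> tee 0" unfolding tee_eq using al by (intro mult_left_mono) auto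
        then show ?thesis using al by simp
      qed
      ultimately show ?thesis using True u b by (simp add: algebra_simps)
    next
      case False
      have "0 \<le> u" using that by simp
      then have "1 * nu u \<le> rh * nu u" using rh nu_nonneg by (intro mult_right_mono) auto
      then show ?thesis using True False b by simp
    qed
  next
    case False
    then have v: "0 < v" using that by simp
    consider "- ln (47/50) \<le> v" | "v < - ln (47/50)" "- ln (47/50) \<le> u" | "u < - ln (47/50)"
      by linarith
    then show ?thesis
    proof cases
      case 1
      then show ?thesis using kernel_low_low [of u v] that by simp
    next
      case 2
      then show ?thesis using kernel_low_high [of u v] v by simp
    next
      case 3
      then show ?thesis using kernel_high_high [of u v] v that by simp
    qed
  qed
  show ?thesis using main [of v u] main [of u v] assms by (cases "v \<le> u") (simp_all add: add.commute)
qed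

lemma kernel:
  assumes "0 \<le> x" "x \<le> 1" "0 \<le> y" "y \<le> 1"
  shows "x * ent y + y * ent x - cut y * excess x - cut x * excess y \<le> rh * ent (x * y)"
proof (cases "x = 0 \<or> y = 0")
  case True
  then show ?thesis by (auto simp: cut_def excess_def pay_def)
next
  case False
  define u v where "u = - ln x" and "v = - ln y"
  have xy: "0 < x" "0 < y" using False assms by auto
  have uv: "0 \<le> u" "0 \<le> v" using assms xy by (auto simp: u_def v_def)
  have e: "exp (- u) = x" "exp (- v) = y" "exp (- (u + v)) = x * y"
    using xy by (simp_all add: u_def v_def exp_add exp_minus exp_diff)
  have en: "ent x = x * nu u" "ent y = y * nu v" "ent (x * y) = x * y * nu (u + v)"
    using ent_eq_nu [of u] ent_eq_nu [of v] ent_eq_nu [of "u + v"] e by simp_all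
  have ex: "excess x = x * tee u" "excess y = y * tee v"
    using xy by (simp_all add: excess_def tee_def gam_minus_ln u_def v_def field_simps)
  have cu: "cut x = x * of_bool (- ln (47/50) \<le> u)" "cut y = y * of_bool (- ln (47/50) \<le> v)"
    using exp_minus_le_iff [of "47/50" u] exp_minus_le_iff [of "47/50" v] by (simp_all add: cut_def e)
  have "x * y * (nu u + nu v - of_bool (- ln (47/50) \<le> v) * tee u - of_bool (- ln (47/50) \<le> u) * tee v)
    \<le> x * y * (rh * nu (u + v))"
    using xy kernel_u [OF uv] by (intro mult_left_mono) auto
  then show ?thesis unfolding en ex cu by (simp add: algebra_simps)
qed

end

section \<open>Combining the two couplings\<close>

lemma ent_gibbs:
  assumes "0 \<le> a" "a \<le> 1" "0 \<le> x" "x \<le> 1" "0 < a \<Longrightarrow> 0 < x" "a < 1 \<Longrightarrow> x < 1"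
  shows "ent a \<le> - a * ln x - (1 - a) * ln (1 - x)"
  using mult_ln_le [of a x 1] mult_ln_le [of "1 - a" "1 - x" 1] assms by (simp add: ent_def)

lemma ent_midpoint:
  assumes "0 \<le> a" "a \<le> 1" "0 \<le> b" "b \<le> 1"
  shows "(ent a + ent b) / 2 \<le> ent ((a + b) / 2)"
proof -
  let ?x = "(a + b) / 2"
  have "ent a \<le> - a * ln ?x - (1 - a) * ln (1 - ?x)" "ent b \<le> - b * ln ?x - (1 - b) * ln (1 - ?x)"
    using assms by (intro ent_gibbs; simp)+
  then have "ent a + ent b \<le> 2 * (- ?x * ln ?x - (1 - ?x) * ln (1 - ?x))"
    by (simp add: field_simps)
  then show ?thesis unfolding ent_def [of ?x] by simp
qed

lemma ent_antimono:
  assumes "1/2 \<le> x" "x \<le> y" "y \<le> 1" shows "ent y \<le> ent x"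
proof (cases "x = 1")
  case False
  have "ent y \<le> - y * ln x - (1 - y) * ln (1 - x)"
    using assms False by (intro ent_gibbs) auto
  also have "\<dots> = ent x - (y - x) * (ln x - ln (1 - x))" by (simp add: ent_def algebra_simps)
  also have "\<dots> \<le> ent x" using assms False by (simp add: mult_nonneg_nonneg)
  finally show ?thesis .
qed (use assms in auto)

lemma pay_le_ln_2: "0 \<le> x \<Longrightarrow> x \<le> 1 \<Longrightarrow> pay x \<le> ln 2"
  using ent_le_ln_2 [of x] ent_le_ln_2 [of "2 * x - 1"] by (auto simp: pay_def)

text \<open>Given the past, \<open>p\<close> and \<open>q\<close> are the conditional probabilities of \<open>k \<notin> A\<close> and \<open>k \<notin> B\<close>, and
  the second coupling makes the probability \<open>z\<close> of \<open>k \<notin> A \<union> B\<close> as close to \<open>1/2\<close> as possible.\<close>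

lemma pay_coupling:
  assumes "0 \<le> p" "p \<le> 1" "0 \<le> q" "q \<le> 1"
  shows "\<exists>z. 0 \<le> z \<and> p + q - 1 \<le> z \<and> z \<le> p \<and> z \<le> q \<and> (pay p - ln 2 / 2) + (pay q - ln 2 / 2) \<le> ent z"
proof -
  have main: "\<exists>z. 0 \<le> z \<and> p + q - 1 \<le> z \<and> z \<le> p \<and> z \<le> q \<and> pay p + pay q - ln 2 \<le> ent z"
    if pq: "0 \<le> p" "p \<le> q" "q \<le> 1" for p q
  proof -
    have le: "pay p \<le> ln 2" "pay q \<le> ln 2" using pq by (auto intro: pay_le_ln_2)
    \<comment> \<open>The admissible \<open>z\<close> run from \<open>max 0 (p + q - 1)\<close> to
      \<open>p\<close>. The point \<open>1/2\<close> is not below \<open>p\<close> in the first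
      case, inside in the second, and below the whole range in the last two.\<close>
    consider "p \<le> 1/2" | "1/2 < p" "p + q \<le> 3/2" | "1/2 < p" "3/2 < p + q" "p \<le> 3/4" | "3/4 < p"
      using pq by linarith
    then show ?thesis
    proof cases
      case 1
      then have "pay p = ent p" by (simp add: pay_def)
      then show ?thesis using pq le by (intro exI [of _ p]) auto
    next
      case 2
      have "pay p + pay q - ln 2 \<le> ent (1/2)" unfolding ent_half using le by simp
      then show ?thesis using pq 2 by (intro exI [of _ "1/2"]) auto
    next
      case 3
      have "pay p = ln 2" "pay q = (ln 2 + ent (2 * q - 1)) / 2"
        using 3 by (auto simp: pay_def)
      then have "pay p + pay q - ln 2 = (ent (1/2) + ent (2 * q - 1)) / 2"
        unfolding ent_half by simp
      also have "\<dots> \<le> ent ((1/2 + (2 * q - 1)) / 2)" using pq 3 by (intro ent_midpoint) auto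
      also have "\<dots> \<le> ent (p + q - 1)" using pq 3 by (intro ent_antimono) auto
      finally show ?thesis using pq 3 by (intro exI [of _ "p + q - 1"]) auto
    next
      case 4
      have "pay p = (ln 2 + ent (2 * p - 1)) / 2" "pay q = (ln 2 + ent (2 * q - 1)) / 2"
        using 4 pq by (auto simp: pay_def)
      then have "pay p + pay q - ln 2 = (ent (2 * p - 1) + ent (2 * q - 1)) / 2" by simp
      also have "\<dots> \<le> ent (((2 * p - 1) + (2 * q - 1)) / 2)" using pq 4 by (intro ent_midpoint) auto
      also have "((2 * p - 1) + (2 * q - 1)) / 2 = p + q - 1" by (simp add: field_simps)
      finally show ?thesis using pq 4 by (intro exI [of _ "p + q - 1"]) auto
    qed
  qed
  show ?thesis
  proof (cases "p \<le> q")
    case True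
    then show ?thesis using main [of p q] assms by (simp add: algebra_simps)
  next
    case False
    then show ?thesis using main [of q p] assms by (auto simp: algebra_simps)
  qed
qed

context kernel_params
begin

lemma cut_bounds: "0 \<le> x \<Longrightarrow> 0 \<le> cut x" "0 \<le> x \<Longrightarrow> cut x \<le> x"
  by (simp_all add: cut_def)

lemma cond_exp_kernel:
  fixes n k :: nat
  assumes F: "finite F"
  defines "E \<equiv> cond_exp n k F"
  shows "2 * E (\<lambda>x. x) * E ent - 2 * E cut * E excess \<le> rh * E (\<lambda>x. E (\<lambda>y. ent (x * y)))"
proof -
  have "E (\<lambda>x. E (\<lambda>y. x * ent y + y * ent x - cut y * excess x - cut x * excess y))
      \<le> E (\<lambda>x. E (\<lambda>y. rh * ent (x * y)))"
    unfolding E_def by (intro cond_exp_mono F kernel)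
  also have "E (\<lambda>x. E (\<lambda>y. x * ent y + y * ent x - cut y * excess x - cut x * excess y))
      = 2 * E (\<lambda>x. x) * E ent - 2 * E cut * E excess"
  proof -
    have r: "E (\<lambda>y. g y * c) = E g * c" for g c
      unfolding E_def using cond_exp_cmult [of n k F c g] by (simp add: mult.commute)
    have l: "E (\<lambda>y. c * g y) = c * E g" for g c
      unfolding E_def by (rule cond_exp_cmult)
    have a: "E (\<lambda>y. g y + h y) = E g + E h" "E (\<lambda>y. g y - h y) = E g - E h" for g h
      unfolding E_def by (rule cond_exp_add cond_exp_diff)+
    show ?thesis by (simp add: a l r)
  qed
  also have "E (\<lambda>x. E (\<lambda>y. rh * ent (x * y))) = rh * E (\<lambda>x. E (\<lambda>y. ent (x * y)))"
    unfolding E_def by (simp add: cond_exp_cmult)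
  finally show ?thesis .
qed

text \<open>If the mean of \<open>excess\<close> is not positive, the second coupling is only credited with the trivial bound
  \<open>0 \<le> ent z\<close>.\<close>

definition bonus :: "nat \<Rightarrow> nat set set \<Rightarrow> nat \<Rightarrow> real \<Rightarrow> real" where
  "bonus n F k x = (if 0 < cond_exp n k F excess then pay x - ln 2 / 2 else 0)"

text \<open>Let \<open>T\<close> be the mean of \<open>excess\<close> and \<open>t\<close> that of
  \<open>X\<close>. If \<open>T > 0\<close>, then \<open>E cut \<le> t\<close> and the integrated
  kernel ask for a contribution \<open>t / m * T\<close> of the second coupling, which supplies
  \<open>T + (t / m - 1) * (al * ln 2)\<close>. That is enough, since
  \<open>T \<le> al * ln 2\<close> and \<open>t \<ge> m\<close>.\<close>

lemma entropy_gain: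
  assumes F: "finite F" "F \<noteq> {}" and k: "k \<in> {1..n}" and t: "m \<le> avoid_frac k F"
  shows "avoid_frac k F / m * cond_exp n k F ent
    \<le> (1 - al) * cond_exp n k F (\<lambda>x. cond_exp n k F (\<lambda>y. ent (x * y)))
      + al * (2 * cond_exp n k F (bonus n F k))"
proof -
  let ?E = "cond_exp n k F"
  define t where "t = avoid_frac k F"
  have m0: "0 < m" using m by simp
  have al0: "0 < al" using al by simp
  have mean: "?E (\<lambda>x. x) = t" unfolding t_def using F k by (rule cond_exp_id)
  have tm: "m \<le> t" "1 \<le> t / m" using t m0 by (simp_all add: t_def)
  define I where "I = ?E (\<lambda>x. ?E (\<lambda>y. ent (x * y)))"
  have "2 * t * ?E ent - 2 * ?E cut * ?E excess \<le> 2 * m * (1 - al) * I"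
    using cond_exp_kernel [OF F(1), of n k] by (simp add: mean I_def rh_eq)
  then have ker: "t * ?E ent - ?E cut * ?E excess \<le> m * ((1 - al) * I)" by simp
  have cut: "0 \<le> ?E cut" "?E cut \<le> t"
  proof -
    have "?E (\<lambda>x. 0) \<le> ?E cut" using F(1) by (intro cond_exp_mono) (auto simp: cut_bounds)
    then show "0 \<le> ?E cut" using cond_exp_const [OF k] by simp
    have "?E cut \<le> ?E (\<lambda>x. x)" using F(1) by (intro cond_exp_mono) (auto simp: cut_bounds)
    then show "?E cut \<le> t" by (simp add: mean)
  qed
  show ?thesis
  proof (cases "0 < ?E excess")
    case False
    then have "bonus n F k = (\<lambda>x. 0)" by (simp add: bonus_def fun_eq_iff)
    then have b: "?E (bonus n F k) = 0" using cond_exp_const [OF k, of F 0] by simp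
    have "?E cut * ?E excess \<le> 0" using cut False by (intro mult_nonneg_nonpos) auto
    then have "t * ?E ent \<le> m * ((1 - al) * I)" using ker by linarith
    then show ?thesis using m0 unfolding b I_def [symmetric] t_def [symmetric]
      by (simp add: field_simps)
  next
    case True
    define T where "T = ?E excess"
    have "bonus n F k = (\<lambda>x. pay x - ln 2 / 2)" using True by (simp add: bonus_def fun_eq_iff)
    then have b: "?E (bonus n F k) = ?E pay - ln 2 / 2"
      using cond_exp_const [OF k] by (simp add: cond_exp_diff)
    have T: "T = 2 * al * ?E pay - al * ln 2 * (t / m)"
    proof -
      have e: "excess = (\<lambda>x. 2 * al * pay x - al * ln 2 / m * x)" by (simp add: excess_def fun_eq_iff)
      show ?thesis unfolding T_def e cond_exp_diff cond_exp_cmult mean by simp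
    qed
    have "?E pay \<le> ?E (\<lambda>x. ln 2)" using F(1) by (intro cond_exp_mono pay_le_ln_2)
    then have "?E pay \<le> ln 2" using cond_exp_const [OF k] by simp
    then have "2 * al * ?E pay \<le> 2 * al * ln 2" using al0 by simp
    moreover have "al * ln 2 * 1 \<le> al * ln 2 * (t / m)" using tm al0 by (intro mult_left_mono) auto
    ultimately have "T \<le> al * ln 2" unfolding T by linarith
    then have "(t / m - 1) * T \<le> (t / m - 1) * (al * ln 2)" using tm by (intro mult_left_mono) auto
    moreover have "?E cut * T \<le> t * T" using cut True by (intro mult_right_mono) (auto simp: T_def)
    then have "t * ?E ent - t * T \<le> m * ((1 - al) * I)" using ker unfolding T_def by linarith
    then have "t / m * ?E ent - t / m * T \<le> (1 - al) * I" using m0 by (simp add: field_simps)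
    moreover have "al * (2 * ?E (bonus n F k)) = T + (t / m - 1) * (al * ln 2)"
      unfolding b T by (simp add: algebra_simps)
    ultimately show ?thesis unfolding I_def [symmetric] t_def [symmetric]
      by (simp add: left_diff_distrib)
  qed
qed

lemma union_closed_avoid_frac:
  fixes n :: nat and F :: "nat set set"
  assumes F: "F \<subseteq> Pow {1..n}" "union_closed F" "2 \<le> card F"
  shows "\<exists>k\<in>{1..n}. avoid_frac k F \<le> m"
proof (rule ccontr)
  assume "\<not> ?thesis"
  then have less: "m < avoid_frac k F" if "k \<in> {1..n}" for k using that by (auto simp: not_le)
  have fin: "finite F" using finite_subset [OF F(1)] by simp
  have ne: "F \<noteq> {}" using F(3) by auto
  have m0: "0 < m" using m by simp
  have "joins F F \<subseteq> F" using F(2) by (auto simp: joins_def union_closed_def)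
  moreover have "joins F F \<noteq> {}" using ne by (auto simp: joins_def)
  ultimately have "card (joins F F) \<le> card F" "0 < card (joins F F)"
    using fin by (auto intro: card_mono simp: card_gt_0_iff finite_subset)
  then have joins: "ln (card (joins F F)) \<le> ln (card F)" by simp
  have "inj_on (\<lambda>A. A \<inter> {1..n}) F" using F(1) by (intro inj_onI) blast
  then have chain: "(\<Sum>k=1..n. cond_exp n k F ent) = ln (card F)"
    using fin ne by (intro sum_cond_exp_ent)
  have pos: "0 < ln (real (card F))" using F(3) by simp
  have ent0: "0 \<le> cond_exp n k F ent" if "k \<in> {1..n}" for k
  proof -
    have "cond_exp n k F (\<lambda>x. 0) \<le> cond_exp n k F ent"
      using fin by (intro cond_exp_mono ent_nonneg)
    then show ?thesis using cond_exp_const [OF that, of F 0] by simp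
  qed
  \<comment> \<open>Strictness in the final chain needs one element of positive entropy, which
    exists because \<open>card F \<ge> 2\<close> makes the total \<open>ln (card F)\<close>
    positive.\<close>
  have "\<exists>k\<in>{1..n}. 0 < cond_exp n k F ent"
  proof (rule ccontr)
    assume "\<not> ?thesis"
    then have "(\<Sum>k=1..n. cond_exp n k F ent) \<le> 0" by (intro sum_nonpos) (auto simp: not_less)
    then show False using chain pos by simp
  qed
  then obtain k0 where k0: "k0 \<in> {1..n}" "0 < cond_exp n k0 F ent" by blast
  have "ln (card F) < (\<Sum>k=1..n. avoid_frac k F / m * cond_exp n k F ent)"
    unfolding chain [symmetric]
  proof (rule sum_strict_mono_ex1)
    show "\<forall>k\<in>{1..n}. cond_exp n k F ent \<le> avoid_frac k F / m * cond_exp n k F ent"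
    proof
      fix k assume k: "k \<in> {1..n}"
      have "1 \<le> avoid_frac k F / m" using less [OF k] m0 by simp
      from mult_right_mono [OF this ent0 [OF k]]
      show "cond_exp n k F ent \<le> avoid_frac k F / m * cond_exp n k F ent" by simp
    qed
    have "1 < avoid_frac k0 F / m" using less [OF k0(1)] m0 by simp
    from mult_strict_right_mono [OF this k0(2)]
    show "\<exists>k\<in>{1..n}. cond_exp n k F ent < avoid_frac k F / m * cond_exp n k F ent"
      using k0(1) by auto
  qed simp
  also have "\<dots> \<le> (\<Sum>k=1..n. (1 - al) * cond_exp n k F (\<lambda>x. cond_exp n k F (\<lambda>y. ent (x * y)))
      + al * (2 * cond_exp n k F (bonus n F k)))"
    using fin ne less by (intro sum_mono entropy_gain) (auto intro: less_imp_le)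
  also have "\<dots> = (1 - al) * (\<Sum>k=1..n. cond_exp n k F (\<lambda>x. cond_exp n k F (\<lambda>y. ent (x * y))))
      + al * (\<Sum>k=1..n. cond_exp n k F (bonus n F k) + cond_exp n k F (bonus n F k))"
    by (simp add: sum.distrib sum_distrib_left)
  also have "\<dots> \<le> (1 - al) * ln (card F) + al * ln (card F)"
  proof (intro add_mono mult_left_mono)
    show "(\<Sum>k=1..n. cond_exp n k F (\<lambda>x. cond_exp n k F (\<lambda>y. ent (x * y)))) \<le> ln (card F)"
      using sum_cond_exp_indep_le [OF fin fin ne ne, of n] joins by linarith
    have cpl: "\<exists>z. 0 \<le> z \<and> p + q - 1 \<le> z \<and> z \<le> p \<and> z \<le> q \<and> bonus n F k p + bonus n F k q \<le> ent z"
      if "0 \<le> p" "p \<le> 1" "0 \<le> q" "q \<le> 1" for k p q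
    proof (cases "0 < cond_exp n k F excess")
      case True
      then show ?thesis using pay_coupling [OF that] by (simp add: bonus_def)
    next
      case False
      \<comment> \<open>With bonus 0 any admissible \<open>z\<close> will do.\<close>
      then show ?thesis using that mult_nonneg_nonneg [of p q]
        by (intro exI [of _ "min p q"]) (auto simp: bonus_def min_def intro: ent_nonneg)
    qed
    have "(\<Sum>k=1..n. cond_exp n k F (bonus n F k) + cond_exp n k F (bonus n F k)) \<le> ln (card (joins F F))"
      by (rule sum_cond_exp_coupled_le [OF fin fin ne ne]) (rule cpl; assumption)
    then show "(\<Sum>k=1..n. cond_exp n k F (bonus n F k) + cond_exp n k F (bonus n F k)) \<le> ln (card F)"
      using joins by linarith
  qed (use al in auto)
  finally show False by (simp add: algebra_simps)
qed

end

section \<open>The constants\<close>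

lemma gap_eq:
  assumes "0 < x" "x < 1"
  shows "gap x = (ent (1 - x) * (2 * ln 2 - ent (1 - x)) - ln 2 * ent ((1 - x)\<^sup>2)) / (ln 2)\<^sup>2"
proof -
  have "2 * x - x\<^sup>2 = 1 - (1 - x)\<^sup>2" by (simp add: power2_eq_square algebra_simps)
  then have "gap x = ent (1 - x) / ln 2 * (2 - ent (1 - x) / ln 2) - ent ((1 - x)\<^sup>2) / ln 2"
    by (simp add: gap_def bin_entropy_eq_ent ent_sym)
  also have "\<dots> = (ent (1 - x) * (2 * ln 2 - ent (1 - x)) - ln 2 * ent ((1 - x)\<^sup>2)) / (ln 2)\<^sup>2"
    by (simp add: divide_simps power2_eq_square)
  finally show ?thesis .
qed

lemma ent_square:
  assumes "0 < y" "y < 1"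
  shows "ent (y\<^sup>2) = - 2 * y\<^sup>2 * ln y - (1 - y\<^sup>2) * (ln (1 - y) + ln (1 + y))"
proof -
  have "1 - y\<^sup>2 = (1 - y) * (1 + y)" by (simp add: power2_eq_square algebra_simps)
  then have "ln (1 - y\<^sup>2) = ln (1 - y) + ln (1 + y)" using assms by (simp add: ln_mult)
  moreover have "ln (y\<^sup>2) = 2 * ln y" using assms by (simp add: ln_realpow)
  ultimately show ?thesis by (simp add: ent_def)
qed

lemma ent_x_hi: "633791280 / 1000000000 \<le> ent (335273/500000)" "ent (335273/500000) \<le> 633791305 / 1000000000"
  using ln_x_hi ln_b_lo by (simp_all add: ent_def)

lemma ent_x_lo: "633791990 / 1000000000 \<le> ent (134109/200000)" "ent (134109/200000) \<le> 633792015 / 1000000000"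
  using ln_x_lo ln_b_hi by (simp_all add: ent_def)

lemma gap_neg: "gap (164727/500000) < 0"
proof -
  let ?y = "335273/500000 :: real"
  have "688064665 / 1000000000 \<le> ent (?y\<^sup>2)"
    using ln_x_hi ln_b_lo ln_1x_hi by (subst ent_square) (simp_all add: power2_eq_square field_simps)
  then have a: "ln 2 * (688064665 / 1000000000) \<le> ln 2 * ent (?y\<^sup>2)" by (intro mult_left_mono) auto
  \<comment> \<open>Monotonicity of \<open>H * (2 * ln 2 - H)\<close> for
    \<open>H \<le> ln 2\<close>, in factored form.\<close>
  have "0 \<le> (633791305 / 1000000000 - ent ?y) * (2 * ln 2 - ent ?y - 633791305 / 1000000000)"
    using ent_x_hi ln_2_bounds by (intro mult_nonneg_nonneg) auto
  then have "ent ?y * (2 * ln 2 - ent ?y) \<le> 633791305 / 1000000000 * (2 * ln 2 - 633791305 / 1000000000)"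
    by (simp add: algebra_simps)
  also have "\<dots> < ln 2 * (688064665 / 1000000000)" using ln_2_bounds by simp
  also note a
  finally have "ent ?y * (2 * ln 2 - ent ?y) - ln 2 * ent (?y\<^sup>2) < 0" by simp
  then show ?thesis by (subst gap_eq) (simp_all add: divide_neg_pos)
qed

lemma gap_num_pos:
  "0 < ent (134109/200000) * (2 * ln 2 - ent (134109/200000)) - ln 2 * ent ((134109/200000)\<^sup>2)"
proof -
  let ?y = "134109/200000 :: real"
  have "ent (?y\<^sup>2) \<le> 688064425 / 1000000000"
    using ln_x_lo ln_b_hi ln_1x_lo by (subst ent_square) (simp_all add: power2_eq_square field_simps)
  then have "ln 2 * ent (?y\<^sup>2) \<le> ln 2 * (688064425 / 1000000000)" by (intro mult_left_mono) auto
  also have "\<dots> < 633791990 / 1000000000 * (2 * ln 2 - 633791990 / 1000000000)" using ln_2_bounds by simp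
  also have "\<dots> \<le> ent ?y * (2 * ln 2 - ent ?y)"
  proof -
    have "0 \<le> (ent ?y - 633791990 / 1000000000) * (2 * ln 2 - ent ?y - 633791990 / 1000000000)"
      using ent_x_lo ln_2_bounds by (intro mult_nonneg_nonneg) auto
    then show ?thesis by (simp add: algebra_simps)
  qed
  finally show ?thesis by simp
qed

lemma ent_strict_mono:
  assumes "0 < x" "x < y" "y \<le> 1/2" shows "ent x < ent y"
proof -
  have D: "(ent has_real_derivative ln ((1 - z) / z)) (at z)" if "x \<le> z" "z \<le> y" for z
    using that assms by (intro DERIV_ent) linarith+
  obtain z where z: "x < z" "z < y" "ent y - ent x = (y - x) * ln ((1 - z) / z)"
    using MVT2 [OF assms(2) D] by blast
  have "1 < (1 - z) / z" using z assms by (simp add: field_simps)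
  then have "0 < (y - x) * ln ((1 - z) / z)" using assms by (intro mult_pos_pos ln_gt_zero) auto
  then show ?thesis using z by linarith
qed

text \<open>In terms of \<open>y = 1 - x\<close>: for \<open>y \<le> 1/2\<close> it is enough that
  \<open>ent (y * y) < ent y \<le> ln 2\<close>. For larger \<open>y\<close> the positive term
  decreases and the negative one grows with \<open>y\<close>, because \<open>y * y\<close> stays
  below \<open>1/2\<close>; so the largest \<open>y\<close> is the worst.\<close>

lemma gap_pos:
  assumes "65891/200000 \<le> x" "x < 1" shows "0 < gap x"
proof -
  define y where "y = 1 - x"
  have y: "0 < y" "y \<le> 134109/200000" using assms by (auto simp: y_def)
  have e: "0 \<le> ent y" "ent y \<le> ln 2" using y by (auto intro!: ent_nonneg ent_le_ln_2)
  have "0 < ent y * (2 * ln 2 - ent y) - ln 2 * ent (y\<^sup>2)"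
  proof (cases "y \<le> 1/2")
    case True
    have "y\<^sup>2 < y" using y by (simp add: power2_eq_square)
    then have "ent (y\<^sup>2) < ent y" using y True by (intro ent_strict_mono) auto
    then have "ln 2 * ent (y\<^sup>2) < ln 2 * ent y" by simp
    also have "ln 2 * ent y = ent y * (2 * ln 2 - ln 2)" by simp
    also have "\<dots> \<le> ent y * (2 * ln 2 - ent y)" using e by (intro mult_left_mono) auto
    finally show ?thesis by simp
  next
    case False
    let ?Y = "134109/200000 :: real"
    have "ent ?Y \<le> ent y" using y False by (intro ent_antimono) auto
    then have "0 \<le> (ent y - ent ?Y) * (2 * ln 2 - ent y - ent ?Y)"
      using e ent_le_ln_2 [of ?Y] by (intro mult_nonneg_nonneg) auto
    then have "ent ?Y * (2 * ln 2 - ent ?Y) \<le> ent y * (2 * ln 2 - ent y)"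
      by (simp add: algebra_simps)
    moreover have "ent (y\<^sup>2) \<le> ent (?Y\<^sup>2)"
    proof -
      have "y\<^sup>2 \<le> ?Y\<^sup>2" using y by (intro power_mono) auto
      moreover have "?Y\<^sup>2 \<le> 1/2" by (simp add: power2_eq_square)
      ultimately show ?thesis using ent_antimono [of "1 - ?Y\<^sup>2" "1 - y\<^sup>2"] by (simp add: ent_sym)
    qed
    then have "ln 2 * ent (y\<^sup>2) \<le> ln 2 * ent (?Y\<^sup>2)" by (intro mult_left_mono) auto
    ultimately show ?thesis using gap_num_pos by linarith
  qed
  then show ?thesis using assms unfolding y_def by (subst gap_eq) auto
qed

lemma isCont_gap:
  assumes "0 < x" "x < 1" shows "isCont gap x"
proof -
  have "2 * x - x\<^sup>2 = x * (2 - x)" "1 - (2 * x - x\<^sup>2) = (1 - x)\<^sup>2" by (simp_all add: power2_eq_square algebra_simps)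
  then have "0 < 2 * x - x\<^sup>2" "0 < 1 - (2 * x - x\<^sup>2)" using assms by simp_all
  then show ?thesis
    unfolding gap_def [abs_def] bin_entropy_eq_ent [abs_def] ent_def using assms
    by (intro continuous_intros) auto
qed

text \<open>\<open>GREATEST\<close> requires an attained maximum. The roots in the enclosing
  interval form a compact set, nonempty by the intermediate value theorem, and
  \<open>gap_pos\<close> excludes roots to its right.\<close>

lemma b_const: "gap b_const = 0" "164727/500000 \<le> b_const" "b_const \<le> 65891/200000"
proof -
  let ?l = "164727/500000 :: real" and ?u = "65891/200000 :: real"
  define R where "R = {x \<in> {?l..?u}. gap x = 0}"
  have cont: "continuous_on {?l..?u} gap"
    by (rule continuous_at_imp_continuous_on, rule ballI, rule isCont_gap) simp_all
  have "closed R"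
    unfolding R_def using continuous_closed_preimage_constant [OF cont, of 0] by simp
  moreover have "R \<subseteq> {?l..?u}" unfolding R_def by blast
  then have "bounded R" by (rule bounded_subset [OF bounded_closed_interval])
  ultimately have compact: "compact R" by (simp only: compact_eq_bounded_closed)
  have ne: "R \<noteq> {}"
  proof -
    have "\<exists>x\<ge>?l. x \<le> ?u \<and> gap x = 0"
    proof (rule IVT' [OF _ _ _ cont])
      show "gap ?l \<le> 0" using gap_neg by simp
      show "0 \<le> gap ?u" using gap_pos [of ?u] by simp
    qed simp
    then show ?thesis unfolding R_def by auto
  qed
  obtain b where b: "b \<in> R" "\<forall>x\<in>R. x \<le> b"
    using compact_attains_sup [OF compact ne] ..
  have "b_const = b"
    unfolding b_const_def
  proof (rule Greatest_equality)
    have "?l \<le> b" "b \<le> ?u" "gap b = 0" using b(1) by (simp_all add: R_def)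
    then show "0 < b \<and> b < 1 \<and> gap b = 0" by linarith
    fix x assume x: "0 < x \<and> x < 1 \<and> gap x = 0"
    then have u: "x < ?u" using gap_pos [of x] by linarith
    show "x \<le> b"
    proof (cases "x < ?l")
      case True
      moreover have "?l \<le> b" using b(1) by (simp add: R_def)
      ultimately show ?thesis by linarith
    next
      case False
      then have "x \<in> R" using x u by (simp add: R_def)
      then show ?thesis using b(2) by simp
    qed
  qed
  then show "gap b_const = 0" "?l \<le> b_const" "b_const \<le> ?u" using b(1) by (simp_all add: R_def)
qed

definition x_const :: real where "x_const = 1 - b_const"

text \<open>The probability of the value \<open>x_const\<close> in the extremal law;
  \<open>m_const\<close> is its mean.\<close>

definition keep_const :: real where "keep_const = 1 - a_const"

definition m_const :: real where "m_const = 1 - c_const"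

text \<open>The solution of the linear equation for \<open>al\<close> that assumption \<open>tangent\<close> of the locale amounts to.\<close>

definition al_const :: real where
  "al_const = (- ln b_const + 2 * keep_const * ln (1 - x_const\<^sup>2)) / (2 * ln 2 + 2 * keep_const * ln (1 - x_const\<^sup>2))"

lemma x_const_bounds: "134109/200000 \<le> x_const" "x_const \<le> 335273/500000"
  using b_const by (auto simp: x_const_def)

lemma ent_x_const: "633791280 / 1000000000 \<le> ent x_const" "ent x_const \<le> 633792015 / 1000000000"
  using ent_antimono [of x_const "335273/500000"] ent_antimono [of "134109/200000" x_const]
    x_const_bounds ent_x_hi ent_x_lo by auto

lemma keep_const_eq: "keep_const = ln 2 / (2 * ln 2 - ent x_const)"
proof -
  have "0 < 2 * ln 2 - ent x_const" using ent_x_const ln_2_bounds by simp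
  then show ?thesis
    using ent_sym [of x_const] by (simp add: keep_const_def a_const_def bin_entropy_eq_ent x_const_def field_simps)
qed

lemma keep_const_bounds: "921121/1000000 \<le> keep_const" "keep_const \<le> 921124/1000000"
proof -
  have p: "0 < 2 * ln 2 - ent x_const" using ent_x_const ln_2_bounds by simp
  show "921121/1000000 \<le> keep_const"
    unfolding keep_const_eq using ent_x_const ln_2_bounds by (subst pos_le_divide_eq [OF p]) simp
  show "keep_const \<le> 921124/1000000"
    unfolding keep_const_eq using ent_x_const ln_2_bounds by (subst pos_divide_le_eq [OF p]) simp
qed

lemma m_const_eq: "m_const = x_const * keep_const"
  by (simp add: m_const_def c_const_def keep_const_def x_const_def algebra_simps)

lemma m_const_bounds: "61765/100000 \<le> m_const" "m_const \<le> 61766/100000"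
proof -
  have "134109/200000 * (921121/1000000) \<le> x_const * keep_const"
    using x_const_bounds keep_const_bounds by (intro mult_mono) auto
  then show "61765/100000 \<le> m_const" by (simp add: m_const_eq)
  have "x_const * keep_const \<le> 335273/500000 * (921124/1000000)"
    using x_const_bounds keep_const_bounds by (intro mult_mono) auto
  then show "m_const \<le> 61766/100000" by (simp add: m_const_eq)
qed

lemma ln_b_const: "- 1110318550 / 1000000000 \<le> ln b_const" "ln b_const \<le> - 1110315490 / 1000000000"
proof -
  have "ln (164727/500000) \<le> ln b_const" "ln b_const \<le> ln (65891/200000)"
    using b_const by (auto intro: ln_mono)
  then show "- 1110318550 / 1000000000 \<le> ln b_const" "ln b_const \<le> - 1110315490 / 1000000000"
    using ln_b_lo ln_b_hi by linarith+
qed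

lemma ln_1x_const: "513149910 / 1000000000 \<le> ln (1 + x_const)" "ln (1 + x_const) \<le> 513150530 / 1000000000"
proof -
  have "ln (334109/200000) \<le> ln (1 + x_const)" "ln (1 + x_const) \<le> ln (835273/500000)"
    using x_const_bounds by (auto intro: ln_mono)
  then show "513149910 / 1000000000 \<le> ln (1 + x_const)" "ln (1 + x_const) \<le> 513150530 / 1000000000"
    using ln_1x_lo ln_1x_hi by linarith+
qed

lemma ln_one_minus_x_const_sq: "ln (1 - x_const\<^sup>2) = ln b_const + ln (1 + x_const)"
proof -
  have "1 - x_const\<^sup>2 = b_const * (1 + x_const)"
    by (simp add: x_const_def power2_eq_square algebra_simps)
  then show ?thesis using b_const x_const_bounds by (simp add: ln_mult)
qed

lemma al_const_denom: "28616/100000 \<le> 2 * ln 2 + 2 * keep_const * ln (1 - x_const\<^sup>2)"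
  "2 * ln 2 + 2 * keep_const * ln (1 - x_const\<^sup>2) \<le> 28618/100000"
proof -
  let ?L = "- ln (1 - x_const\<^sup>2)"
  have L: "597164960/1000000000 \<le> ?L" "?L \<le> 597168640/1000000000"
    using ln_b_const ln_1x_const by (simp_all add: ln_one_minus_x_const_sq)
  have "921121/1000000 * (597164960/1000000000) \<le> keep_const * ?L"
    using L keep_const_bounds by (intro mult_mono) auto
  moreover have "keep_const * ?L \<le> 921124/1000000 * (597168640/1000000000)"
    using L keep_const_bounds by (intro mult_mono) auto
  ultimately show "28616/100000 \<le> 2 * ln 2 + 2 * keep_const * ln (1 - x_const\<^sup>2)"
    "2 * ln 2 + 2 * keep_const * ln (1 - x_const\<^sup>2) \<le> 28618/100000"
    using ln_2_bounds by simp_all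
qed

text \<open>The numerator is about 0.0102, a difference of two numbers near 0.94, hence the sharp
  enclosures above.\<close>

lemma al_const_bounds: "3556/100000 \<le> al_const" "al_const \<le> 3565/100000"
proof -
  have d: "0 < 2 * ln 2 + 2 * keep_const * ln (1 - x_const\<^sup>2)" using al_const_denom by simp
  have "(2 * (921121/1000000) - 1) * (1110315490 / 1000000000) \<le> (2 * keep_const - 1) * (- ln b_const)"
    using keep_const_bounds ln_b_const by (intro mult_mono) auto
  moreover have "(2 * keep_const - 1) * (- ln b_const) \<le> (2 * (921124/1000000) - 1) * (1110318550 / 1000000000)"
    using keep_const_bounds ln_b_const by (intro mult_mono) auto
  moreover have "2 * (921121/1000000) * (513149910 / 1000000000) \<le> 2 * keep_const * ln (1 + x_const)"
    using keep_const_bounds ln_1x_const by (intro mult_mono) auto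
  moreover have "2 * keep_const * ln (1 + x_const) \<le> 2 * (921124/1000000) * (513150530 / 1000000000)"
    using keep_const_bounds ln_1x_const by (intro mult_mono) auto
  moreover have "- ln b_const + 2 * keep_const * ln (1 - x_const\<^sup>2)
      = 2 * keep_const * ln (1 + x_const) - (2 * keep_const - 1) * (- ln b_const)"
    unfolding ln_one_minus_x_const_sq by (simp add: algebra_simps)
  ultimately have "1018/100000 \<le> - ln b_const + 2 * keep_const * ln (1 - x_const\<^sup>2)"
    "- ln b_const + 2 * keep_const * ln (1 - x_const\<^sup>2) \<le> 102/10000"
    by simp_all
  then show "3556/100000 \<le> al_const" "al_const \<le> 3565/100000"
    unfolding al_const_def using al_const_denom
    by (simp_all only: pos_le_divide_eq [OF d] pos_divide_le_eq [OF d]) simp_all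
qed

interpretation sharp: kernel_params al_const m_const "2 * m_const * (1 - al_const)" "- ln x_const"
proof
  let ?k = keep_const and ?H = "ent x_const"
  have x: "0 < x_const" "x_const < 1" using x_const_bounds by auto
  have b: "b_const = 1 - x_const" by (simp add: x_const_def)
  have p: "0 < 2 * ln 2 - ?H" using ent_x_const ln_2_bounds by simp
  have k: "0 < ?k" using keep_const_bounds by simp
  have k': "?k * (2 * ln 2 - ?H) = ln 2" using p by (simp add: keep_const_eq)
  have e: "exp (- ln x_const) = 1 / x_const" using x by (simp add: exp_minus inverse_eq_divide)
  have two: "2 * - ln x_const = - ln (x_const\<^sup>2)" using x by (simp add: ln_realpow)
  show "ln (4/3) \<le> - ln x_const"
  proof -
    have "ln x_const \<le> ln (3/4)" using x_const_bounds by (intro ln_mono) auto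
    then show ?thesis by (simp add: ln_div)
  qed
  have "gap b_const = 0" by (rule b_const)
  then have "?H * (2 * ln 2 - ?H) = ln 2 * ent (x_const\<^sup>2)"
    using b_const by (subst (asm) gap_eq) (auto simp: x_const_def)
  then have "?k * (ln 2 * ent (x_const\<^sup>2)) = ?H * ln 2"
    using k' by (metis mult.commute mult.left_commute)
  \<comment> \<open>Tightness of the independent coupling for the extremal law, divided by
    \<open>?k\<close>.\<close>
  then have kE: "?k * ent (x_const\<^sup>2) = ?H" by simp
  have km: "ln 2 / m_const = (2 * ln 2 - ?H) / x_const"
    using k k' x by (simp add: m_const_eq field_simps)
  show "2 * m_const * (1 - al_const) * nu (2 * - ln x_const) - 2 * nu (- ln x_const)
      + 2 * (2 * al_const * (ln 2 * exp (- ln x_const)) - al_const * ln 2 / m_const) = 0"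
  proof -
    have n: "nu (- ln (x_const\<^sup>2)) = ent (x_const\<^sup>2) / x_const\<^sup>2" "nu (- ln x_const) = ?H / x_const"
      using x by (intro nu_minus_ln; simp)+
    have "2 * m_const * (1 - al_const) * (ent (x_const\<^sup>2) / x_const\<^sup>2)
        = 2 * (1 - al_const) * (?k * ent (x_const\<^sup>2)) / x_const"
      using x by (simp add: m_const_eq power2_eq_square)
    also have "\<dots> = 2 * (1 - al_const) * ?H / x_const" unfolding kE ..
    finally have A: "2 * m_const * (1 - al_const) * (ent (x_const\<^sup>2) / x_const\<^sup>2)
        = 2 * (1 - al_const) * ?H / x_const" .
    have B: "al_const * ln 2 / m_const = al_const * ((2 * ln 2 - ?H) / x_const)"
      unfolding km [symmetric] by simp
    \<comment> \<open>After these substitutions the terms cancel identically in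
      \<open>al_const\<close>.\<close>
    show ?thesis
      unfolding two n e A B using x by (simp add: divide_simps) (simp add: algebra_simps)
  qed
  show "2 * (2 * m_const * (1 - al_const)) * nu' (2 * - ln x_const) - 2 * nu' (- ln x_const)
      + 4 * al_const * (ln 2 * exp (- ln x_const)) = 0"
  proof -
    let ?L = "ln (1 - x_const\<^sup>2)"
    have n: "nu' (- ln (x_const\<^sup>2)) = - ?L / x_const\<^sup>2" "nu' (- ln x_const) = - ln b_const / x_const"
      using x by (simp_all add: nu'_minus_ln b)
    have "0 < 2 * ln 2 + 2 * ?k * ?L" using al_const_denom by simp
    then have "al_const * (2 * ln 2 + 2 * ?k * ?L) = - ln b_const + 2 * ?k * ?L"
      by (simp add: al_const_def)
    then have *: "2 * ?k * (1 - al_const) * - ?L + ln b_const + 2 * al_const * ln 2 = 0"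
      by (simp add: algebra_simps)
    have "2 * (2 * m_const * (1 - al_const)) * (- ?L / x_const\<^sup>2) - 2 * (- ln b_const / x_const)
        + 4 * al_const * (ln 2 * (1 / x_const))
      = 2 * (2 * ?k * (1 - al_const) * - ?L + ln b_const + 2 * al_const * ln 2) / x_const"
      using x by (simp add: m_const_eq power2_eq_square field_simps)
    then show ?thesis unfolding two n e * by simp
  qed
qed (fact al_const_bounds m_const_bounds refl)+

theorem theorem1p3:
  fixes n :: nat and F :: "nat set set"
  assumes "n \<ge> 1"
    and "F \<subseteq> Pow {1..n}"
    and "union_closed F"
    and "\<exists>A\<in>F. A \<noteq> {}"
  shows "\<exists>i\<in>{1..n}. real (card {A \<in> F. i \<in> A}) \<ge> c_const * real (card F)"
proof (cases "2 \<le> card F")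
  case True
  have fin: "finite F" using finite_subset [OF assms(2)] by simp
  have ne: "F \<noteq> {}" using assms(4) by blast
  obtain i where i: "i \<in> {1..n}" "avoid_frac i F \<le> m_const"
    using sharp.union_closed_avoid_frac [OF assms(2,3) True] by blast
  have "c_const \<le> card (containing i F) / card F"
    using i(2) one_minus_avoid_frac [OF fin ne, of i] by (simp add: m_const_def)
  then have "c_const * card F \<le> card (containing i F)"
    using fin ne by (simp add: pos_le_divide_eq card_gt_0_iff)
  then show ?thesis using i(1) by (auto simp: containing_def)
next
  case False
  obtain A i where A: "A \<in> F" "i \<in> A" using assms(4) by blast
  have "finite F" using finite_subset [OF assms(2)] by simp
  then have "card F = 1" using A False card_gt_0_iff [of F] by fastforce
  then have "F = {A}" using A by (metis card_1_singletonE singletonD)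
  then have "{A \<in> F. i \<in> A} = {A}" using A by auto
  moreover have "c_const \<le> 1" using m_const_bounds by (simp add: m_const_def)
  moreover have "i \<in> {1..n}" using A assms(2) by blast
  ultimately show ?thesis using \<open>card F = 1\<close> by (intro bexI [of _ i]) auto
qed

end
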